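(* With the notation below, the multigraded Poincaré series of the pure trace ring $U(M_n(F),ptr)$ equals $$\oint_T \prod_{i,j=1}^n\prod_{\alpha=1}^d\Bigl[1-\tfrac{z_i}{z_j}\,t(\gamma(i,j),\alpha)\Bigr]^{-1}\,d\nu(z).$$
   Context: $F$ has characteristic zero, $n=n_1+\cdots+n_t$, the index set $\{1,\dots,n\}$ is split into consecutive blocks $B_1,\dots,B_t$ of sizes $n_1,\dots,n_t$, and $e_a=\sum_{i\in B_a}e_{ii}$. $X_\alpha=(x_{ij}^{(\alpha)})$, $\alpha=1,\dots,d$, are generic matrices over $F[x_{ij}^{(\alpha)}]$. $U(M_n(F),ptr)$ is the subalgebra of $F[x_{ij}^{(\alpha)}]$ generated by all traces $tr(e_{a_1}X_{\alpha_1}e_{a_2}X_{\alpha_2}\cdots e_{a_m}X_{\alpha_m})$. For $1\le i,j\le n$, $\gamma(i,j)=(a,b)$ where $i\in B_a$, $j\in B_b$. The ring $F[x_{ij}^{(\alpha)}]$ is multigraded by giving $x_{ij}^{(\alpha)}$ the degree of the indeterminate $t(\gamma(i,j),\alpha)$; the Poincaré series is the generating function of the dimensions of the multihomogeneous components, a formal power series in the $t(a,b,\alpha)$. $T$ is the torus $|z_i|=1$ for all $i$, and $d\nu(z)=\prod_{c=1}^t\Bigl[(n_c!)^{-1}(2\pi i)^{-n_c}\prod_{i\ne j\in B_c}(1-\tfrac{z_i}{z_j})\bigwedge_{i\in B_c}\tfrac{dz_i}{z_i}\Bigr]$; the integrand is expanded as a power series in the $t$-variables and integrated coefficientwise. 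*)

theory Defs
  imports "HOL-Analysis.Analysis" "HOL-Library.Poly_Mapping"
begin

text \<open>Conventions (0-based indexing). Block sizes are given by a list ns = [n_1,...,n_t];
 n = sum_list ns, t = length ns. Matrix indices range over {0..<n}, block indices over
 {0..<t}, generic-matrix indices alpha over {0..<d}. The variable x_ij^(alpha) is indexed by
 the triple (i,j,alpha). Polynomials over F in these variables are
 ((nat*nat*nat) =>0 nat) =>0 F (monomial = finitely supported exponent vector).\<close>

type_synonym var = "nat \<times> nat \<times> nat"
type_synonym 'f mpoly = "(var \<Rightarrow>\<^sub>0 nat) \<Rightarrow>\<^sub>0 'f"

definition blockset :: "nat list \<Rightarrow> nat \<Rightarrow> nat set" where
  "blockset ns a = {sum_list (take a ns) ..< sum_list (take (Suc a) ns)}"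

definition blk :: "nat list \<Rightarrow> nat \<Rightarrow> nat" where
  "blk ns i = (THE a. a < length ns \<and> i \<in> blockset ns a)"

definition gam :: "nat list \<Rightarrow> nat \<Rightarrow> nat \<Rightarrow> nat \<times> nat" where
  "gam ns i j = (blk ns i, blk ns j)"

text \<open>Degree (index of the t-variable t(a,b,alpha)) of the variable x_ij^(alpha).\<close>
definition vdeg :: "nat list \<Rightarrow> var \<Rightarrow> var" where
  "vdeg ns v = (case v of (i, j, \<alpha>) \<Rightarrow> (blk ns i, blk ns j, \<alpha>))"

definition Var :: "var \<Rightarrow> 'f::comm_ring_1 mpoly" where
  "Var v = Poly_Mapping.single (Poly_Mapping.single v 1) 1"

definition Const :: "'f::comm_ring_1 \<Rightarrow> 'f mpoly" where
  "Const c = Poly_Mapping.single 0 c"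

definition mmul :: "nat \<Rightarrow> (nat \<Rightarrow> nat \<Rightarrow> 'a::comm_ring_1) \<Rightarrow> (nat \<Rightarrow> nat \<Rightarrow> 'a) \<Rightarrow> (nat \<Rightarrow> nat \<Rightarrow> 'a)" where
  "mmul n A B = (\<lambda>i j. \<Sum>k<n. A i k * B k j)"

definition mid :: "nat \<Rightarrow> nat \<Rightarrow> 'a::comm_ring_1" where
  "mid i j = (if i = j then 1 else 0)"

definition mtr :: "nat \<Rightarrow> (nat \<Rightarrow> nat \<Rightarrow> 'a::comm_ring_1) \<Rightarrow> 'a" where
  "mtr n A = (\<Sum>i<n. A i i)"

definition eblk :: "nat list \<Rightarrow> nat \<Rightarrow> nat \<Rightarrow> nat \<Rightarrow> 'a::comm_ring_1" where
  "eblk ns a i j = (if i = j \<and> i \<in> blockset ns a then 1 else 0)"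

definition genmat :: "nat \<Rightarrow> nat \<Rightarrow> nat \<Rightarrow> 'f::comm_ring_1 mpoly" where
  "genmat \<alpha> i j = Var (i, j, \<alpha>)"

definition wordmat :: "nat list \<Rightarrow> (nat \<times> nat) list \<Rightarrow> nat \<Rightarrow> nat \<Rightarrow> 'f::comm_ring_1 mpoly" where
  "wordmat ns w = foldr (\<lambda>(a, \<alpha>) M. mmul (sum_list ns) (mmul (sum_list ns) (eblk ns a) (genmat \<alpha>)) M) w mid"

definition ptr_gens :: "nat list \<Rightarrow> nat \<Rightarrow> 'f::comm_ring_1 mpoly set" where
  "ptr_gens ns d = {mtr (sum_list ns) (wordmat ns w) | w.
      w \<noteq> [] \<and> (\<forall>(a, \<alpha>) \<in> set w. a < length ns \<and> \<alpha> < d)}"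

inductive_set subalg :: "'f::comm_ring_1 mpoly set \<Rightarrow> 'f mpoly set" for G where
  gen: "p \<in> G \<Longrightarrow> p \<in> subalg G"
| const: "Const c \<in> subalg G"
| add: "p \<in> subalg G \<Longrightarrow> q \<in> subalg G \<Longrightarrow> p + q \<in> subalg G"
| mult: "p \<in> subalg G \<Longrightarrow> q \<in> subalg G \<Longrightarrow> p * q \<in> subalg G"

definition U_ptr :: "nat list \<Rightarrow> nat \<Rightarrow> 'f::comm_ring_1 mpoly set" where
  "U_ptr ns d = subalg (ptr_gens ns d)"

definition mdeg :: "nat list \<Rightarrow> (var \<Rightarrow>\<^sub>0 nat) \<Rightarrow> var \<Rightarrow> nat" where
  "mdeg ns e key = (\<Sum>v \<in> {v \<in> Poly_Mapping.keys e. vdeg ns v = key}. Poly_Mapping.lookup e v)"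

definition hcomp :: "nat list \<Rightarrow> 'f::comm_ring_1 mpoly set \<Rightarrow> (var \<Rightarrow> nat) \<Rightarrow> 'f mpoly set" where
  "hcomp ns S k = {p \<in> S. \<forall>e \<in> Poly_Mapping.keys p. mdeg ns e = k}"

definition fscale :: "'f::comm_ring_1 \<Rightarrow> 'f mpoly \<Rightarrow> 'f mpoly" where
  "fscale c p = Const c * p"

definition poincare_coeff :: "'f::field_char_0 itself \<Rightarrow> nat list \<Rightarrow> nat \<Rightarrow> (var \<Rightarrow> nat) \<Rightarrow> nat" where
  "poincare_coeff _ ns d k = vector_space.dim (fscale :: 'f \<Rightarrow> 'f mpoly \<Rightarrow> 'f mpoly) (hcomp ns (U_ptr ns d) k)"

definition varidx :: "nat list \<Rightarrow> nat \<Rightarrow> var set" where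
  "varidx ns d = {0..<sum_list ns} \<times> {0..<sum_list ns} \<times> {0..<d}"

text \<open>Exponent arrays m_{ij alpha} of the expansion of prod (1 - z_i/z_j t(gamma(i,j),alpha))^{-1}
  = prod sum_m (z_i/z_j)^m t^m contributing to the monomial t^k.\<close>
definition expo :: "nat list \<Rightarrow> nat \<Rightarrow> (var \<Rightarrow> nat) \<Rightarrow> (var \<Rightarrow> nat) set" where
  "expo ns d k = {m. (\<forall>v. v \<notin> varidx ns d \<longrightarrow> m v = 0) \<and>
      (\<forall>key. k key = (\<Sum>v \<in> {v \<in> varidx ns d. vdeg ns v = key}. m v))}"

definition integrand_coeff :: "nat list \<Rightarrow> nat \<Rightarrow> (var \<Rightarrow> nat) \<Rightarrow> (nat \<Rightarrow> complex) \<Rightarrow> complex" where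
  "integrand_coeff ns d k z = (\<Sum>m \<in> expo ns d k.
      \<Prod>v \<in> varidx ns d. (case v of (i, j, \<alpha>) \<Rightarrow> (z i / z j) ^ m v))"

text \<open>Density of d nu with respect to the normalized form (2 pi i)^{-n} /\ dz_i/z_i.\<close>
definition nu_density :: "nat list \<Rightarrow> (nat \<Rightarrow> complex) \<Rightarrow> complex" where
  "nu_density ns z = (\<Prod>c < length ns. inverse (of_nat (fact (ns ! c))) *
      (\<Prod>i \<in> blockset ns c. \<Prod>j \<in> blockset ns c - {i}. (1 - z i / z j)))"

text \<open>Integral over the torus |z_i| = 1 of (2 pi i)^{-n} /\ dz_i/z_i, i.e. with z_i = exp(i theta_i),
  (2 pi)^{-n} times the integral over theta in [0, 2 pi]^n.\<close>
definition torus_integral :: "nat \<Rightarrow> ((nat \<Rightarrow> complex) \<Rightarrow> complex) \<Rightarrow> complex" where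
  "torus_integral n f = complex_of_real (inverse ((2 * pi) ^ n)) *
     integral\<^sup>L (PiM {..<n} (\<lambda>_. restrict_space lborel {0..2*pi}))
       (\<lambda>\<theta>. f (\<lambda>i. cis (\<theta> i)))"

end

theory Submission
  imports Defs
    "HOL-Computational_Algebra.Polynomial"
    "HOL-Combinatorics.Transposition"
    "HOL-Analysis.Finite_Function_Topology"
    "HOL-Library.Function_Algebras"
    "HOL-Library.Nat_Bijection"
begin

text \<open>
  Both sides equal the dimension of the space of degree \<open>k\<close> polynomials that are annihilated by the
  Lie algebra \<open>\<gg> = \<Oplus>\<^sub>c \<gg>\<ll>(B\<^sub>c)\<close> of infinitesimal simultaneous conjugations.

  Trace ring: on an invariant \<open>p\<close> of degree \<open>N > 0\<close> the Casimir operator \<open>\<Sum> L\<^sub>i\<^sub>j L\<^sub>j\<^sub>i\<close> of left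
  multiplication coincides with \<open>\<Sum> L\<^sub>i\<^sub>j R\<^sub>j\<^sub>i\<close>, which writes its value through traces and invariants of
  degree \<open>N - 1\<close> (possibly with one more generic matrix, for which a product is substituted), so by
  induction it lies in the trace ring. It is positive definite for the apolar inner product, hence
  bijective on invariants of degree \<open>N\<close>.

  Integral: by the symmetry of the integrand, the Weyl density may be replaced by
  \<open>\<Prod> (1 - z\<^sub>l / z\<^sub>i)\<close> over the positive roots \<open>i < l\<close>. Its expansion makes the integral the Euler
  characteristic of the zero weight space of polynomials tensor exterior algebra. On that space
  the square of Kostant's cubic Dirac operator is half the Casimir operator, whose kernel consists of the
  invariants in exterior degree \<open>0\<close>.

  The dimension over an arbitrary field reduces to the rational one, since products of traces have
  rational coefficients.
\<close>

text \<open>Compact groups, highest weights and complete reducibility never enter: invariance is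
  infinitesimal throughout, and positivity over the reals takes their place in both halves.

  Kostant's operator would be painful to square directly because of its cubic term. It is assembled
  instead along the chain gl(1), gl(2), ... inside each block, as a sum of pairwise anticommuting
  relative operators \<open>dirac m\<close>. Twice the square of each is the difference of two
  consecutive Casimir elements up to weight operators, so the sum telescopes to the Casimir element
  of the module alone.

  The asymmetric density is what makes this fit. Each factor \<open>1 - z l / z i\<close> is the
  signed character of one fermionic mode, so no factorials are left, and the empty set of modes has
  weight 0. Compared with the usual spin module this shifts weights by half the sum of the positive
  roots, which is why the norm constant in Kostant's formula cancels on the zero weight space.

  In the trace ring the Casimir element of conjugation itself is useless, as it vanishes on
  invariants; hence the use of left multiplication.\<close>

abbreviation "lookup \<equiv> Poly_Mapping.lookup"
abbreviation "keys \<equiv> Poly_Mapping.keys"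
abbreviation "single \<equiv> Poly_Mapping.single"

section \<open>The Dirac operator as an element of a ring\<close>

lemma commute_mult:
  fixes x y z :: "'a::semigroup_mult"
  assumes "x * y = y * x" "x * z = z * x"
  shows "x * (y * z) = y * z * x"
proof -
  have "x * (y * z) = (y * x) * z" using assms(1) by (simp add: mult.assoc[symmetric])
  also have "\<dots> = y * z * x" using assms(2) by (simp add: mult.assoc)
  finally show ?thesis .
qed

lemma anticommute_mult:
  fixes x y z :: "'a::ring"
  assumes "x * y = y * x" "x * z = - (z * x)"
  shows "x * (y * z) = - (y * z * x)"
proof -
  have "x * (y * z) = (y * x) * z" using assms(1) by (simp add: mult.assoc[symmetric])
  also have "\<dots> = - (y * z * x)" using assms(2) by (simp add: mult.assoc)
  finally show ?thesis .
qed

lemma anticommute_mult2: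
  fixes x y z :: "'a::ring"
  assumes "x * y = - (y * x)" "x * z = - (z * x)"
  shows "x * (y * z) = y * z * x"
proof -
  have "x * (y * z) = - (y * x) * z" using assms(1) by (simp add: mult.assoc[symmetric])
  also have "\<dots> = - (y * (x * z))" by (simp add: mult.assoc)
  also have "\<dots> = y * z * x" using assms(2) by (simp add: mult.assoc)
  finally show ?thesis .
qed

lemma commute_diff:
  fixes x y z :: "'a::ring"
  assumes "x * y = y * x" "x * z = z * x"
  shows "x * (y - z) = (y - z) * x"
  using assms by (simp add: algebra_simps)

lemma commute_add:
  fixes x y z :: "'a::ring"
  assumes "x * y = y * x" "x * z = z * x"
  shows "x * (y + z) = (y + z) * x"
  using assms by (simp add: algebra_simps)

lemma anticommute_add:
  fixes x y z :: "'a::ring"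
  assumes "x * y = - (y * x)" "x * z = - (z * x)"
  shows "x * (y + z) = - ((y + z) * x)"
  using assms by (simp add: algebra_simps)

lemma commute_sum:
  fixes x :: "'a::ring"
  assumes "\<And>i. i \<in> A \<Longrightarrow> x * f i = f i * x"
  shows "x * sum f A = sum f A * x"
  using assms by (simp add: sum_distrib_left sum_distrib_right)

lemma anticommute_sum:
  fixes x :: "'a::ring"
  assumes "\<And>i. i \<in> A \<Longrightarrow> x * f i = - (f i * x)"
  shows "x * sum f A = - (sum f A * x)"
  using assms by (simp add: sum_distrib_left sum_distrib_right sum_negf)

text \<open>All identities of the Dirac operator hold in an abstract ring; the Fock space that
  realizes it comes later. \<open>E i j\<close> stands for the action of a matrix unit,
  \<open>c i j\<close> and \<open>b i j\<close> for creation and annihilation of a fermion in mode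
  \<open>(i, j)\<close>, and \<open>r\<close> for membership in a common block. The commutators are
  those of the full general linear algebra; \<open>r\<close> only selects the terms that enter the
  operators.\<close>

locale gl_fermions =
  fixes n :: nat and r :: "nat \<Rightarrow> nat \<Rightarrow> bool"
    and E c b :: "nat \<Rightarrow> nat \<Rightarrow> 'a::ring_1"
  assumes r_refl: "r i i" and r_sym: "r i j \<Longrightarrow> r j i" and r_trans: "r i j \<Longrightarrow> r j k \<Longrightarrow> r i k"
    and E_E: "E i j * E k l = E k l * E i j + (if j = k then E i l else 0) - (if l = i then E k j else 0)"
    and E_c: "E i j * c k l = c k l * E i j"
    and E_b: "E i j * b k l = b k l * E i j"
    and c_c: "c i j * c k l = - (c k l * c i j)"
    and b_b: "b i j * b k l = - (b k l * b i j)"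
    and b_c: "b i j * c k l = (if i = k \<and> j = l then 1 else 0) - c k l * b i j"
begin

text \<open>The action of \<open>\<gg>\<ll>\<^sub>m\<close>, for the indices below \<open>m\<close>, on the module tensor the exterior algebra in the
  modes \<open>(i, l)\<close> with \<open>l \<ge> m\<close>. The cubic terms of Kostant's operator are hidden in it.\<close>

definition diag_E :: "nat \<Rightarrow> nat \<Rightarrow> nat \<Rightarrow> 'a" where
  "diag_E m i j = E i j - (\<Sum>l\<in>{l. m \<le> l \<and> l < n \<and> r i l}. c j l * b i l)"

definition below :: "nat \<Rightarrow> nat set" where
  "below m = {i. i < m \<and> r i m}"

text \<open>The relative Dirac operator of gl(m+1) over gl(m) + gl(1), restricted to the block of
  \<open>m\<close>. Its odd directions are the roots that join \<open>m\<close> to smaller indices.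
  As \<open>diag_E (Suc m)\<close> involves only modes \<open>(i, l)\<close> with
  \<open>l > m\<close>, it commutes with the fermions \<open>c i m\<close> and \<open>b i m\<close>
  beside it.\<close>

definition dirac :: "nat \<Rightarrow> 'a" where
  "dirac m = (\<Sum>i\<in>below m. diag_E (Suc m) i m * c i m + diag_E (Suc m) m i * b i m)"

text \<open>The total weight of index \<open>m\<close>; the modes \<open>(m, l)\<close> with \<open>l > m\<close> enter through \<open>diag_E\<close>.\<close>

definition weight_op :: "nat \<Rightarrow> 'a" where
  "weight_op m = diag_E (Suc m) m m + (\<Sum>i\<in>below m. c i m * b i m)"

definition casimir :: "nat \<Rightarrow> 'a" where
  "casimir m = (\<Sum>i<m. \<Sum>j\<in>{j. j < m \<and> r i j}. diag_E m i j * diag_E m j i)"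

lemma finite_below [simp]: "finite (below m)"
proof -
  have "below m \<subseteq> {..<m}" unfolding below_def by blast
  then show ?thesis using finite_subset by blast
qed

lemma diag_E_n: "diag_E n i j = E i j"
proof -
  have "{l. n \<le> l \<and> l < n \<and> r i l} = {}" by force
  then show ?thesis unfolding diag_E_def by (simp only: sum.empty diff_zero)
qed

lemma diag_E_step:
  assumes "m < n"
  shows "diag_E m i j = diag_E (Suc m) i j - (if r i m then c j m * b i m else 0)"
proof -
  have "{l. m \<le> l \<and> l < n \<and> r i l} = (if r i m then insert m {l. Suc m \<le> l \<and> l < n \<and> r i l} else {l. Suc m \<le> l \<and> l < n \<and> r i l})"
    using assms by (auto simp: le_less Suc_le_eq)
  then show ?thesis by (simp add: diag_E_def algebra_simps)
qed

section \<open>Fermion bilinears and the diagonal action\<close>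

lemma cb_c: "c j l * b i l * c k m = c k m * (c j l * b i l) + (if i = k \<and> l = m then c j l else 0)"
proof -
  have "c j l * b i l * c k m = c j l * (b i l * c k m)" by (simp add: mult.assoc)
  also have "\<dots> = c j l * ((if i = k \<and> l = m then 1 else 0) - c k m * b i l)" by (simp only: b_c)
  also have "\<dots> = (if i = k \<and> l = m then c j l else 0) - (c j l * c k m) * b i l"
    by (simp add: algebra_simps)
  also have "c j l * c k m = - (c k m * c j l)" by (rule c_c)
  finally show ?thesis by (simp add: algebra_simps)
qed

lemma cb_b: "c j l * b i l * b k m = b k m * (c j l * b i l) - (if j = k \<and> l = m then b i l else 0)"
proof -
  have "c j l * b i l * b k m = - (c j l * (b k m * b i l))"
    by (subst b_b[of k m]) (simp add: mult.assoc)
  also have "\<dots> = - ((c j l * b k m) * b i l)" by (simp add: mult.assoc)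
  also have "c j l * b k m = (if k = j \<and> m = l then 1 else 0) - b k m * c j l"
    by (simp add: b_c)
  finally show ?thesis by (auto simp add: algebra_simps)
qed

lemma cb_cb: "c j l * b i l * (c q m * b p m) = c q m * b p m * (c j l * b i l)
   + (if i = q \<and> l = m then c j l * b p m else 0) - (if j = p \<and> l = m then c q m * b i l else 0)"
proof -
  have "c j l * b i l * (c q m * b p m) = (c j l * b i l * c q m) * b p m" by (simp add: mult.assoc)
  also have "\<dots> = c q m * (c j l * b i l * b p m) + (if i = q \<and> l = m then c j l * b p m else 0)"
    by (subst cb_c) (simp add: algebra_simps)
  also have "\<dots> = c q m * (b p m * (c j l * b i l)) - c q m * (if j = p \<and> l = m then b i l else 0) + (if i = q \<and> l = m then c j l * b p m else 0)"
    by (subst cb_b) (simp add: algebra_simps)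
  finally show ?thesis by (auto simp add: algebra_simps)
qed

lemma diag_E_c: "l < m \<Longrightarrow> diag_E m i j * c k l = c k l * diag_E m i j"
  unfolding diag_E_def left_diff_distrib right_diff_distrib sum_distrib_left sum_distrib_right E_c
  by (subst cb_c) (auto intro!: sum.cong)

lemma diag_E_b: "l < m \<Longrightarrow> diag_E m i j * b k l = b k l * diag_E m i j"
  unfolding diag_E_def left_diff_distrib right_diff_distrib sum_distrib_left sum_distrib_right E_b
  by (subst cb_b) (auto intro!: sum.cong)

lemma diag_E_cb: "l < m \<Longrightarrow> diag_E m i j * (c p l * b q l) = c p l * b q l * diag_E m i j"
  by (intro commute_mult diag_E_b diag_E_c)

text \<open>Minus the transpose is an automorphism of the general linear algebra, so the terms
  \<open>- c j m * b i m\<close> satisfy the relations of \<open>E i j\<close>; they also commute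
  with \<open>diag_E (Suc m)\<close>. Descending induction from \<open>m = n\<close> therefore adds
  one column of modes at a time. The hypotheses on \<open>r\<close> ensure that contracted terms see
  column \<open>m\<close> either on both sides or on neither.\<close>

lemma diag_E_ee:
  assumes "m \<le> n" "r i j" "r k l"
  shows "diag_E m i j * diag_E m k l = diag_E m k l * diag_E m i j + (if j = k then diag_E m i l else 0) - (if l = i then diag_E m k j else 0)"
  using assms
proof (induction m arbitrary: i j k l rule: inc_induct)
  case base
  show ?case unfolding diag_E_n by (rule E_E)
next
  case (step m)
  let ?N = "\<lambda>i j. if r i m then c j m * b i m else 0"
  have a: "diag_E (Suc m) p q * ?N s t = ?N s t * diag_E (Suc m) p q" for p q s t
    by (simp add: diag_E_cb)
  have b: "?N i j * ?N k l = ?N k l * ?N i j + (if i = l then ?N k j else 0) - (if j = k then ?N i l else 0)"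
  proof (cases "r i m \<and> r k m")
    case True
    have "c j m * b i m * (c l m * b k m) = c l m * b k m * (c j m * b i m)
       + (if i = l \<and> m = m then c j m * b k m else 0) - (if j = k \<and> m = m then c l m * b i m else 0)"
      by (rule cb_cb)
    then show ?thesis using True by simp
  next
    case False
    then have "\<not> r i m \<or> \<not> r k m" by blast
    moreover have "j = k \<Longrightarrow> r i m = r k m" "i = l \<Longrightarrow> r i m = r k m"
      using step.prems r_sym r_trans by blast+
    ultimately show ?thesis by auto
  qed
  have "diag_E m i j * diag_E m k l = diag_E (Suc m) i j * diag_E (Suc m) k l - diag_E (Suc m) i j * ?N k l - ?N i j * diag_E (Suc m) k l + ?N i j * ?N k l"
    by (simp only: diag_E_step[OF step(2)] algebra_simps)
  also have "\<dots> = (diag_E (Suc m) k l * diag_E (Suc m) i j + (if j = k then diag_E (Suc m) i l else 0) - (if l = i then diag_E (Suc m) k j else 0))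
     - ?N k l * diag_E (Suc m) i j - diag_E (Suc m) k l * ?N i j +
      (?N k l * ?N i j + (if i = l then ?N k j else 0) - (if j = k then ?N i l else 0))"
    by (simp only: step.IH[OF step.prems] a b)
  also have "\<dots> = diag_E m k l * diag_E m i j + (if j = k then diag_E m i l else 0) - (if l = i then diag_E m k j else 0)"
    by (simp only: diag_E_step[OF step(2)]) (simp add: algebra_simps)
  finally show ?case .
qed


lemma c_cb_commute: "l < m \<Longrightarrow> c i l * (c p m * b q m) = c p m * b q m * c i l"
  by (subst cb_c) simp

lemma b_cb_commute: "l < m \<Longrightarrow> b i l * (c p m * b q m) = c p m * b q m * b i l"
  by (subst cb_b) simp

lemma weight_op_c: "l < m \<Longrightarrow> c i l * weight_op m = weight_op m * c i l"
  unfolding weight_op_def by (intro commute_add commute_sum c_cb_commute) (simp_all add: diag_E_c)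

lemma weight_op_b: "l < m \<Longrightarrow> b i l * weight_op m = weight_op m * b i l"
  unfolding weight_op_def by (intro commute_add commute_sum b_cb_commute) (simp_all add: diag_E_b)

lemma weight_op_diag_E:
  assumes m: "m < n" and ij: "i < m" "j < m" "r i j"
  shows "weight_op m * diag_E m i j = diag_E m i j * weight_op m"
proof -
  let ?e = "diag_E (Suc m)" and ?N = "\<Sum>k\<in>below m. c k m * b k m"
  have a: "?e m m * ?e i j = ?e i j * ?e m m"
  proof -
    have "?e m m * ?e i j = ?e i j * ?e m m + (if m = i then ?e m j else 0) - (if j = m then ?e i m else 0)"
      using m ij r_refl by (intro diag_E_ee) simp_all
    then show ?thesis using ij by simp
  qed
  have b: "?N * ?e i j = ?e i j * ?N"
    by (rule sym, intro commute_sum diag_E_cb) simp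
  have c: "?N * (c j m * b i m) = (c j m * b i m) * ?N" if "r i m"
  proof -
    have "j \<in> below m" "i \<in> below m"
      using that ij r_trans[OF r_sym[OF ij(3)], of m] unfolding below_def by blast+
    have "?N * (c j m * b i m) = (\<Sum>k\<in>below m. c j m * b i m * (c k m * b k m)
       + (if k = j then c k m * b i m else 0) - (if k = i then c j m * b k m else 0))"
      unfolding sum_distrib_right by (intro sum.cong refl, subst cb_cb) auto
    also have "\<dots> = (c j m * b i m) * ?N"
      using \<open>i \<in> below m\<close> \<open>j \<in> below m\<close> by (simp add: sum_distrib_left sum.distrib sum_subtractf)
    finally show ?thesis .
  qed
  have d: "?e m m * (c j m * b i m) = (c j m * b i m) * ?e m m"
    by (intro diag_E_cb) simp
  have "(?e m m + ?N) * (?e i j - (if r i m then c j m * b i m else 0)) = (?e i j - (if r i m then c j m * b i m else 0)) * (?e m m + ?N)"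
    using a b c d by (simp add: algebra_simps)
  then show ?thesis unfolding weight_op_def diag_E_step[OF m] .
qed

section \<open>The relative Dirac operators of the chain\<close>

lemma below_iff: "i \<in> below m \<longleftrightarrow> i < m \<and> r i m"
  unfolding below_def by blast

text \<open>\<open>dirac m\<close> contracts the vectors \<open>diag_E (Suc m) i m\<close> and
  \<open>diag_E (Suc m) m i\<close> with fermions that transform dually under gl(m). The invariance
  needs the diagonal action \<open>diag_E m\<close>, whose fermionic part in column \<open>m\<close>
  rotates \<open>c i m\<close> and \<open>b i m\<close>.\<close>

lemma dirac_diag_E:
  assumes m: "m < n" and ij: "i < m" "j < m" "r i j"
  shows "dirac m * diag_E m i j = diag_E m i j * dirac m"
proof -
  let ?e = "diag_E (Suc m)"
  let ?X = "\<lambda>k. ?e k m * c k m + ?e m k * b k m"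
  have sm: "Suc m \<le> n" using m by simp
  have e1: "?e i j * ?e k m = ?e k m * ?e i j + (if j = k then ?e i m else 0)" if "k \<in> below m" for k
  proof -
    have "?e i j * ?e k m = ?e k m * ?e i j + (if j = k then ?e i m else 0) - (if m = i then ?e k j else 0)"
      using that by (intro diag_E_ee[OF sm ij(3)]) (simp add: below_iff)
    then show ?thesis using ij by simp
  qed
  have e2: "?e i j * ?e m k = ?e m k * ?e i j - (if k = i then ?e m j else 0)" if "k \<in> below m" for k
  proof -
    have "r m k" using that r_sym by (simp add: below_iff)
    then have "?e i j * ?e m k = ?e m k * ?e i j + (if j = m then ?e i k else 0) - (if k = i then ?e m j else 0)"
      by (intro diag_E_ee[OF sm ij(3)])
    then show ?thesis using ij by simp
  qed
  have ec: "?e p q * c k m = c k m * ?e p q" "?e p q * b k m = b k m * ?e p q" for p q k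
    by (simp_all add: diag_E_c diag_E_b)
  have eX: "?e i j * ?X k = ?X k * ?e i j + (if j = k then ?e i m * c j m else 0) - (if k = i then ?e m j * b i m else 0)"
    if "k \<in> below m" for k
  proof -
    have "?e i j * ?X k = (?e i j * ?e k m) * c k m + (?e i j * ?e m k) * b k m"
      by (simp add: distrib_left mult.assoc)
    also have "\<dots> = ?e k m * (?e i j * c k m) + ?e m k * (?e i j * b k m) + (if j = k then ?e i m * c j m else 0) - (if k = i then ?e m j * b i m else 0)"
      unfolding e1[OF that] e2[OF that] by (simp add: algebra_simps)
    finally show ?thesis by (simp only: ec[of i j k]) (simp add: distrib_right mult.assoc)
  qed
  \<comment> \<open>Since \<open>i\<close> and \<open>j\<close> lie in one block, both of them are
    joined to \<open>m\<close> or neither is. The defects of the two brackets computed below, for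
    \<open>diag_E (Suc m) i j\<close> and for the bilinear, then coincide and cancel in the
    difference \<open>diag_E m i j\<close>.\<close>
  have "r i m = r j m"
    using r_trans[OF ij(3), of m] r_trans[OF r_sym[OF ij(3)], of m] by blast
  then have split: "i \<in> below m \<and> j \<in> below m \<and> r i m \<or> i \<notin> below m \<and> j \<notin> below m \<and> \<not> r i m"
    using ij unfolding below_iff by simp
  have NX: "c j m * b i m * ?X k = ?X k * (c j m * b i m) + (if i = k then ?e i m * c j m else 0) - (if j = k then ?e m j * b i m else 0)" for k
  proof -
    have a: "c j m * b i m * (?e p q * z) = ?e p q * (c j m * b i m * z)" for p q z
      using diag_E_cb[of m "Suc m" p q j i] by (simp add: mult.assoc[symmetric])
    have "c j m * b i m * ?X k = ?e k m * (c j m * b i m * c k m) + ?e m k * (c j m * b i m * b k m)"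
      by (simp only: distrib_left a)
    also have "\<dots> = ?e k m * (c k m * (c j m * b i m) + (if i = k \<and> m = m then c j m else 0)) + ?e m k * (b k m * (c j m * b i m) - (if j = k \<and> m = m then b i m else 0))"
      by (simp only: cb_c cb_b)
    also have "\<dots> = ?X k * (c j m * b i m) + (if i = k then ?e i m * c j m else 0) - (if j = k then ?e m j * b i m else 0)"
      by (simp add: algebra_simps)
    finally show ?thesis .
  qed
  have "?e i j * dirac m = dirac m * ?e i j + (if j \<in> below m then ?e i m * c j m else 0) - (if i \<in> below m then ?e m j * b i m else 0)"
    unfolding dirac_def sum_distrib_left sum_distrib_right
    by (simp add: eX sum.distrib sum_subtractf cong: sum.cong)
  moreover have "c j m * b i m * dirac m = dirac m * (c j m * b i m) + (if i \<in> below m then ?e i m * c j m else 0) - (if j \<in> below m then ?e m j * b i m else 0)"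
    unfolding dirac_def sum_distrib_left sum_distrib_right
    by (simp only: NX) (simp add: sum.distrib sum_subtractf)
  ultimately show ?thesis
    using split unfolding diag_E_step[OF m] by (auto simp: left_diff_distrib right_diff_distrib)
qed

lemma dirac_c: "l < m \<Longrightarrow> c i l * dirac m = - (dirac m * c i l)"
  unfolding dirac_def
  by (intro anticommute_sum anticommute_add anticommute_mult c_c) (simp_all add: diag_E_c b_c)

lemma dirac_b: "l < m \<Longrightarrow> b i l * dirac m = - (dirac m * b i l)"
  unfolding dirac_def
  by (intro anticommute_sum anticommute_add anticommute_mult b_b) (simp_all add: diag_E_b b_c)

lemma diag_E_lower:
  assumes "m' \<le> m" "m \<le> n"
  shows "diag_E m' i j = diag_E m i j - (\<Sum>l\<in>{l. m' \<le> l \<and> l < m \<and> r i l}. c j l * b i l)"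
proof -
  have fin: "finite {l. p \<le> l \<and> l < q \<and> r i l}" for p q
    by (rule finite_subset[of _ "{..<q}"]) auto
  have "{l. m' \<le> l \<and> l < n \<and> r i l} = {l. m' \<le> l \<and> l < m \<and> r i l} \<union> {l. m \<le> l \<and> l < n \<and> r i l}"
    using assms by auto
  then have "(\<Sum>l\<in>{l. m' \<le> l \<and> l < n \<and> r i l}. c j l * b i l) =
     (\<Sum>l\<in>{l. m' \<le> l \<and> l < m \<and> r i l}. c j l * b i l) + (\<Sum>l\<in>{l. m \<le> l \<and> l < n \<and> r i l}. c j l * b i l)"
    by (simp only:) (rule sum.union_disjoint[OF fin fin], rule Int_emptyI, simp)
  then show ?thesis by (simp add: diag_E_def)
qed

lemma dirac_diag_E_lower:
  assumes "m' \<le> m" "m < n" "i < m" "j < m" "r i j"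
  shows "dirac m * diag_E m' i j = diag_E m' i j * dirac m"
proof -
  have "dirac m * (c j l * b i l) = c j l * b i l * dirac m" if "l < m" for l
    using that by (intro anticommute_mult2) (simp_all add: dirac_c dirac_b)
  then show ?thesis
    using assms unfolding diag_E_lower[OF assms(1) less_imp_le[OF assms(2)]]
    by (intro commute_diff commute_sum) (simp_all add: dirac_diag_E)
qed

lemma weight_op_diag_E_lower:
  assumes "m' \<le> m" "m < n" "i < m" "j < m" "r i j"
  shows "weight_op m * diag_E m' i j = diag_E m' i j * weight_op m"
proof -
  have "weight_op m * (c j l * b i l) = c j l * b i l * weight_op m" if "l < m" for l
    using that by (intro commute_mult) (simp_all add: weight_op_c weight_op_b)
  then show ?thesis
    using assms unfolding diag_E_lower[OF assms(1) less_imp_le[OF assms(2)]]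
    by (intro commute_diff commute_sum) (simp_all add: weight_op_diag_E)
qed

text \<open>The even factors of \<open>dirac m\<close> have indices below \<open>m'\<close>, so by
  invariance they commute with \<open>dirac m'\<close>; the one fermion in each term anticommutes
  with it.\<close>

lemma dirac_dirac:
  assumes "m < m'" "m' < n"
  shows "dirac m' * dirac m = - (dirac m * dirac m')"
  unfolding dirac_def[of m]
proof (intro anticommute_sum anticommute_add anticommute_mult)
  fix i assume "i \<in> below m"
  then have i: "i < m" "r i m" "r m i" using r_sym by (simp_all add: below_iff)
  show "dirac m' * diag_E (Suc m) i m = diag_E (Suc m) i m * dirac m'"
    "dirac m' * diag_E (Suc m) m i = diag_E (Suc m) m i * dirac m'"
    using i assms by (simp_all add: dirac_diag_E_lower)
  show "dirac m' * c i m = - (c i m * dirac m')" "dirac m' * b i m = - (b i m * dirac m')"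
    using assms by (simp_all add: dirac_c dirac_b)
qed

text \<open>For distinct indices this follows from commuting factors and from the invariance of
  \<open>dirac m\<close>. For equal indices every term is neutral: \<open>diag_E (Suc m) k m\<close>
  lowers the weight of \<open>m\<close> by one while \<open>c k m\<close> raises it, and the reverse
  holds for \<open>diag_E (Suc m) m k\<close> and \<open>b k m\<close>.\<close>

lemma weight_op_dirac:
  assumes "m < n" "m' < n"
  shows "weight_op m' * dirac m = dirac m * weight_op m'"
proof (rule linorder_cases[of m m'])
  assume less: "m < m'"
  show ?thesis unfolding dirac_def[of m]
  proof (intro commute_sum commute_add commute_mult)
    fix i assume "i \<in> below m"
    then have i: "i < m" "r i m" "r m i" using r_sym by (simp_all add: below_iff)
    show "weight_op m' * diag_E (Suc m) i m = diag_E (Suc m) i m * weight_op m'"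
      "weight_op m' * diag_E (Suc m) m i = diag_E (Suc m) m i * weight_op m'"
      using i assms less by (simp_all add: weight_op_diag_E_lower)
    show "weight_op m' * c i m = c i m * weight_op m'" "weight_op m' * b i m = b i m * weight_op m'"
      using less by (simp_all add: weight_op_c weight_op_b)
  qed
next
  assume less: "m' < m"
  have "dirac m * weight_op m' = weight_op m' * dirac m" unfolding weight_op_def
  proof (intro commute_add commute_sum anticommute_mult2)
    show "dirac m * diag_E (Suc m') m' m' = diag_E (Suc m') m' m' * dirac m"
      using less assms r_refl by (intro dirac_diag_E_lower) simp_all
    show "dirac m * c i m' = - (c i m' * dirac m)" "dirac m * b i m' = - (b i m' * dirac m)" for i
      using less by (simp_all add: dirac_c dirac_b)
  qed
  then show ?thesis by simp
next
  assume eq: "m = m'"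
  let ?e = "diag_E (Suc m)" and ?N = "\<Sum>k\<in>below m. c k m * b k m"
  have sm: "Suc m \<le> n" using assms by simp
  have "weight_op m * dirac m = dirac m * weight_op m" unfolding dirac_def
  proof (intro commute_sum)
    fix k assume k: "k \<in> below m"
    then have k': "k < m" "r k m" "r m k" using r_sym by (simp_all add: below_iff)
    have "?e m m * ?e k m = ?e k m * ?e m m + (if m = k then ?e m m else 0) - (if m = m then ?e k m else 0)"
      by (intro diag_E_ee sm r_refl k')
    then have e1: "?e m m * ?e k m = ?e k m * ?e m m - ?e k m" using k' by simp
    have "?e m m * ?e m k = ?e m k * ?e m m + (if m = m then ?e m k else 0) - (if k = m then ?e m m else 0)"
      by (intro diag_E_ee sm r_refl k')
    then have e2: "?e m m * ?e m k = ?e m k * ?e m m + ?e m k" using k' by simp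
    have "?N * c k m = (\<Sum>i\<in>below m. c k m * (c i m * b i m) + (if i = k then c i m else 0))"
      unfolding sum_distrib_right by (intro sum.cong refl, subst cb_c) auto
    then have n1: "?N * c k m = c k m * ?N + c k m"
      using k by (simp add: sum.distrib sum_distrib_left)
    have "?N * b k m = (\<Sum>i\<in>below m. b k m * (c i m * b i m) - (if i = k then b i m else 0))"
      unfolding sum_distrib_right by (intro sum.cong refl, subst cb_b) auto
    then have n2: "?N * b k m = b k m * ?N - b k m"
      using k by (simp add: sum_subtractf sum_distrib_left)
    have n3: "?N * ?e i j = ?e i j * ?N" for i j
      by (rule sym, intro commute_sum diag_E_cb) simp
    have ec: "?e p q * c k m = c k m * ?e p q" "?e p q * b k m = b k m * ?e p q" for p q
      by (simp_all add: diag_E_c diag_E_b)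
    have h1: "weight_op m * ?e k m = ?e k m * weight_op m - ?e k m" "weight_op m * ?e m k = ?e m k * weight_op m + ?e m k"
      unfolding weight_op_def using e1 e2 n3[of k m] n3[of m k] by (simp_all add: algebra_simps)
    have h2: "weight_op m * c k m = c k m * weight_op m + c k m" "weight_op m * b k m = b k m * weight_op m - b k m"
      unfolding weight_op_def using n1 n2 ec[of m m] by (simp_all add: algebra_simps)
    have "weight_op m * (?e k m * c k m + ?e m k * b k m) = (weight_op m * ?e k m) * c k m + (weight_op m * ?e m k) * b k m"
      by (simp add: algebra_simps)
    also have "\<dots> = ?e k m * (weight_op m * c k m) - ?e k m * c k m + ?e m k * (weight_op m * b k m) + ?e m k * b k m"
      unfolding h1 by (simp add: algebra_simps)
    also have "\<dots> = (?e k m * c k m + ?e m k * b k m) * weight_op m"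
      unfolding h2 by (simp add: algebra_simps)
    finally show "weight_op m * (?e k m * c k m + ?e m k * b k m) = (?e k m * c k m + ?e m k * b k m) * weight_op m" .
  qed
  then show ?thesis using eq by simp
qed

text \<open>A mode \<open>(j, l)\<close> with both ends below \<open>m\<close> counts with opposite
  signs in the weights of \<open>j\<close> and of \<open>l\<close>, so it cancels in the sum over
  the block. Only the modes with \<open>l\<close> at least \<open>m\<close> survive, and these are
  the ones inside \<open>diag_E m\<close>.\<close>

lemma sum_diag_E_below:
  assumes "m \<le> n"
  shows "(\<Sum>i\<in>below m. diag_E m i i) = (\<Sum>j\<in>below m. weight_op j)"
proof -
  have fin: "finite {l. p \<le> l \<and> l < q \<and> r i l}" for p q i
    by (rule finite_subset[of _ "{..<q}"]) auto
  have "(\<Sum>j\<in>below m. weight_op j) = (\<Sum>j\<in>below m. diag_E m j j - (\<Sum>l\<in>{l. Suc j \<le> l \<and> l < m \<and> r j l}. c j l * b j l) + (\<Sum>i\<in>below j. c i j * b i j))"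
    using assms by (intro sum.cong refl) (simp add: weight_op_def below_iff diag_E_lower[of "Suc _" m])
  also have "\<dots> = (\<Sum>j\<in>below m. diag_E m j j) - (\<Sum>j\<in>below m. \<Sum>l\<in>{l. Suc j \<le> l \<and> l < m \<and> r j l}. c j l * b j l)
     + (\<Sum>j\<in>below m. \<Sum>i\<in>below j. c i j * b i j)"
    by (simp only: sum.distrib sum_subtractf)
  also have "(\<Sum>j\<in>below m. \<Sum>l\<in>{l. Suc j \<le> l \<and> l < m \<and> r j l}. c j l * b j l) = (\<Sum>j\<in>below m. \<Sum>l\<in>below m. if j < l then c j l * b j l else 0)"
  proof (rule sum.cong[OF refl])
    fix j assume j: "j \<in> below m"
    have "r j l = r l m" for l
      using j r_sym[of j l] r_sym[of l j] r_trans[of l j m] r_trans[of j m l] r_sym[of l m] unfolding below_iff by blast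
    then have eq: "{l. Suc j \<le> l \<and> l < m \<and> r j l} = {l \<in> below m. j < l}" unfolding below_def by auto
    show "(\<Sum>l\<in>{l. Suc j \<le> l \<and> l < m \<and> r j l}. c j l * b j l) = (\<Sum>l\<in>below m. if j < l then c j l * b j l else 0)"
      unfolding eq by (intro sum.inter_filter finite_below)
  qed
  also have "\<dots> = (\<Sum>l\<in>below m. \<Sum>j\<in>below m. if j < l then c j l * b j l else 0)"
    by (rule sum.swap)
  also have "(\<Sum>j\<in>below m. \<Sum>i\<in>below j. c i j * b i j) = (\<Sum>l\<in>below m. \<Sum>j\<in>below m. if j < l then c j l * b j l else 0)"
  proof (rule sum.cong[OF refl])
    fix l assume l: "l \<in> below m"
    have "r j l = r j m" for j
      using l r_sym[of l m] r_trans[of j l m] r_trans[of j m l] unfolding below_iff by blast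
    then have eq: "below l = {j \<in> below m. j < l}" using l unfolding below_def by auto
    show "(\<Sum>i\<in>below l. c i l * b i l) = (\<Sum>j\<in>below m. if j < l then c j l * b j l else 0)"
      unfolding eq by (intro sum.inter_filter finite_below)
  qed
  finally show ?thesis by simp
qed

text \<open>Let \<open>P\<close> and \<open>Q\<close> be the \<open>c\<close> and \<open>b\<close>
  parts of \<open>dirac m\<close>. Their doubled squares vanish, because commuting coefficients are
  paired with anticommuting fermions, and the cross terms give \<open>A + T - e m m * N\<close>.
  Both Casimir elements are then expanded in the same quantities. Everything is doubled because 2
  need not be invertible in the ring.\<close>

lemma dirac_square:
  assumes m: "m < n"
  shows "dirac m * dirac m + dirac m * dirac m = casimir (Suc m) - casimir m
     - weight_op m * weight_op m + of_nat (card (below m)) * weight_op m - (\<Sum>i\<in>below m. diag_E m i i)"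
proof -
  let ?e = "diag_E (Suc m)" and ?I = "below m"
  define e where "e = diag_E (Suc m)"
  define C where "C k = c k m" for k
  define B where "B k = b k m" for k
  define N where "N = (\<Sum>k\<in>?I. C k * B k)"
  define A where "A = (\<Sum>k\<in>?I. e m k * e k m)"
  define T where "T = (\<Sum>i\<in>?I. \<Sum>j\<in>?I. e i j * (C i * B j))"
  define F where "F = (\<Sum>i\<in>?I. e i i)"
  define q where "q = (of_nat (card ?I) :: 'a)"
  have sm: "Suc m \<le> n" using m by simp
  have rI: "r i m" "r m i" "i < m" "r i i" if "i \<in> ?I" for i using that r_sym r_refl by (simp_all add: below_iff)
  have rII: "r i j" if "i \<in> ?I" "j \<in> ?I" for i j using rI[OF that(1)] rI[OF that(2)] r_trans[of i m j] by blast
  have CC: "C i * C j = - (C j * C i)" for i j unfolding C_def by (rule c_c)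
  have BB: "B i * B j = - (B j * B i)" for i j unfolding B_def by (rule b_b)
  have BC: "B i * C j = (if i = j then 1 else 0) - C j * B i" for i j unfolding B_def C_def by (simp add: b_c)
  have eC: "e i j * C k = C k * e i j" for i j k unfolding e_def C_def by (simp add: diag_E_c)
  have eB: "e i j * B k = B k * e i j" for i j k unfolding e_def B_def by (simp add: diag_E_b)
  have ee1: "e i m * e j m = e j m * e i m" if "i \<in> ?I" "j \<in> ?I" for i j
    using diag_E_ee[OF sm rI(1)[OF that(1)] rI(1)[OF that(2)]] rI(3)[OF that(1)] rI(3)[OF that(2)] unfolding e_def by simp
  have ee2: "e m i * e m j = e m j * e m i" if "i \<in> ?I" "j \<in> ?I" for i j
    using diag_E_ee[OF sm rI(2)[OF that(1)] rI(2)[OF that(2)]] rI(3)[OF that(1)] rI(3)[OF that(2)] unfolding e_def by simp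
  have ee3: "e i m * e m j = e m j * e i m + e i j - (if i = j then e m m else 0)" if "i \<in> ?I" "j \<in> ?I" for i j
    using diag_E_ee[OF sm rI(1)[OF that(1)] rI(2)[OF that(2)]] unfolding e_def by simp
  have zero: "(\<Sum>i\<in>?I. \<Sum>j\<in>?I. f i j) + (\<Sum>i\<in>?I. \<Sum>j\<in>?I. f i j) = 0"
    if "\<And>i j. i \<in> ?I \<Longrightarrow> j \<in> ?I \<Longrightarrow> f i j = - f j i" for f :: "nat \<Rightarrow> nat \<Rightarrow> 'a"
  proof -
    have "(\<Sum>i\<in>?I. \<Sum>j\<in>?I. f i j) = (\<Sum>i\<in>?I. \<Sum>j\<in>?I. - f j i)" by (intro sum.cong refl that)
    also have "\<dots> = - (\<Sum>i\<in>?I. \<Sum>j\<in>?I. f j i)" by (simp add: sum_negf)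
    also have "(\<Sum>i\<in>?I. \<Sum>j\<in>?I. f j i) = (\<Sum>i\<in>?I. \<Sum>j\<in>?I. f i j)" by (rule sum.swap)
    finally show ?thesis by (rule eq_neg_iff_add_eq_0[THEN iffD1])
  qed
  define P where "P = (\<Sum>i\<in>?I. e i m * C i)"
  define Q where "Q = (\<Sum>i\<in>?I. e m i * B i)"
  have D: "dirac m = P + Q"
    by (simp add: dirac_def P_def Q_def e_def C_def B_def sum.distrib)
  have mv: "x * Z * (y * W) = x * y * (Z * W)" if "y * Z = Z * y" for x y Z W :: 'a
  proof -
    have "x * Z * (y * W) = x * (Z * y) * W" by (simp only: mult.assoc)
    then show ?thesis by (simp only: that[symmetric] mult.assoc)
  qed
  have PP: "P * P + P * P = 0"
  proof -
    have "P * P = (\<Sum>i\<in>?I. \<Sum>j\<in>?I. e i m * e j m * (C i * C j))"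
      unfolding P_def sum_product by (intro sum.cong refl mv eC)
    then show ?thesis
      by (simp only:) (rule zero, subst ee1, assumption, assumption, subst CC, simp)
  qed
  have QQ: "Q * Q + Q * Q = 0"
  proof -
    have "Q * Q = (\<Sum>i\<in>?I. \<Sum>j\<in>?I. e m i * e m j * (B i * B j))"
      unfolding Q_def sum_product by (intro sum.cong refl mv eB)
    then show ?thesis
      by (simp only:) (rule zero, subst ee2, assumption, assumption, subst BB, simp)
  qed
  have PQ: "P * Q + Q * P = A + T - e m m * N"
  proof -
    have "P * Q = (\<Sum>i\<in>?I. \<Sum>j\<in>?I. e i m * e m j * (C i * B j))"
      unfolding P_def Q_def sum_product by (intro sum.cong refl mv eC)
    also have "\<dots> = (\<Sum>i\<in>?I. \<Sum>j\<in>?I. e m j * e i m * (C i * B j) + e i j * (C i * B j) - (if i = j then e m m * (C i * B j) else 0))"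
      by (intro sum.cong refl) (simp add: ee3 algebra_simps)
    also have "\<dots> = (\<Sum>i\<in>?I. \<Sum>j\<in>?I. e m j * e i m * (C i * B j)) + T - e m m * N"
      by (simp add: sum.distrib sum_subtractf T_def N_def sum_distrib_left)
    finally have 1: "P * Q = (\<Sum>i\<in>?I. \<Sum>j\<in>?I. e m j * e i m * (C i * B j)) + T - e m m * N" .
    have "Q * P = (\<Sum>j\<in>?I. \<Sum>i\<in>?I. e m j * e i m * (B j * C i))"
      unfolding P_def Q_def sum_product by (intro sum.cong refl mv eB)
    also have "\<dots> = (\<Sum>i\<in>?I. \<Sum>j\<in>?I. e m j * e i m * (B j * C i))" by (rule sum.swap)
    also have "\<dots> = (\<Sum>i\<in>?I. \<Sum>j\<in>?I. (if i = j then e m j * e i m else 0) - e m j * e i m * (C i * B j))"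
      by (intro sum.cong refl, subst BC) (simp add: right_diff_distrib)
    also have "\<dots> = A - (\<Sum>i\<in>?I. \<Sum>j\<in>?I. e m j * e i m * (C i * B j))"
      by (simp add: sum_subtractf A_def)
    finally show ?thesis using 1 by simp
  qed
  have DD: "dirac m * dirac m + dirac m * dirac m = A + A + (T + T) - e m m * N - e m m * N"
  proof -
    have "dirac m * dirac m + dirac m * dirac m = (P * P + P * P) + (Q * Q + Q * Q) + (P * Q + Q * P) + (P * Q + Q * P)"
      unfolding D by (simp add: algebra_simps)
    then show ?thesis unfolding PP QQ PQ by simp
  qed
  \<comment> \<open>The quartic term that arises in \<open>casimir m\<close> from multiplying two
    bilinears. Normal ordering expresses it through the number operator \<open>N\<close> of column
    \<open>m\<close>, where \<open>q\<close> is the number of modes in that column.\<close>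
  have NN: "(\<Sum>i\<in>?I. \<Sum>j\<in>?I. C j * B i * (C i * B j)) = q * N - N * N + N"
  proof -
    have "C j * B i * (C i * B j) = C j * B j - (C i * B i) * (C j * B j) + (if i = j then C i * B j else 0)" for i j
    proof -
      have "C j * B i * (C i * B j) = C j * (B i * C i) * B j" by (simp only: mult.assoc)
      also have "\<dots> = C j * B j - (C j * C i) * (B i * B j)" by (simp add: BC algebra_simps)
      also have "(C j * C i) * (B i * B j) = (C i * B i) * (C j * B j) - (if i = j then C i * B j else 0)"
      proof -
        have "(C j * C i) * (B i * B j) = - (C i * C j) * (B i * B j)" by (subst CC) simp
        also have "\<dots> = C i * (- (C j * B i)) * B j" by (simp add: mult.assoc)
        also have "- (C j * B i) = B i * C j - (if i = j then 1 else 0)" by (simp add: BC)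
        also have "C i * (B i * C j - (if i = j then 1 else 0)) * B j = (C i * B i) * (C j * B j) - (if i = j then C i * B j else 0)"
          by (simp add: algebra_simps)
        finally show ?thesis .
      qed
      finally show ?thesis by simp
    qed
    then have "(\<Sum>i\<in>?I. \<Sum>j\<in>?I. C j * B i * (C i * B j)) = (\<Sum>i\<in>?I. N - (C i * B i) * N + C i * B i)"
      by (simp add: sum.distrib sum_subtractf N_def sum_distrib_left)
    also have "\<dots> = q * N - N * N + N"
      by (simp add: sum.distrib sum_subtractf q_def sum_distrib_right[symmetric] N_def[symmetric])
    finally show ?thesis .
  qed
  let ?J = "\<lambda>i. {j. j < m \<and> r i j}"
  let ?g = "\<lambda>i j. e i j * e j i"
  define S where "S = (\<Sum>i<m. \<Sum>j\<in>?J i. ?g i j)"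
  have finJ: "finite (?J i)" for i by (rule finite_subset[of _ "{..<m}"]) auto
  have I_eq: "?I = {i \<in> {..<m}. r i m}" unfolding below_def by auto
  have J_eq: "?J i = ?I" if "r i m" for i
  proof -
    have "r i j = r j m" for j using that r_sym[of i m] r_sym[of j m] r_sym[of j i] r_sym[of i j] r_trans[of j i m] r_trans[of i m j] by blast
    then show ?thesis unfolding below_def by simp
  qed
  \<comment> \<open>The index \<open>m\<close> adds a row, a column and a corner to the Casimir
    element. Reordering the column by \<open>ee3\<close> turns it into the row sum \<open>A\<close>
    plus diagonal terms.\<close>
  have c1: "casimir (Suc m) = S + A + (A + F - q * e m m) + e m m * e m m"
  proof -
    have a: "(\<Sum>j\<in>{j. j < Suc m \<and> r i j}. ?g i j) = (\<Sum>j\<in>?J i. ?g i j) + (if r i m then ?g i m else 0)" for i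
    proof -
      have "{j. j < Suc m \<and> r i j} = (if r i m then insert m (?J i) else ?J i)"
        unfolding less_Suc_eq by (cases "r i m"; simp; blast)
      then show ?thesis using finJ[of i] by (simp add: add.commute)
    qed
    have b: "?J m = ?I" by (rule J_eq[OF r_refl])
    have "casimir (Suc m) = S + (\<Sum>i<m. if r i m then ?g i m else 0) + ((\<Sum>j\<in>?J m. ?g m j) + ?g m m)"
      unfolding casimir_def e_def[symmetric] a using r_refl[of m] by (simp add: S_def sum.distrib)
    also have "(\<Sum>i<m. if r i m then ?g i m else 0) = (\<Sum>i\<in>?I. ?g i m)"
      unfolding I_eq by (rule sum.inter_filter[symmetric]) simp
    also have "\<dots> = (\<Sum>i\<in>?I. e m i * e i m + e i i - e m m)"
      by (intro sum.cong refl) (simp add: ee3)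
    also have "\<dots> = A + F - q * e m m"
      by (simp add: sum.distrib sum_subtractf A_def F_def q_def)
    finally show ?thesis unfolding b A_def[symmetric] by (simp add: algebra_simps)
  qed
  have c2: "casimir m = S - (T + T - (q * N - N * N + N))"
  proof -
    let ?t = "\<lambda>i j. e i j * (C i * B j) + e j i * (C j * B i) - C j * B i * (C i * B j)"
    have comm: "C p * B s * e i j = e i j * (C p * B s)" for p s i j
      by (rule sym, intro commute_mult eC eB)
    have "diag_E m i j * diag_E m j i = ?g i j - (if r i m then ?t i j else 0)" if "r i j" for i j
    proof -
      have "r i m = r j m" using r_trans[OF that, of m] r_trans[OF r_sym[OF that], of m] by blast
      moreover have "(e i j - C j * B i) * (e j i - C i * B j) = ?g i j - ?t i j"
        by (simp add: left_diff_distrib right_diff_distrib comm)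
      ultimately show ?thesis unfolding diag_E_step[OF m] e_def[symmetric] C_def[symmetric] B_def[symmetric] by simp
    qed
    then have "casimir m = (\<Sum>i<m. \<Sum>j\<in>?J i. ?g i j - (if r i m then ?t i j else 0))"
      unfolding casimir_def by (intro sum.cong refl) simp
    also have "\<dots> = S - (\<Sum>i<m. \<Sum>j\<in>?J i. if r i m then ?t i j else 0)"
      by (simp add: sum_subtractf S_def)
    also have "(\<Sum>i<m. \<Sum>j\<in>?J i. if r i m then ?t i j else 0) = (\<Sum>i<m. if r i m then \<Sum>j\<in>?I. ?t i j else 0)"
      by (intro sum.cong refl) (simp add: J_eq)
    also have "\<dots> = (\<Sum>i\<in>?I. \<Sum>j\<in>?I. ?t i j)"
      unfolding I_eq by (rule sum.inter_filter[symmetric]) simp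
    also have "\<dots> = T + (\<Sum>i\<in>?I. \<Sum>j\<in>?I. e j i * (C j * B i)) - (q * N - N * N + N)"
      by (simp only: sum.distrib sum_subtractf T_def NN)
    also have "(\<Sum>i\<in>?I. \<Sum>j\<in>?I. e j i * (C j * B i)) = T" unfolding T_def by (rule sum.swap)
    finally show ?thesis .
  qed
  have h: "weight_op m = e m m + N"
    by (simp add: weight_op_def e_def N_def C_def B_def)
  have f: "(\<Sum>i\<in>?I. diag_E m i i) = F - N"
    unfolding diag_E_step[OF m] e_def[symmetric] C_def[symmetric] B_def[symmetric]
    by (simp add: sum_subtractf F_def N_def rI cong: sum.cong)
  have Ne: "N * e m m = e m m * N"
    unfolding N_def by (rule sym, intro commute_sum commute_mult eC eB)
  show ?thesis
    unfolding DD c1 c2 h f q_def[symmetric] by (simp add: algebra_simps Ne)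
qed

section \<open>The sum over the chain\<close>

definition total_dirac :: 'a where
  "total_dirac = (\<Sum>m<n. dirac m)"

text \<open>Anticommutation removes the cross terms and the Casimir differences telescope down to 0
  from \<open>casimir n\<close>, where \<open>diag_E n\<close> is just \<open>E\<close>. Each
  remaining summand carries a \<open>weight_op\<close> as its rightmost factor and there is no
  constant term, so the remainder annihilates vectors of weight zero.\<close>

lemma total_dirac_square:
  "total_dirac * total_dirac + total_dirac * total_dirac =
     (\<Sum>i<n. \<Sum>j\<in>{j. j < n \<and> r i j}. E i j * E j i)
     + (\<Sum>m<n. (of_nat (card (below m)) - weight_op m) * weight_op m - (\<Sum>j\<in>below m. weight_op j))"
proof -
  have "(\<Sum>m<k. dirac m) * (\<Sum>m<k. dirac m) = (\<Sum>m<k. dirac m * dirac m)" if "k \<le> n" for k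
    using that
  proof (induction k)
    case (Suc k)
    have "dirac k * (\<Sum>m<k. dirac m) = - ((\<Sum>m<k. dirac m) * dirac k)"
      using Suc.prems by (intro anticommute_sum dirac_dirac) simp_all
    then show ?case using Suc by (simp add: algebra_simps)
  qed simp
  then have "total_dirac * total_dirac + total_dirac * total_dirac = (\<Sum>m<n. dirac m * dirac m + dirac m * dirac m)"
    by (simp add: total_dirac_def sum.distrib)
  also have "\<dots> = (\<Sum>m<n. casimir (Suc m) - casimir m + ((of_nat (card (below m)) - weight_op m) * weight_op m - (\<Sum>j\<in>below m. weight_op j)))"
    by (intro sum.cong refl) (simp add: dirac_square sum_diag_E_below left_diff_distrib)
  also have "\<dots> = casimir n - casimir 0 + (\<Sum>m<n. (of_nat (card (below m)) - weight_op m) * weight_op m - (\<Sum>j\<in>below m. weight_op j))"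
    by (simp only: sum.distrib sum_lessThan_telescope)
  finally show ?thesis by (simp add: casimir_def diag_E_n)
qed

lemma weight_op_total_dirac: "m < n \<Longrightarrow> weight_op m * total_dirac = total_dirac * weight_op m"
  unfolding total_dirac_def by (intro commute_sum weight_op_dirac) simp_all

text \<open>Meant for \<open>X\<close> the set of operators that preserve a given subspace: it is
  then enough to look at the generators, and only at those attached to pairs of indices in one
  block.\<close>

lemma total_dirac_closed:
  assumes zero: "0 \<in> X" and add: "\<And>x y. x \<in> X \<Longrightarrow> y \<in> X \<Longrightarrow> x + y \<in> X"
    and diff: "\<And>x y. x \<in> X \<Longrightarrow> y \<in> X \<Longrightarrow> x - y \<in> X"
    and mult: "\<And>x y. x \<in> X \<Longrightarrow> y \<in> X \<Longrightarrow> x * y \<in> X"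
    and E: "\<And>i j. i < n \<Longrightarrow> j < n \<Longrightarrow> r i j \<Longrightarrow> E i j \<in> X"
    and cb: "\<And>i j. i < j \<Longrightarrow> j < n \<Longrightarrow> r i j \<Longrightarrow> c i j \<in> X \<and> b i j \<in> X"
  shows "total_dirac \<in> X"
proof -
  have sum: "sum f A \<in> X" if "\<And>i. i \<in> A \<Longrightarrow> f i \<in> X" for f :: "nat \<Rightarrow> 'a" and A
    using that by (induction A rule: infinite_finite_induct) (auto intro: zero add)
  have diag_E: "diag_E m i j \<in> X" if ij: "r i j" "i < m" "j < m" "m \<le> n" for m i j
    unfolding diag_E_def
  proof (intro diff sum mult)
    show "E i j \<in> X" using ij by (intro E) simp_all
    fix l assume "l \<in> {l. m \<le> l \<and> l < n \<and> r i l}"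
    then have l: "m \<le> l" "l < n" "r i l" by simp_all
    then have "r j l" using r_trans[OF r_sym[OF ij(1)]] by blast
    then show "c j l \<in> X" "b i l \<in> X" using l ij cb by simp_all
  qed
  show ?thesis unfolding total_dirac_def dirac_def
  proof (intro sum add mult)
    fix m i assume "m \<in> {..<n}" "i \<in> below m"
    then have im: "m < n" "i < m" "r i m" "r m i" using r_sym by (simp_all add: below_iff)
    then show "diag_E (Suc m) i m \<in> X" "diag_E (Suc m) m i \<in> X" by (simp_all add: diag_E)
    show "c i m \<in> X" "b i m \<in> X" using im cb by simp_all
  qed
qed

text \<open>For \<open>x\<close> the fermion parity this says that the operator is odd. Bilinears
  contain two fermions, so \<open>diag_E\<close> is even, and each term of \<open>dirac\<close> has
  exactly one more.\<close>

lemma total_dirac_parity: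
  assumes E: "\<And>i j. x * E i j = E i j * x"
    and c: "\<And>i j. x * c i j = - (c i j * x)" and b: "\<And>i j. x * b i j = - (b i j * x)"
  shows "x * total_dirac = - (total_dirac * x)"
proof -
  have "x * diag_E m i j = diag_E m i j * x" for m i j
    unfolding diag_E_def by (intro commute_diff commute_sum anticommute_mult2 E c b)
  then show ?thesis unfolding total_dirac_def dirac_def
    by (intro anticommute_sum anticommute_add anticommute_mult c b)
qed

end

section \<open>Polynomials and derivations\<close>

lemma poly_mapping_sum_single: "p = (\<Sum>e\<in>keys p. single e (lookup p e))"
  by (rule poly_mapping_eqI)
    (auto simp: lookup_sum lookup_single when_def in_keys_iff sum.delta' cong: sum.cong)

lemma monomial_induct [case_names zero add_single]:
  fixes e :: "'v \<Rightarrow>\<^sub>0 nat"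
  assumes "P 0" and "\<And>e v. P e \<Longrightarrow> P (e + single v 1)"
  shows "P e"
proof -
  have *: "P f \<Longrightarrow> P (f + single v k)" for f v k
  proof (induction k)
    case (Suc k)
    then have "P (f + single v k + single v 1)" using assms(2) by blast
    then show ?case by (simp add: add.assoc single_add[symmetric])
  qed simp
  have "P (\<Sum>v\<in>A. single v (lookup e v))" if "finite A" for A
    using that
  proof (induction A)
    case (insert v A)
    then show ?case using *[OF insert.IH, of v "lookup e v"] by (simp add: add.commute)
  qed (simp add: assms)
  then show ?thesis by (subst poly_mapping_sum_single) simp
qed

definition vars_in :: "var set \<Rightarrow> 'f::comm_ring_1 mpoly \<Rightarrow> bool" where
  "vars_in A p \<longleftrightarrow> (\<forall>e\<in>keys p. keys e \<subseteq> A)"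

lemma Var_mult_single: "Var v * single e c = single (e + single v 1) c"
  by (simp add: Var_def mult_single add.commute)

lemma Const_mult: "Const (a * b) = Const a * Const b"
  by (simp add: Const_def mult_single)

lemma Const_add: "Const (a + b) = Const a + Const b"
  by (simp add: Const_def single_add)

lemma Const_0 [simp]: "Const 0 = 0"
  by (simp add: Const_def)

lemma Const_1 [simp]: "Const 1 = 1"
  by (simp add: Const_def)

lemma lookup_Const_mult [simp]: "lookup (Const a * p) e = a * lookup p e"
proof -
  have "Const a * p = Poly_Mapping.map ((*) a) p" by (simp add: Const_def mult_map_scale_conv_mult)
  then show ?thesis by (simp add: map.rep_eq when_def)
qed

lemma keys_add_monomial:
  fixes e f :: "'v \<Rightarrow>\<^sub>0 nat"
  shows "keys (e + f) = keys e \<union> keys f"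
  by (auto simp: in_keys_iff lookup_add)

lemma vars_in_mpoly_induct [consumes 1, case_names Const Var add mult]:
  fixes p :: "'f::comm_ring_1 mpoly"
  assumes p: "vars_in A p"
    and const: "\<And>c. P (Const c)" and var: "\<And>v. v \<in> A \<Longrightarrow> P (Var v)"
    and add: "\<And>p q. vars_in A p \<Longrightarrow> vars_in A q \<Longrightarrow> P p \<Longrightarrow> P q \<Longrightarrow> P (p + q)"
    and mult: "\<And>p q. vars_in A p \<Longrightarrow> vars_in A q \<Longrightarrow> P p \<Longrightarrow> P q \<Longrightarrow> P (p * q)"
  shows "P p"
proof -
  have *: "keys e \<subseteq> A \<longrightarrow> vars_in A (single e c) \<and> P (single e c)" for e c
  proof (induction e rule: monomial_induct)
    case zero
    then show ?case using const[of c] by (simp add: Const_def vars_in_def)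
  next
    case (add_single e v)
    show ?case
    proof
      assume a: "keys (e + single v 1) \<subseteq> A"
      then have "v \<in> A" "keys e \<subseteq> A" by (auto simp: keys_add_monomial)
      moreover from this have "vars_in A (Var v :: 'f mpoly)" by (simp add: Var_def vars_in_def)
      ultimately have "P (Var v * single e c)" using mult var add_single by blast
      then show "vars_in A (single (e + single v 1) c) \<and> P (single (e + single v 1) c)"
        using a by (simp add: Var_mult_single vars_in_def)
    qed
  qed
  have "finite B \<Longrightarrow> B \<subseteq> keys p \<Longrightarrow> vars_in A (\<Sum>e\<in>B. single e (lookup p e)) \<and> P (\<Sum>e\<in>B. single e (lookup p e))" for B
  proof (induction B rule: finite_induct)
    case (insert e B)
    have "vars_in A (single e (lookup p e)) \<and> P (single e (lookup p e))"
      using * p insert by (auto simp: vars_in_def)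
    moreover have "vars_in A (\<Sum>e\<in>B. single e (lookup p e)) \<and> P (\<Sum>e\<in>B. single e (lookup p e))"
      using insert by blast
    moreover from calculation have "vars_in A (single e (lookup p e) + (\<Sum>e\<in>B. single e (lookup p e)))"
      unfolding vars_in_def by (meson UnE keys_add subsetD)
    ultimately show ?case using insert add by simp
  next
    case empty
    then show ?case using const[of 0] by (simp add: vars_in_def)
  qed
  then show ?thesis using poly_mapping_sum_single[of p] by (metis finite_keys subset_refl)
qed

lemma vars_in_UNIV [simp]: "vars_in UNIV p"
  by (simp add: vars_in_def)

lemmas mpoly_induct = vars_in_mpoly_induct[OF vars_in_UNIV, simplified, case_names Const Var add mult]

section \<open>Substitution homomorphisms\<close>

definition meval :: "(var \<Rightarrow> 'b) \<Rightarrow> (var \<Rightarrow>\<^sub>0 nat) \<Rightarrow> 'b::comm_ring_1" where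
  "meval \<sigma> e = (\<Prod>v\<in>keys e. \<sigma> v ^ lookup e v)"

text \<open>Coefficients are moved by \<open>\<phi>\<close> into an arbitrary commutative ring. This
  covers the dual-number trick behind \<open>der\<close>, the substitution \<open>merge\<close> and
  the extension of scalars \<open>rat_embed\<close> at once.\<close>

definition eval_hom :: "('f \<Rightarrow> 'b) \<Rightarrow> (var \<Rightarrow> 'b) \<Rightarrow> 'f::comm_ring_1 mpoly \<Rightarrow> 'b::comm_ring_1" where
  "eval_hom \<phi> \<sigma> p = (\<Sum>e\<in>keys p. \<phi> (lookup p e) * meval \<sigma> e)"

lemma meval_superset:
  assumes "finite A" "keys e \<subseteq> A"
  shows "meval \<sigma> e = (\<Prod>v\<in>A. \<sigma> v ^ lookup e v)"
  unfolding meval_def using assms by (intro prod.mono_neutral_left) (auto simp: in_keys_iff)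

lemma meval_add: "meval \<sigma> (e + f) = meval \<sigma> e * meval \<sigma> f"
proof -
  let ?A = "keys e \<union> keys f"
  have "meval \<sigma> (e + f) = (\<Prod>v\<in>?A. \<sigma> v ^ lookup (e + f) v)"
    by (intro meval_superset) (auto simp: keys_add_monomial)
  also have "\<dots> = (\<Prod>v\<in>?A. \<sigma> v ^ lookup e v) * (\<Prod>v\<in>?A. \<sigma> v ^ lookup f v)"
    by (simp add: lookup_add power_add prod.distrib)
  also have "\<dots> = meval \<sigma> e * meval \<sigma> f"
    by (intro arg_cong2[where f = "(*)"] meval_superset[symmetric]) auto
  finally show ?thesis .
qed

locale coeff_hom =
  fixes \<phi> :: "'f::comm_ring_1 \<Rightarrow> 'b::comm_ring_1"
  assumes zero: "\<phi> 0 = 0" and one: "\<phi> 1 = 1" and add: "\<phi> (x + y) = \<phi> x + \<phi> y" and mult: "\<phi> (x * y) = \<phi> x * \<phi> y"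
begin

lemma eval_hom_superset:
  assumes "finite A" "keys p \<subseteq> A"
  shows "eval_hom \<phi> \<sigma> p = (\<Sum>e\<in>A. \<phi> (lookup p e) * meval \<sigma> e)"
  unfolding eval_hom_def using assms by (intro sum.mono_neutral_left) (auto simp: in_keys_iff zero)

lemma eval_hom_add: "eval_hom \<phi> \<sigma> (p + q) = eval_hom \<phi> \<sigma> p + eval_hom \<phi> \<sigma> q"
proof -
  let ?A = "keys p \<union> keys q"
  have "eval_hom \<phi> \<sigma> (p + q) = (\<Sum>v\<in>?A. \<phi> (lookup (p + q) v) * meval \<sigma> v)"
    by (intro eval_hom_superset) (simp_all add: keys_add)
  also have "\<dots> = (\<Sum>v\<in>?A. \<phi> (lookup p v) * meval \<sigma> v) + (\<Sum>v\<in>?A. \<phi> (lookup q v) * meval \<sigma> v)"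
    by (simp add: lookup_add add sum.distrib distrib_right)
  also have "\<dots> = eval_hom \<phi> \<sigma> p + eval_hom \<phi> \<sigma> q"
    by (intro arg_cong2[where f = "(+)"] eval_hom_superset[symmetric]) auto
  finally show ?thesis .
qed

lemma eval_hom_zero [simp]: "eval_hom \<phi> \<sigma> 0 = 0"
  by (simp add: eval_hom_def)

lemma eval_hom_sum: "eval_hom \<phi> \<sigma> (sum f A) = (\<Sum>x\<in>A. eval_hom \<phi> \<sigma> (f x))"
  by (induction A rule: infinite_finite_induct) (simp_all add: eval_hom_add)

lemma eval_hom_single: "eval_hom \<phi> \<sigma> (single e c) = \<phi> c * meval \<sigma> e"
  by (simp add: eval_hom_def zero)

lemma eval_hom_mult: "eval_hom \<phi> \<sigma> (p * q) = eval_hom \<phi> \<sigma> p * eval_hom \<phi> \<sigma> q"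
proof -
  have "eval_hom \<phi> \<sigma> (p * q) = eval_hom \<phi> \<sigma> ((\<Sum>e\<in>keys p. single e (lookup p e)) * (\<Sum>e\<in>keys q. single e (lookup q e)))"
    by (simp only: poly_mapping_sum_single[symmetric])
  also have "\<dots> = (\<Sum>e\<in>keys p. \<Sum>f\<in>keys q. (\<phi> (lookup p e) * meval \<sigma> e) * (\<phi> (lookup q f) * meval \<sigma> f))"
    by (simp add: sum_product eval_hom_sum mult_single eval_hom_single meval_add mult mult_ac)
  also have "\<dots> = eval_hom \<phi> \<sigma> p * eval_hom \<phi> \<sigma> q"
    by (simp add: eval_hom_def sum_product)
  finally show ?thesis .
qed

lemma eval_hom_Const [simp]: "eval_hom \<phi> \<sigma> (Const c) = \<phi> c"
  by (simp add: Const_def eval_hom_single meval_def)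

lemma eval_hom_one [simp]: "eval_hom \<phi> \<sigma> 1 = 1"
  using eval_hom_Const[of \<sigma> 1] by (simp add: one)

lemma eval_hom_Var [simp]: "eval_hom \<phi> \<sigma> (Var v) = \<sigma> v"
  by (simp add: Var_def eval_hom_single meval_def one)

lemma eval_hom_prod_list: "eval_hom \<phi> \<sigma> (prod_list ps) = prod_list (map (eval_hom \<phi> \<sigma>) ps)"
  by (induction ps) (simp_all add: eval_hom_mult)

end

text \<open>The first order term of substituting \<open>Var v + t * \<delta> v\<close> for each
  variable. The Leibniz rule then comes from multiplicativity of the substitution, without any
  computation with exponents.\<close>

definition der :: "(var \<Rightarrow> 'f mpoly) \<Rightarrow> 'f::comm_ring_1 mpoly \<Rightarrow> 'f mpoly" where
  "der \<delta> p = coeff (eval_hom (\<lambda>c. [:Const c:]) (\<lambda>v. [:Var v, \<delta> v:]) p) 1"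

interpretation dual: coeff_hom "\<lambda>c::'f::comm_ring_1. [:Const c :: 'f mpoly:]"
  by unfold_locales (simp_all add: Const_add Const_mult)

interpretation const: coeff_hom "Const :: 'f::comm_ring_1 \<Rightarrow> 'f mpoly"
  by unfold_locales (simp_all add: Const_add Const_mult)

lemma dual_coeff_0: "coeff (eval_hom (\<lambda>c. [:Const c:]) (\<lambda>v. [:Var v, \<delta> v:]) p) 0 = p"
  by (induction p rule: mpoly_induct)
    (simp_all add: dual.eval_hom_add dual.eval_hom_mult coeff_mult)

lemma der_Const [simp]: "der \<delta> (Const c) = 0"
  by (simp add: der_def)

lemma der_Var [simp]: "der \<delta> (Var v) = \<delta> v"
  by (simp add: der_def)

lemma der_add: "der \<delta> (p + q) = der \<delta> p + der \<delta> q"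
  by (simp add: der_def dual.eval_hom_add)

lemma der_mult: "der \<delta> (p * q) = p * der \<delta> q + der \<delta> p * q"
  by (simp add: der_def dual.eval_hom_mult coeff_mult dual_coeff_0 numeral_2_eq_2)

lemma der_zero [simp]: "der \<delta> 0 = 0"
  using der_Const[of \<delta> 0] by simp

lemma der_sum: "der \<delta> (sum f A) = (\<Sum>x\<in>A. der \<delta> (f x))"
  by (induction A rule: infinite_finite_induct) (simp_all add: der_add)

lemma der_Const_mult: "der \<delta> (Const c * p) = Const c * der \<delta> p"
  by (simp add: der_mult)

lemma der_minus: "der \<delta> (- p) = - der \<delta> p"
  by (metis add.right_inverse add_eq_0_iff der_add der_zero)

lemma der_diff: "der \<delta> (p - q) = der \<delta> p - der \<delta> q"
  by (metis der_add der_minus uminus_add_conv_diff add.commute)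

lemma der_one [simp]: "der \<delta> 1 = 0"
  using der_Const[of \<delta> 1] by simp

lemma derivation_eqI:
  fixes D D' :: "'f::comm_ring_1 mpoly \<Rightarrow> 'f mpoly"
  assumes "vars_in A p"
    and "\<And>c. D (Const c) = 0" "\<And>p q. D (p + q) = D p + D q" "\<And>p q. D (p * q) = p * D q + D p * q"
    and "\<And>c. D' (Const c) = 0" "\<And>p q. D' (p + q) = D' p + D' q" "\<And>p q. D' (p * q) = p * D' q + D' p * q"
    and "\<And>v. v \<in> A \<Longrightarrow> D (Var v) = D' (Var v)"
  shows "D p = D' p"
  using assms(1) by (induction rule: vars_in_mpoly_induct) (simp_all add: assms)

definition pd :: "var \<Rightarrow> 'f::comm_ring_1 mpoly \<Rightarrow> 'f mpoly" where
  "pd v = der (\<lambda>w. if w = v then 1 else 0)"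

lemma der_expand:
  assumes "vars_in A p" "finite A"
  shows "der \<delta> p = (\<Sum>v\<in>A. \<delta> v * pd v p)"
  using assms(1)
proof (rule derivation_eqI)
  fix v assume "v \<in> A"
  have "(\<Sum>w\<in>A. \<delta> w * pd w (Var v)) = (\<Sum>w\<in>A. if v = w then \<delta> w else 0)"
    by (intro sum.cong refl) (simp add: pd_def)
  then show "der \<delta> (Var v) = (\<Sum>w\<in>A. \<delta> w * pd w (Var v))"
    using \<open>v \<in> A\<close> assms(2) by simp
qed (simp_all add: der_add der_mult pd_def distrib_left sum.distrib sum_distrib_left sum_distrib_right mult_ac)

lemma der_delta_diff: "der (\<lambda>v. \<delta> v - \<epsilon> v) p = der \<delta> p - der \<epsilon> p"
  by (rule derivation_eqI[OF vars_in_UNIV]) (simp_all add: der_add der_mult algebra_simps)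

lemma lookup_Var_mult: "lookup (Var v * p) (e + single v 1) = lookup p e"
proof -
  have "Var v * p = (\<Sum>f\<in>keys p. single (f + single v 1) (lookup p f))"
    by (subst poly_mapping_sum_single[of p]) (simp add: sum_distrib_left Var_mult_single)
  then show ?thesis
    by (simp add: lookup_sum lookup_single when_def in_keys_iff)
qed

text \<open>Euler's identity with weights \<open>s\<close>. It serves three times: with all weights
  1 for the total degree, with the indicator of one variable for \<open>pd\<close>, and with the
  torus weights for \<open>adj l l\<close>.\<close>

lemma der_Var_scale_single:
  fixes c :: "'f::comm_ring_1" and s :: "var \<Rightarrow> 'f"
  shows "der (\<lambda>v. Const (s v) * Var v) (single e c) = Const (\<Sum>v\<in>keys e. of_nat (lookup e v) * s v) * single e c"
proof (induction e rule: monomial_induct)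
  case zero
  then show ?case using der_Const[of "\<lambda>v. Const (s v) * Var v" c] by (simp add: Const_def)
next
  case (add_single e w)
  let ?f = "e + single w 1"
  have k: "(\<Sum>v\<in>keys e. of_nat (lookup e v) * s v) = (\<Sum>v\<in>keys ?f. of_nat (lookup e v) * s v)"
    by (intro sum.mono_neutral_left) (auto simp: keys_add_monomial in_keys_iff)
  have "(\<Sum>v\<in>keys ?f. of_nat (lookup ?f v) * s v)
     = (\<Sum>v\<in>keys ?f. of_nat (lookup e v) * s v + (if w = v then s w else 0))"
    by (intro sum.cong refl) (auto simp: lookup_add lookup_single when_def distrib_right)
  also have "\<dots> = (\<Sum>v\<in>keys e. of_nat (lookup e v) * s v) + s w"
    unfolding k sum.distrib by (simp add: keys_add_monomial)
  finally show ?case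
    unfolding Var_mult_single[symmetric] der_mult add_single.IH by (simp add: Const_add algebra_simps)
qed

lemma lookup_der_Var_scale:
  "lookup (der (\<lambda>v. Const (s v) * Var v) p) e = (\<Sum>v\<in>keys e. of_nat (lookup e v) * s v) * lookup p e"
proof -
  have "der (\<lambda>v. Const (s v) * Var v) p = (\<Sum>e\<in>keys p. Const (\<Sum>v\<in>keys e. of_nat (lookup e v) * s v) * single e (lookup p e))"
    by (subst poly_mapping_sum_single[of p]) (simp only: der_sum der_Var_scale_single)
  then show ?thesis
    by (simp add: lookup_sum lookup_single when_def in_keys_iff if_distrib cong: if_cong)
qed

text \<open>\<open>Var v * pd v p\<close> is the Euler operator of a single variable, diagonal on
  monomials, and multiplication by \<open>Var v\<close> merely shifts coefficients.\<close>

lemma lookup_pd: "lookup (pd v p) e = of_nat (lookup e v + 1) * lookup p (e + single v 1)"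
proof -
  let ?s = "\<lambda>w. if w = v then 1 else 0 :: 'a" and ?f = "e + single v 1"
  have "Var v * pd v p = der (\<lambda>w. Const (?s w) * Var w) p"
    unfolding pd_def
    by (rule derivation_eqI[OF vars_in_UNIV]) (auto simp: der_add der_mult algebra_simps)
  then have "lookup (pd v p) e = lookup (der (\<lambda>w. Const (?s w) * Var w) p) ?f"
    by (metis lookup_Var_mult)
  also have "\<dots> = (\<Sum>w\<in>keys ?f. of_nat (lookup ?f w) * ?s w) * lookup p ?f"
    by (rule lookup_der_Var_scale)
  also have "(\<Sum>w\<in>keys ?f. of_nat (lookup ?f w) * ?s w) = of_nat (lookup ?f v)"
    by (simp add: if_distrib keys_add_monomial cong: if_cong)
  finally show ?thesis by (simp add: lookup_add)
qed

text \<open>Used to see which degrees and which variables a derivation preserves. The additive form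
  avoids subtracting exponents.\<close>

lemma keys_der:
  assumes "e' \<in> keys (der \<delta> p)"
  shows "\<exists>e\<in>keys p. \<exists>v\<in>keys e. \<exists>f\<in>keys (\<delta> v). e' + single v 1 = e + f"
proof -
  have *: "e' \<in> keys (der \<delta> (single e c)) \<Longrightarrow> \<exists>v\<in>keys e. \<exists>f\<in>keys (\<delta> v). e' + single v 1 = e + f" for e e' c
  proof (induction e arbitrary: e' rule: monomial_induct)
    case zero
    then show ?case using der_Const[of \<delta> c] by (simp add: Const_def)
  next
    case (add_single e w)
    have "der \<delta> (single (e + single w 1) c) = Var w * der \<delta> (single e c) + \<delta> w * single e c"
      unfolding Var_mult_single[symmetric] der_mult by simp
    with add_single.prems have "e' \<in> keys (Var w * der \<delta> (single e c) + \<delta> w * single e c)"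
      by simp
    from subsetD[OF keys_add this] consider "e' \<in> keys (Var w * der \<delta> (single e c))"
      | "e' \<in> keys (\<delta> w * single e c)"
      by blast
    then show ?case
    proof cases
      case 1
      then obtain e1 e2 where "e' = e1 + e2" "e1 \<in> keys (Var w :: 'a mpoly)" "e2 \<in> keys (der \<delta> (single e c))"
        using keys_mult by blast
      then have e': "e' = single w 1 + e2" by (simp add: Var_def split: if_splits)
      obtain v f where vf: "v \<in> keys e" "f \<in> keys (\<delta> v)" "e2 + single v 1 = e + f"
        using add_single.IH \<open>e2 \<in> _\<close> by blast
      have "e' + single v 1 = (e2 + single v 1) + single w 1"
        unfolding e' by (simp only: add_ac)
      also have "\<dots> = (e + single w 1) + f"
        unfolding vf(3) by (simp only: add_ac)
      finally show ?thesis using vf by (auto simp: keys_add_monomial)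
    next
      case 2
      then obtain e1 e2 where "e' = e1 + e2" "e1 \<in> keys (\<delta> w)" "e2 \<in> keys (single e c)"
        using keys_mult by blast
      then show ?thesis by (intro bexI[of _ w] bexI[of _ e1]) (auto simp: keys_add_monomial add_ac split: if_splits)
    qed
  qed
  have "der \<delta> p = (\<Sum>e\<in>keys p. der \<delta> (single e (lookup p e)))"
    by (subst poly_mapping_sum_single[of p]) (simp only: der_sum)
  with assms have "e' \<in> keys (\<Sum>e\<in>keys p. der \<delta> (single e (lookup p e)))"
    by simp
  from subsetD[OF keys_sum this] obtain e where "e \<in> keys p" "e' \<in> keys (der \<delta> (single e (lookup p e)))"
    by blast
  then show ?thesis using * by blast
qed

section \<open>Finite-dimensional subspaces\<close>

definition fin_dim :: "'v::real_vector set \<Rightarrow> bool" where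
  "fin_dim S \<longleftrightarrow> (\<exists>B. finite B \<and> S \<subseteq> span B)"

lemma fin_dim_subset: "fin_dim T \<Longrightarrow> S \<subseteq> T \<Longrightarrow> fin_dim S"
  unfolding fin_dim_def by blast

lemma fin_dim_independent_extend:
  fixes S :: "'v::real_vector set"
  assumes "fin_dim S" "independent b0" "b0 \<subseteq> S"
  obtains b where "b0 \<subseteq> b" "b \<subseteq> S" "independent b" "S \<subseteq> span b" "finite b" "card b = dim S"
proof -
  obtain b where b: "b0 \<subseteq> b" "b \<subseteq> S" "independent b" "S \<subseteq> span b"
    using real_vector.maximal_independent_subset_extend[OF assms(3,2)] by blast
  obtain B where "finite B" "S \<subseteq> span B" using assms(1) unfolding fin_dim_def by blast
  then have "finite b" using independent_span_bound[of B b] b by blast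
  with b show ?thesis by (intro that[of b]) (simp_all add: real_vector.dim_unique)
qed

lemma fin_dim_basis:
  fixes S :: "'v::real_vector set"
  assumes "fin_dim S"
  obtains b where "b \<subseteq> S" "independent b" "S \<subseteq> span b" "finite b" "card b = dim S"
proof (rule fin_dim_independent_extend[OF assms real_vector.independent_empty])
  show "{} \<subseteq> S" by simp
  fix b assume "b \<subseteq> S" "independent b" "S \<subseteq> span b" "finite b" "card b = dim S"
  then show thesis by (rule that)
qed

lemma independent_span_Int:
  fixes A B :: "'v::real_vector set"
  assumes "independent (A \<union> B)" "A \<inter> B = {}" "finite A" "finite B" "x \<in> span A" "x \<in> span B"
  shows "x = 0"
proof -
  obtain u where u: "x = (\<Sum>v\<in>A. u v *\<^sub>R v)"
    using assms(5) unfolding real_vector.span_finite[OF assms(3)] by blast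
  obtain w where w: "x = (\<Sum>v\<in>B. w v *\<^sub>R v)"
    using assms(6) unfolding real_vector.span_finite[OF assms(4)] by blast
  let ?h = "\<lambda>v. if v \<in> A then u v else - w v"
  have "(\<Sum>v\<in>A \<union> B. ?h v *\<^sub>R v) = (\<Sum>v\<in>A. ?h v *\<^sub>R v) + (\<Sum>v\<in>B. ?h v *\<^sub>R v)"
    using assms by (intro sum.union_disjoint) auto
  also have "(\<Sum>v\<in>A. ?h v *\<^sub>R v) = x" unfolding u by (intro sum.cong) auto
  also have "(\<Sum>v\<in>B. ?h v *\<^sub>R v) = - x" unfolding w sum_negf[symmetric]
    using assms(2) by (intro sum.cong) auto
  finally have "(\<Sum>v\<in>A \<union> B. ?h v *\<^sub>R v) = 0" by simp
  then have "?h v = 0" if "v \<in> A" for v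
    using real_vector.independentD[OF assms(1), of "A \<union> B" ?h v] assms(3,4) that by simp
  then have "u v = 0" if "v \<in> A" for v using that by (metis (full_types))
  then show ?thesis unfolding u by simp
qed

lemma dim_image_inj_on:
  fixes f :: "'v::real_vector \<Rightarrow> 'w::real_vector"
  assumes "subspace S" "fin_dim S" "linear f" "inj_on f S"
  shows "dim (f ` S) = dim S" "fin_dim (f ` S)"
proof -
  obtain b where b: "b \<subseteq> S" "independent b" "S \<subseteq> span b" "finite b" "card b = dim S"
    by (rule fin_dim_basis[OF assms(2)])
  have span: "span b = S" using b assms(1) by (simp add: span_subspace)
  have "independent (f ` b)"
    using linear_independent_injective_image[OF assms(3) b(2)] assms(4) span by simp
  moreover have "span (f ` b) = f ` S" using linear_span_image[OF assms(3), of b] span by simp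
  moreover have "card (f ` b) = dim S"
    using b(1,5) assms(4) by (metis card_image inj_on_subset)
  ultimately show "dim (f ` S) = dim S" using b(1) by (intro real_vector.dim_unique[of "f ` b"]) auto
  show "fin_dim (f ` S)" unfolding fin_dim_def using \<open>span (f ` b) = f ` S\<close> b(4) by blast
qed

lemma rank_nullity:
  fixes f :: "'v::real_vector \<Rightarrow> 'w::real_vector"
  assumes S: "subspace S" "fin_dim S" and f: "linear f"
  shows "dim S = dim {x \<in> S. f x = 0} + dim (f ` S)"
proof -
  interpret f: linear f by fact
  let ?K = "{x \<in> S. f x = 0}"
  have K: "fin_dim ?K" using S(2) by (rule fin_dim_subset) auto
  obtain b0 where b0: "b0 \<subseteq> ?K" "independent b0" "?K \<subseteq> span b0" "finite b0" "card b0 = dim ?K"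
    by (rule fin_dim_basis[OF K])
  have "b0 \<subseteq> S" using b0(1) by auto
  then obtain b where b: "b0 \<subseteq> b" "b \<subseteq> S" "independent b" "S \<subseteq> span b" "finite b" "card b = dim S"
    using fin_dim_independent_extend[OF S(2) b0(2)] by blast
  let ?c = "b - b0"
  have ic: "independent ?c" using b(3) by (rule real_vector.independent_mono) auto
  have cS: "span ?c \<subseteq> S" using b(2) S(1) by (intro span_minimal) auto
  have inj: "inj_on f (span ?c)"
  proof (rule inj_onI)
    fix x y assume xy: "x \<in> span ?c" "y \<in> span ?c" "f x = f y"
    then have d: "x - y \<in> span ?c" by (simp add: span_diff)
    then have "x - y \<in> ?K" using cS xy by (auto simp: f.diff)
    then have "x - y \<in> span b0" using b0(3) by blast
    then have "x - y = 0"
      using d b b0(4) by (intro independent_span_Int[of b0 ?c]) (auto simp: Un_absorb1)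
    then show "x = y" by simp
  qed
  have img: "f ` S = f ` span ?c"
  proof
    show "f ` S \<subseteq> f ` span ?c"
    proof
      fix y assume "y \<in> f ` S"
      then obtain x where x: "x \<in> span (b0 \<union> ?c)" "y = f x" using b(1,4) by (auto simp: Un_absorb1)
      then obtain p q where pq: "x = p + q" "p \<in> span b0" "q \<in> span ?c"
        unfolding real_vector.span_Un by blast
      have "f p = 0" using pq(2)
        by (induction rule: span_induct_alt) (use b0(1) in \<open>auto simp: f.zero f.add f.scale\<close>)
      then show "y \<in> f ` span ?c" using x pq by (auto simp: f.add)
    qed
  qed (use cS in blast)
  have "fin_dim (span ?c)" unfolding fin_dim_def using b(5) by auto
  then have "dim (f ` span ?c) = dim (span ?c)"
    using inj f by (intro dim_image_inj_on) (auto simp: subspace_span)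
  also have "\<dots> = card ?c" using ic by (simp add: real_vector.dim_eq_card_independent)
  also have "\<dots> = card b - card b0" using b b0 by (simp add: card_Diff_subset)
  finally show ?thesis using b b0 card_mono[OF b(5,1)] img by simp
qed

lemma subspace_dim_eq:
  assumes "subspace T" "T \<subseteq> S" "fin_dim S" "dim T = dim S"
  shows "T = S"
proof -
  obtain t where t: "t \<subseteq> T" "independent t" "T \<subseteq> span t" "finite t" "card t = dim T"
    by (rule fin_dim_basis[OF fin_dim_subset[OF assms(3,2)]])
  have "t \<subseteq> S" using t(1) assms(2) by simp
  obtain b where b: "t \<subseteq> b" "b \<subseteq> S" "S \<subseteq> span b" "finite b" "card b = dim S"
    using fin_dim_independent_extend[OF assms(3) t(2) \<open>t \<subseteq> S\<close>] by metis
  then have "t = b" using t assms(4) by (intro card_subset_eq) auto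
  then have "S \<subseteq> T" using b(3) span_minimal[OF t(1) assms(1)] by simp
  then show ?thesis using assms(2) by blast
qed

lemma inj_endo_surj:
  fixes f :: "'v::real_vector \<Rightarrow> 'v"
  assumes "subspace S" "fin_dim S" "linear f" "inj_on f S" "f ` S \<subseteq> S"
  shows "f ` S = S"
  using assms dim_image_inj_on[OF assms(1-4)]
  by (intro subspace_dim_eq linear_subspace_image) auto

text \<open>The operator \<open>D\<close> exchanges \<open>P\<close> and \<open>Q\<close> injectively modulo its kernels, so the two
  dimensions can differ only by the kernels.\<close>

lemma dim_supersymmetry:
  fixes D :: "'v::real_vector \<Rightarrow> 'v"
  assumes P: "subspace P" "fin_dim P" and Q: "subspace Q" "fin_dim Q" and D: "linear D"
    and PQ: "D ` P \<subseteq> Q" "D ` Q \<subseteq> P"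
    and ker: "\<And>x. x \<in> P \<union> Q \<Longrightarrow> D (D x) = 0 \<Longrightarrow> D x = 0"
  shows "dim P + dim {x \<in> Q. D x = 0} = dim Q + dim {x \<in> P. D x = 0}"
proof -
  interpret D: linear D by fact
  \<comment> \<open>By the kernel condition \<open>D\<close> is injective on the image of
    \<open>X\<close>. Applying it once more embeds that image into the image of
    \<open>Y\<close>.\<close>
  have le: "dim (D ` X) \<le> dim (D ` Y)"
    if X: "subspace X" "fin_dim X" and Y: "fin_dim Y" and XY: "D ` X \<subseteq> Y" and k: "\<And>x. x \<in> X \<Longrightarrow> D (D x) = 0 \<Longrightarrow> D x = 0" for X Y
  proof -
    have fin: "fin_dim (D ` X)" "fin_dim (D ` Y)"
    proof -
      have "fin_dim (D ` Z)" if Z: "fin_dim Z" for Z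
      proof -
        obtain B where "finite B" "Z \<subseteq> span B" using Z unfolding fin_dim_def by blast
        then show ?thesis unfolding fin_dim_def
          by (intro exI[of _ "D ` B"]) (auto simp: linear_span_image[OF D])
      qed
      then show "fin_dim (D ` X)" "fin_dim (D ` Y)" using X Y by auto
    qed
    have "inj_on D (D ` X)"
    proof (rule inj_onI)
      fix x y assume "x \<in> D ` X" "y \<in> D ` X" and eq: "D x = D y"
      then obtain u v where uv: "x = D u" "y = D v" "u \<in> X" "v \<in> X" by auto
      have "D (D (u - v)) = 0" using eq uv by (simp add: D.diff)
      moreover have "u - v \<in> X" using uv X(1) by (simp add: subspace_diff)
      ultimately have "D (u - v) = 0" using k by blast
      then show "x = y" using uv by (simp add: D.diff)
    qed
    then have "dim (D ` (D ` X)) = dim (D ` X)"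
      by (rule dim_image_inj_on(1)[OF linear_subspace_image[OF D X(1)] fin(1) D])
    moreover have "dim (D ` (D ` X)) \<le> dim (D ` Y)"
    proof -
      obtain b where b: "D ` Y \<subseteq> span b" "finite b" "card b = dim (D ` Y)"
        by (rule fin_dim_basis[OF fin(2)])
      have "D ` (D ` X) \<subseteq> span b" using XY b(1) by blast
      then have "dim (D ` (D ` X)) \<le> card b" using b(2) by (rule real_vector.dim_le_card)
      then show ?thesis using b by simp
    qed
    ultimately show ?thesis by simp
  qed
  have "dim (D ` P) = dim (D ` Q)"
    using le[OF P Q(2) PQ(1)] le[OF Q P(2) PQ(2)] ker by (intro antisym) auto
  then show ?thesis using rank_nullity[OF P D] rank_nullity[OF Q D] by simp
qed

lemma scaleR_eq_Const_mult: "c *\<^sub>R (p :: real mpoly) = Const c * p"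
proof (rule poly_mapping_eqI)
  fix e
  have "finite {k. c *\<^sub>R lookup p k \<noteq> 0}"
    by (rule finite_subset[OF _ finite_lookup[of p]]) auto
  then show "lookup (c *\<^sub>R p) e = lookup (Const c * p) e"
    by (simp add: scaleR_poly_mapping_def)
qed

lemma lookup_scaleR: "lookup (c *\<^sub>R (p :: real mpoly)) e = c * lookup p e"
  by (simp add: scaleR_eq_Const_mult)

lemma linear_der: "linear (der \<delta> :: real mpoly \<Rightarrow> _)"
  by (rule linearI) (simp_all add: der_add scaleR_eq_Const_mult der_Const_mult)

section \<open>The apolar inner product\<close>

text \<open>These factorial weights are forced: they make multiplication by a variable adjoint to
  differentiation by it, since raising the exponent of \<open>v\<close> multiplies the weight by the
  same factor that \<open>pd v\<close> produces.\<close>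

definition mfact :: "(var \<Rightarrow>\<^sub>0 nat) \<Rightarrow> real" where
  "mfact e = (\<Prod>v\<in>keys e. fact (lookup e v))"

definition apolar :: "real mpoly \<Rightarrow> real mpoly \<Rightarrow> real" where
  "apolar p q = (\<Sum>e\<in>keys p. mfact e * lookup p e * lookup q e)"

lemma mfact_pos: "mfact e > 0"
  unfolding mfact_def by (intro prod_pos) auto

lemma mfact_add_single: "mfact (e + single v 1) = real (lookup e v + 1) * mfact e"
proof -
  let ?A = "insert v (keys e)"
  have 1: "mfact f = (\<Prod>v\<in>?A. fact (lookup f v))" if "keys f \<subseteq> ?A" for f
    unfolding mfact_def using that by (intro prod.mono_neutral_left) (auto simp: in_keys_iff)
  have "mfact (e + single v 1) = (\<Prod>w\<in>?A. (if w = v then real (lookup e v + 1) else 1) * fact (lookup e w))"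
    by (subst 1) (auto simp: keys_add_monomial lookup_add lookup_single when_def intro!: prod.cong)
  also have "\<dots> = real (lookup e v + 1) * mfact e"
    unfolding prod.distrib using 1[OF subset_insertI] by simp
  finally show ?thesis .
qed

lemma apolar_superset:
  assumes "finite A" "keys p \<subseteq> A"
  shows "apolar p q = (\<Sum>e\<in>A. mfact e * lookup p e * lookup q e)"
  unfolding apolar_def using assms by (intro sum.mono_neutral_left) (auto simp: in_keys_iff)

lemma apolar_commute: "apolar p q = apolar q p"
  using apolar_superset[of "keys p \<union> keys q" p q]
    apolar_superset[of "keys p \<union> keys q" q p] by (simp add: mult_ac)

lemma apolar_add_right: "apolar p (q + r) = apolar p q + apolar p r"
  by (simp add: apolar_def lookup_add sum.distrib distrib_left)

lemma apolar_zero_right [simp]: "apolar p 0 = 0"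
  by (simp add: apolar_def)

lemma apolar_sum_right: "apolar p (sum f A) = (\<Sum>x\<in>A. apolar p (f x))"
  by (induction A rule: infinite_finite_induct) (simp_all add: apolar_add_right)

lemma apolar_sum_left: "apolar (sum f A) p = (\<Sum>x\<in>A. apolar (f x) p)"
  by (simp add: apolar_commute[of _ p] apolar_sum_right)

lemma apolar_self: "apolar p p \<ge> 0" "apolar p p = 0 \<longleftrightarrow> p = 0"
proof -
  have t: "mfact e * lookup p e * lookup p e \<ge> 0" for e
    using mfact_pos[of e] by (simp add: mult.assoc)
  then show "apolar p p \<ge> 0" unfolding apolar_def by (intro sum_nonneg) auto
  show "apolar p p = 0 \<longleftrightarrow> p = 0"
  proof
    assume "apolar p p = 0"
    then have "\<forall>e\<in>keys p. mfact e * lookup p e * lookup p e = 0"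
      unfolding apolar_def using t by (subst (asm) sum_nonneg_eq_0_iff) auto
    then have "keys p = {}"
      using mfact_pos by (metis ex_in_conv in_keys_iff less_irrefl mult_eq_0_iff)
    then show "p = 0" by simp
  qed simp
qed

lemma apolar_Var_mult: "apolar (Var v * p) q = apolar p (pd v q)"
proof -
  let ?s = "\<lambda>e :: var \<Rightarrow>\<^sub>0 nat. e + single v 1"
  have inj: "inj_on ?s A" for A by (rule inj_onI) simp
  have "keys (Var v * p) \<subseteq> ?s ` keys p"
    using keys_mult[of "Var v" p] by (force simp: Var_def add.commute)
  then have "apolar (Var v * p) q = (\<Sum>e\<in>?s ` keys p. mfact e * lookup (Var v * p) e * lookup q e)"
    by (intro apolar_superset) auto
  also have "\<dots> = apolar p (pd v q)"
    unfolding sum.reindex[OF inj] apolar_def o_def lookup_Var_mult lookup_pd mfact_add_single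
    by (simp add: mult_ac)
  finally show ?thesis .
qed

lemma apolar_Var_mult_right: "apolar p (Var v * q) = apolar (pd v p) q"
  by (metis apolar_Var_mult apolar_commute)

section \<open>The infinitesimal conjugation action\<close>

text \<open>The derivations with these values are the classical polarization operators:
  \<open>ldelta i j\<close> turns a row index \<open>j\<close> into \<open>i\<close>, and
  \<open>rdelta i j\<close> turns a column index \<open>i\<close> into \<open>j\<close>.\<close>

definition ldelta :: "nat \<Rightarrow> nat \<Rightarrow> var \<Rightarrow> 'f::comm_ring_1 mpoly" where
  "ldelta i j v = (case v of (k, l, \<alpha>) \<Rightarrow> if k = j then Var (i, l, \<alpha>) else 0)"

definition rdelta :: "nat \<Rightarrow> nat \<Rightarrow> var \<Rightarrow> 'f::comm_ring_1 mpoly" where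
  "rdelta i j v = (case v of (k, l, \<alpha>) \<Rightarrow> if l = i then Var (k, j, \<alpha>) else 0)"

text \<open>The derivative of \<open>X \<mapsto> g X g\<^sup>-\<^sup>1\<close> at the matrix unit \<open>e\<^sub>i\<^sub>j\<close>.\<close>

definition adj :: "nat \<Rightarrow> nat \<Rightarrow> 'f::comm_ring_1 mpoly \<Rightarrow> 'f mpoly" where
  "adj i j = der (\<lambda>v. ldelta i j v - rdelta i j v)"

lemma adj_eq: "adj i j p = der (ldelta i j) p - der (rdelta i j) p"
  unfolding adj_def by (rule der_delta_diff)

lemma der_ldelta_Var [simp]: "der \<delta> (ldelta i j (k, l, \<alpha>)) = (if k = j then \<delta> (i, l, \<alpha>) else 0)"
  by (simp add: ldelta_def)

lemma der_rdelta_Var [simp]: "der \<delta> (rdelta i j (k, l, \<alpha>)) = (if l = i then \<delta> (k, j, \<alpha>) else 0)"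
  by (simp add: rdelta_def)

lemma adj_mult: "adj i j (p * q) = p * adj i j q + adj i j p * q"
  by (simp add: adj_def der_mult)

lemma adj_add: "adj i j (p + q) = adj i j p + adj i j q"
  by (simp add: adj_def der_add)

lemma adj_Const [simp]: "adj i j (Const c) = 0"
  by (simp add: adj_def)

lemma adj_zero [simp]: "adj i j 0 = 0"
  by (simp add: adj_def)

lemma adj_sum: "adj i j (sum f A) = (\<Sum>x\<in>A. adj i j (f x))"
  by (simp add: adj_def der_sum)

lemma adj_commutator:
  "adj i j (adj k l p) = adj k l (adj i j p) + (if j = k then adj i l p else 0) - (if l = i then adj k j p else 0)"
proof (induction p rule: mpoly_induct)
  case (Var v)
  obtain a b \<alpha> where v: "v = (a, b, \<alpha>)" by (cases v)
  show ?case unfolding v adj_def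
    by (simp add: der_diff) (auto simp: ldelta_def rdelta_def)
next
  case (mult p q)
  have "adj i j (adj k l (p * q)) = p * adj i j (adj k l q) + adj i j (adj k l p) * q + adj i j p * adj k l q + adj k l p * adj i j q"
    by (simp add: adj_mult adj_add algebra_simps)
  also have "\<dots> = adj k l (adj i j (p * q)) + (if j = k then adj i l (p * q) else 0) - (if l = i then adj k j (p * q) else 0)"
    unfolding mult by (simp add: adj_mult adj_add algebra_simps)
  finally show ?case .
next
  case (add p q)
  show ?case unfolding adj_add add by (simp add: algebra_simps)
qed simp

text \<open>The derivation is a sum of terms
  \<open>Var (i, l, \<alpha>) * pd (j, l, \<alpha>) p\<close>, and passing to the adjoint exchanges
  \<open>i\<close> and \<open>j\<close> in each of them. The set \<open>A\<close> of pairs occurring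
  in \<open>p\<close> or \<open>q\<close> keeps the sum finite.\<close>

lemma apolar_ldelta: "apolar (der (ldelta i j) p) q = apolar p (der (ldelta j i) q)"
proof -
  define V where "V = (\<Union>e\<in>keys p \<union> keys q. keys e)"
  define A where "A = snd ` V"
  have fin: "finite A" by (simp add: A_def V_def)
  have *: "der (ldelta i j) p = (\<Sum>(l, \<alpha>)\<in>A. Var (i, l, \<alpha>) * pd (j, l, \<alpha>) p)"
    if "vars_in V p" for p :: "real mpoly" and i j
  proof (rule derivation_eqI[OF that])
    fix v assume v: "v \<in> V"
    obtain k l \<alpha> where kl: "v = (k, l, \<alpha>)" by (cases v)
    have lA: "(l, \<alpha>) \<in> A" using v kl by (force simp: A_def)
    have "(\<Sum>(l', \<alpha>')\<in>A. Var (i, l', \<alpha>') * pd (j, l', \<alpha>') (Var v :: real mpoly)) = (\<Sum>x\<in>A. if x = (l, \<alpha>) then (if k = j then Var (i, l, \<alpha>) else 0) else 0)"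
      by (intro sum.cong refl) (auto simp: kl pd_def split: if_splits)
    also have "\<dots> = der (ldelta i j) (Var v)" using fin lA by (simp add: kl ldelta_def)
    finally show "der (ldelta i j) (Var v) = (\<Sum>(l', \<alpha>')\<in>A. Var (i, l', \<alpha>') * pd (j, l', \<alpha>') (Var v :: real mpoly))" ..
  qed (simp_all add: der_add der_mult pd_def distrib_left sum.distrib sum_distrib_left sum_distrib_right mult_ac case_prod_unfold)
  have "vars_in V p" "vars_in V q" by (auto simp: vars_in_def V_def)
  then show ?thesis
    by (simp only: * apolar_sum_left apolar_sum_right case_prod_unfold apolar_Var_mult apolar_Var_mult_right)
qed

lemma apolar_rdelta: "apolar (der (rdelta i j) p) q = apolar p (der (rdelta j i) q)"
proof -
  define V where "V = (\<Union>e\<in>keys p \<union> keys q. keys e)"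
  define A where "A = (\<lambda>(k, l, \<alpha>). (k, \<alpha>)) ` V"
  have fin: "finite A" by (simp add: A_def V_def)
  have *: "der (rdelta i j) p = (\<Sum>(k, \<alpha>)\<in>A. Var (k, j, \<alpha>) * pd (k, i, \<alpha>) p)"
    if "vars_in V p" for p :: "real mpoly" and i j
  proof (rule derivation_eqI[OF that])
    fix v assume v: "v \<in> V"
    obtain k l \<alpha> where kl: "v = (k, l, \<alpha>)" by (cases v)
    have lA: "(k, \<alpha>) \<in> A" using v kl by (force simp: A_def)
    have "(\<Sum>(k', \<alpha>')\<in>A. Var (k', j, \<alpha>') * pd (k', i, \<alpha>') (Var v :: real mpoly)) = (\<Sum>x\<in>A. if x = (k, \<alpha>) then (if l = i then Var (k, j, \<alpha>) else 0) else 0)"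
      by (intro sum.cong refl) (auto simp: kl pd_def split: if_splits)
    also have "\<dots> = der (rdelta i j) (Var v)" using fin lA by (simp add: kl rdelta_def)
    finally show "der (rdelta i j) (Var v) = (\<Sum>(k', \<alpha>')\<in>A. Var (k', j, \<alpha>') * pd (k', i, \<alpha>') (Var v :: real mpoly))" ..
  qed (simp_all add: der_add der_mult pd_def distrib_left sum.distrib sum_distrib_left sum_distrib_right mult_ac case_prod_unfold)
  have "vars_in V p" "vars_in V q" by (auto simp: vars_in_def V_def)
  then show ?thesis
    by (simp only: * apolar_sum_left apolar_sum_right case_prod_unfold apolar_Var_mult apolar_Var_mult_right)
qed

lemma apolar_adj: "apolar (adj i j p) q = apolar p (adj j i q)"
proof -
  have d: "apolar r (s - t) = apolar r s - apolar r t" for r s t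
    by (simp add: apolar_def lookup_minus algebra_simps sum_subtractf)
  have d': "apolar (s - t) r = apolar s r - apolar t r" for r s t
    using d apolar_commute by metis
  show ?thesis unfolding adj_eq d d' apolar_ldelta apolar_rdelta ..
qed

text \<open>Pairing the sum with \<open>p\<close> turns it into a sum of squared norms of the
  \<open>F' i j p\<close>. This is the one place where positivity is converted into invariance or
  vanishing, once for \<open>ldelta\<close> and once for \<open>adj\<close>.\<close>

lemma casimir_kernel:
  assumes "finite K" "(\<Sum>(i, j)\<in>K. F i j (F' i j p)) = 0"
    and "\<And>i j p q. apolar (F i j p) q = apolar p (F' i j q)" "(i, j) \<in> K"
  shows "F' i j p = 0"
proof -
  have "0 = apolar (\<Sum>(i, j)\<in>K. F i j (F' i j p)) p" using assms(2) apolar_commute[of 0 p] by simp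
  also have "\<dots> = (\<Sum>(i, j)\<in>K. apolar (F' i j p) (F' i j p))"
    by (simp add: apolar_sum_left case_prod_unfold assms(3))
  finally have "\<forall>x\<in>K. (case x of (i, j) \<Rightarrow> apolar (F' i j p) (F' i j p)) = 0"
    using assms(1) apolar_self(1) by (subst (asm) eq_commute, subst (asm) sum_nonneg_eq_0_iff) auto
  then show ?thesis using assms(4) apolar_self(2) by auto
qed

section \<open>The first fundamental theorem\<close>

lemma sum_list_take_mono: "a \<le> b \<Longrightarrow> sum_list (take a ns) \<le> sum_list (take b (ns :: nat list))"
  by (metis le_add1 min.absorb1 sum_list_append take_add le_Suc_ex)

lemma blockset_subset: "blockset ns a \<subseteq> {..<sum_list ns}"
  using sum_list_take_mono[of "Suc a" "length ns + Suc a" ns] by (auto simp: blockset_def)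

lemma blockset_disjoint:
  assumes "i \<in> blockset ns a" "i \<in> blockset ns b"
  shows "a = b"
proof (rule ccontr)
  assume "a \<noteq> b"
  then consider "Suc a \<le> b" | "Suc b \<le> a" by linarith
  then show False
    using assms sum_list_take_mono[of "Suc a" b ns] sum_list_take_mono[of "Suc b" a ns]
    by cases (auto simp: blockset_def)
qed

lemma blk_eqI: "i \<in> blockset ns a \<Longrightarrow> a < length ns \<Longrightarrow> blk ns i = a"
  unfolding blk_def by (rule the_equality) (auto dest: blockset_disjoint)

lemma blockset_exists:
  assumes "i < sum_list ns"
  shows "\<exists>a<length ns. i \<in> blockset ns a"
proof -
  define a where "a = (LEAST a. i < sum_list (take a ns))"
  have ex: "i < sum_list (take (length ns) ns)" using assms by simp
  have a: "i < sum_list (take a ns)" unfolding a_def using ex by (rule LeastI)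
  have "a \<le> length ns" unfolding a_def using ex by (rule Least_le)
  moreover obtain b where b: "a = Suc b" using a by (cases a) auto
  moreover have "\<not> i < sum_list (take b ns)"
    using not_less_Least[of b "\<lambda>a. i < sum_list (take a ns)"] b unfolding a_def by simp
  ultimately show ?thesis using a by (auto simp: blockset_def intro!: exI[of _ b])
qed

lemma blk_works: "i < sum_list ns \<Longrightarrow> blk ns i < length ns \<and> i \<in> blockset ns (blk ns i)"
  using blockset_exists blk_eqI by metis

lemma in_blockset_iff: "a < length ns \<Longrightarrow> i \<in> blockset ns a \<longleftrightarrow> i < sum_list ns \<and> blk ns i = a"
  using blk_works blk_eqI blockset_subset by blast

lemma finite_blockset [simp]: "finite (blockset ns a)"
  by (simp add: blockset_def)

definition same_block :: "nat list \<Rightarrow> (nat \<times> nat) set" where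
  "same_block ns = {(i, j). i < sum_list ns \<and> j < sum_list ns \<and> blk ns i = blk ns j}"

lemma finite_same_block [simp]: "finite (same_block ns)"
  by (rule finite_subset[of _ "{..<sum_list ns} \<times> {..<sum_list ns}"]) (auto simp: same_block_def)

lemma sum_same_block:
  "(\<Sum>(i, j)\<in>same_block ns. f i j) = (\<Sum>c<length ns. \<Sum>i\<in>blockset ns c. \<Sum>j\<in>blockset ns c. f i j)"
proof -
  have "same_block ns = (\<Union>c\<in>{..<length ns}. blockset ns c \<times> blockset ns c)"
    using blk_works by (auto simp: same_block_def in_blockset_iff)
  then have "(\<Sum>x\<in>same_block ns. case x of (i, j) \<Rightarrow> f i j) = (\<Sum>c<length ns. \<Sum>x\<in>blockset ns c \<times> blockset ns c. case x of (i, j) \<Rightarrow> f i j)"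
    by (simp only:) (rule sum.UNION_disjoint, auto dest: blockset_disjoint)
  then show ?thesis by (simp add: sum.cartesian_product)
qed

section \<open>Invariants and traces of words\<close>

definition inv_under :: "nat list \<Rightarrow> 'f::comm_ring_1 mpoly \<Rightarrow> bool" where
  "inv_under ns p \<longleftrightarrow> (\<forall>(i, j)\<in>same_block ns. adj i j p = 0)"

lemma inv_underD: "inv_under ns p \<Longrightarrow> (i, j) \<in> same_block ns \<Longrightarrow> adj i j p = 0"
  unfolding inv_under_def by blast

lemma adj_one [simp]: "adj i j 1 = 0"
  by (simp add: adj_def)

lemma adj_Var: "adj i j (Var (k, l, \<alpha>)) = (if k = j then Var (i, l, \<alpha>) else 0) - (if l = i then Var (k, j, \<alpha>) else 0)"
  by (simp add: adj_def ldelta_def rdelta_def)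

lemma wordmat_Nil [simp]: "wordmat ns [] = mid"
  by (simp add: wordmat_def)

lemma wordmat_Cons:
  assumes "a < length ns"
  shows "wordmat ns ((a, \<alpha>) # w) i j = (if i \<in> blockset ns a then \<Sum>k<sum_list ns. Var (i, k, \<alpha>) * wordmat ns w k j else 0)"
proof -
  have "(\<Sum>s<sum_list ns. eblk ns a i s * genmat \<alpha> s k) = (if i \<in> blockset ns a then Var (i, k, \<alpha>) else 0 :: 'a mpoly)" for k
  proof -
    have "(\<Sum>s<sum_list ns. eblk ns a i s * genmat \<alpha> s k) = (\<Sum>s<sum_list ns. if s = i then (if i \<in> blockset ns a then Var (i, k, \<alpha>) else 0 :: 'a mpoly) else 0)"
      by (intro sum.cong refl) (auto simp: eblk_def genmat_def)
    then show ?thesis using blockset_subset[of ns a] by auto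
  qed
  then show ?thesis by (simp add: wordmat_def mmul_def)
qed

lemma mtr_wordmat_single:
  assumes "c < length ns"
  shows "mtr (sum_list ns) (wordmat ns [(c, \<alpha>)]) = (\<Sum>i\<in>blockset ns c. Var (i, i, \<alpha>))"
proof -
  have "mtr (sum_list ns) (wordmat ns [(c, \<alpha>)]) = (\<Sum>i<sum_list ns. if i \<in> blockset ns c then Var (i, i, \<alpha>) else 0 :: 'a mpoly)"
    unfolding mtr_def by (intro sum.cong refl) (simp add: wordmat_Cons[OF assms] mid_def if_distrib cong: if_cong)
  also have "\<dots> = (\<Sum>i\<in>blockset ns c. Var (i, i, \<alpha>))"
    using blockset_subset[of ns c] by (simp add: sum.If_cases Int_absorb1)
  finally show ?thesis .
qed

text \<open>A product of matrices that transform by conjugation transforms by conjugation, and the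
  idempotents of the blocks are fixed because \<open>i\<close> and \<open>j\<close> belong to the
  same block. The entries of a word thus obey the rule \<open>adj_Var\<close> for the
  variables.\<close>

lemma adj_wordmat:
  assumes ij: "(i, j) \<in> same_block ns" and w: "\<forall>(a, \<alpha>)\<in>set w. a < length ns"
  shows "adj i j (wordmat ns w k l) = (if k = j then wordmat ns w i l else 0) - (if l = i then wordmat ns w k j else 0)"
  using w
proof (induction w arbitrary: k l)
  case Nil
  have m: "adj i j (mid k l :: 'a mpoly) = 0" unfolding mid_def by simp
  show ?case unfolding wordmat_Nil m by (auto simp: mid_def)
next
  case (Cons x w)
  obtain a \<alpha> where x: "x = (a, \<alpha>)" by (cases x)
  have a: "a < length ns" using Cons.prems x by auto
  have ijn: "i < sum_list ns" "j < sum_list ns" "i \<in> blockset ns a \<longleftrightarrow> j \<in> blockset ns a"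
    using ij a by (auto simp: same_block_def in_blockset_iff)
  have IH: "adj i j (wordmat ns w k l) = (if k = j then wordmat ns w i l else 0) - (if l = i then wordmat ns w k j else 0 :: 'a mpoly)" for k l
    using Cons by auto
  let ?W = "wordmat ns w :: nat \<Rightarrow> nat \<Rightarrow> 'a mpoly"
  have "adj i j (\<Sum>s<sum_list ns. Var (k, s, \<alpha>) * ?W s l)
      = (\<Sum>s<sum_list ns. (if s = j then Var (k, s, \<alpha>) * ?W i l else 0) - (if l = i then Var (k, s, \<alpha>) * ?W s j else 0)
          + (if k = j then Var (i, s, \<alpha>) * ?W s l else 0) - (if s = i then Var (k, j, \<alpha>) * ?W s l else 0))"
    unfolding adj_sum adj_mult IH adj_Var by (intro sum.cong refl) (simp add: algebra_simps)
  also have "\<dots> = (if k = j then \<Sum>s<sum_list ns. Var (i, s, \<alpha>) * ?W s l else 0) - (if l = i then \<Sum>s<sum_list ns. Var (k, s, \<alpha>) * ?W s j else 0)"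
    using ijn by (simp add: sum.distrib sum_subtractf)
  finally have e: "adj i j (\<Sum>s<sum_list ns. Var (k, s, \<alpha>) * ?W s l) = \<dots>" .
  show ?case unfolding x wordmat_Cons[OF a] using ijn e by auto
qed

lemma U_ptr_inv:
  assumes "p \<in> U_ptr ns d"
  shows "inv_under ns p"
  using assms unfolding U_ptr_def
proof (induction rule: subalg.induct)
  case (gen p)
  then obtain w where p: "p = mtr (sum_list ns) (wordmat ns w)" and w: "\<forall>(a, \<alpha>)\<in>set w. a < length ns"
    unfolding ptr_gens_def by fastforce
  show ?case unfolding inv_under_def
  proof (intro ballI, clarify)
    fix i j assume ij: "(i, j) \<in> same_block ns"
    then have "i < sum_list ns" "j < sum_list ns" by (auto simp: same_block_def)
    then show "adj i j p = 0"
      by (simp add: p mtr_def adj_sum adj_wordmat[OF ij w] sum_subtractf)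
  qed
qed (fastforce simp: inv_under_def adj_add adj_mult)+

lemma U_ptr_sum: "(\<And>x. x \<in> A \<Longrightarrow> f x \<in> U_ptr ns d) \<Longrightarrow> sum f A \<in> U_ptr ns d"
proof (induction A rule: infinite_finite_induct)
  case (insert x A)
  then show ?case by (simp add: U_ptr_def subalg.add)
qed (use subalg.const[of 0] in \<open>simp_all add: U_ptr_def\<close>)

lemma U_ptr_add: "p \<in> U_ptr ns d \<Longrightarrow> q \<in> U_ptr ns d \<Longrightarrow> p + q \<in> U_ptr ns d"
  unfolding U_ptr_def by (rule subalg.add)

lemma U_ptr_mult: "p \<in> U_ptr ns d \<Longrightarrow> q \<in> U_ptr ns d \<Longrightarrow> p * q \<in> U_ptr ns d"
  unfolding U_ptr_def by (rule subalg.mult)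

context
  fixes ns :: "nat list" and d c \<alpha> \<beta> :: nat
  assumes c: "c < length ns" and \<alpha>: "\<alpha> < d" and \<beta>: "\<beta> < d"
begin

text \<open>The substitution of \<open>X\<^sub>\<alpha> e\<^sub>c X\<^sub>\<beta>\<close> for the generic matrix of index \<open>d\<close>.\<close>

definition merge :: "'f::comm_ring_1 mpoly \<Rightarrow> 'f mpoly" where
  "merge = eval_hom Const (\<lambda>(k, l, \<gamma>). if \<gamma> = d then \<Sum>i\<in>blockset ns c. Var (k, i, \<alpha>) * Var (i, l, \<beta>) else Var (k, l, \<gamma>))"

lemma merge_simps:
  "merge (p + q) = merge p + merge q" "merge (p * q) = merge p * merge q" "merge (Const x) = Const x"
  "merge 0 = 0" "merge 1 = 1" "merge (sum f A) = (\<Sum>x\<in>A. merge (f x))"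
  "merge (Var (k, l, \<gamma>)) = (if \<gamma> = d then \<Sum>i\<in>blockset ns c. Var (k, i, \<alpha>) * Var (i, l, \<beta>) else Var (k, l, \<gamma>))"
  by (simp_all add: merge_def const.eval_hom_add const.eval_hom_mult const.eval_hom_sum)

lemma merge_vars_in:
  assumes "vars_in (varidx ns d) p"
  shows "merge p = p"
  using assms by (induction rule: vars_in_mpoly_induct) (auto simp: merge_simps varidx_def)

lemma merge_wordmat:
  assumes "\<forall>(a, \<gamma>)\<in>set w. a < length ns"
  shows "merge (wordmat ns w i j) = wordmat ns (concat (map (\<lambda>(a, \<gamma>). if \<gamma> = d then [(a, \<alpha>), (c, \<beta>)] else [(a, \<gamma>)]) w)) i j"
  using assms
proof (induction w arbitrary: i j)
  case Nil
  then show ?case by (simp add: mid_def merge_simps)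
next
  case (Cons x w)
  obtain a \<gamma> where x: "x = (a, \<gamma>)" by (cases x)
  have a: "a < length ns" using Cons.prems x by auto
  let ?f = "\<lambda>(a, \<gamma>). if \<gamma> = d then [(a, \<alpha>), (c, \<beta>)] else [(a, \<gamma>)]"
  let ?W = "wordmat ns (concat (map ?f w)) :: nat \<Rightarrow> nat \<Rightarrow> 'a mpoly"
  have IH: "merge (wordmat ns w i j) = ?W i j" for i j using Cons by auto
  show ?case
  proof (cases "\<gamma> = d")
    case True
    have "(\<Sum>k<sum_list ns. (\<Sum>s\<in>blockset ns c. Var (i, s, \<alpha>) * Var (s, k, \<beta>)) * ?W k j)
       = (\<Sum>s\<in>blockset ns c. Var (i, s, \<alpha>) * (\<Sum>k<sum_list ns. Var (s, k, \<beta>) * ?W k j))"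
      unfolding sum_distrib_left sum_distrib_right by (subst sum.swap) (simp add: mult.assoc)
    also have "\<dots> = (\<Sum>s<sum_list ns. Var (i, s, \<alpha>) * (if s \<in> blockset ns c then \<Sum>k<sum_list ns. Var (s, k, \<beta>) * ?W k j else 0))"
      using blockset_subset[of ns c] by (intro sum.mono_neutral_cong_left) auto
    finally show ?thesis
      by (simp add: x True wordmat_Cons[OF a] wordmat_Cons[OF c] merge_simps IH)
  next
    case False
    then show ?thesis by (simp add: x wordmat_Cons[OF a] merge_simps IH)
  qed
qed

lemma merge_U_ptr:
  assumes "p \<in> U_ptr ns (Suc d)"
  shows "merge p \<in> U_ptr ns d"
  using assms unfolding U_ptr_def
proof (induction rule: subalg.induct)
  case (gen p)
  then obtain w where p: "p = mtr (sum_list ns) (wordmat ns w)" and w: "w \<noteq> []" "\<forall>(a, \<gamma>)\<in>set w. a < length ns \<and> \<gamma> < Suc d"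
    unfolding ptr_gens_def by blast
  let ?w = "concat (map (\<lambda>(a, \<gamma>). if \<gamma> = d then [(a, \<alpha>), (c, \<beta>)] else [(a, \<gamma>)]) w)"
  have "merge p = mtr (sum_list ns) (wordmat ns ?w)"
    unfolding p mtr_def merge_simps using w by (intro sum.cong refl merge_wordmat) auto
  moreover have "?w \<noteq> []" using w(1) by (cases w) (auto split: if_splits)
  moreover have "\<forall>(a, \<gamma>)\<in>set ?w. a < length ns \<and> \<gamma> < d"
    using w(2) c \<alpha> \<beta> by (auto split: if_splits)
  ultimately have "merge p \<in> ptr_gens ns d" unfolding ptr_gens_def by blast
  then show ?case by (rule subalg.gen)
qed (simp_all add: merge_simps subalg.const subalg.add subalg.mult)

end

section \<open>Homogeneous polynomials\<close>

definition tdeg :: "(var \<Rightarrow>\<^sub>0 nat) \<Rightarrow> nat" where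
  "tdeg e = (\<Sum>v\<in>keys e. lookup e v)"

lemma tdeg_superset: "finite A \<Longrightarrow> keys e \<subseteq> A \<Longrightarrow> tdeg e = (\<Sum>v\<in>A. lookup e v)"
  unfolding tdeg_def by (intro sum.mono_neutral_left) (auto simp: in_keys_iff)

lemma tdeg_add: "tdeg (e + f) = tdeg e + tdeg f"
  using tdeg_superset[of "keys e \<union> keys f"]
  by (simp add: keys_add_monomial lookup_add sum.distrib)

lemma tdeg_single [simp]: "tdeg (single v k) = k"
  by (simp add: tdeg_def)

definition hom_in :: "var set \<Rightarrow> nat \<Rightarrow> 'f::comm_ring_1 mpoly \<Rightarrow> bool" where
  "hom_in A N p \<longleftrightarrow> (\<forall>e\<in>keys p. keys e \<subseteq> A \<and> tdeg e = N)"

lemma hom_in_vars_in: "hom_in A N p \<Longrightarrow> vars_in A p"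
  by (simp add: hom_in_def vars_in_def)

lemma hom_in_sum: "(\<And>x. x \<in> X \<Longrightarrow> hom_in A N (f x)) \<Longrightarrow> hom_in A N (sum f X)"
  unfolding hom_in_def using subsetD[OF keys_sum[of f X]] by blast

lemma hom_in_der:
  assumes "\<And>v f. v \<in> A \<Longrightarrow> f \<in> keys (\<delta> v) \<Longrightarrow> keys f \<subseteq> A \<and> tdeg f = 1" and p: "hom_in A N p"
  shows "hom_in A N (der \<delta> p)"
  unfolding hom_in_def
proof
  fix e' assume "e' \<in> keys (der \<delta> p)"
  then obtain e v f where *: "e \<in> keys p" "v \<in> keys e" "f \<in> keys (\<delta> v)"
    and eq: "e' + single v 1 = e + f" using keys_der by blast
  then have "v \<in> A" using p unfolding hom_in_def by blast
  have "keys e' \<subseteq> keys (e' + single v 1)" by (auto simp: keys_add_monomial)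
  also have "\<dots> \<subseteq> A" unfolding eq keys_add_monomial using * assms(1)[OF \<open>v \<in> A\<close> *(3)] p unfolding hom_in_def by auto
  finally have "keys e' \<subseteq> A" .
  moreover have "tdeg (e' + single v 1) = tdeg (e + f)" by (simp only: eq)
  then have "tdeg e' = N" using * assms(1)[OF \<open>v \<in> A\<close> *(3)] p unfolding hom_in_def tdeg_add by simp
  ultimately show "keys e' \<subseteq> A \<and> tdeg e' = N" by simp
qed

lemma keys_pd:
  assumes "hom_in A N p" "e \<in> keys (pd v p)"
  shows "keys e \<subseteq> A \<and> tdeg e + 1 = N"
proof -
  have "e + single v 1 \<in> keys p"
    using assms(2) by (auto simp: in_keys_iff lookup_pd)
  then have "keys (e + single v 1) \<subseteq> A" "tdeg (e + single v 1) = N"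
    using assms(1) unfolding hom_in_def by blast+
  then show ?thesis by (simp add: keys_add_monomial tdeg_add)
qed

lemma hom_in_pd:
  assumes "hom_in A N p"
  shows "hom_in A (N - 1) (pd v p)"
  unfolding hom_in_def
proof
  fix e assume "e \<in> keys (pd v p)"
  from keys_pd[OF assms this] show "keys e \<subseteq> A \<and> tdeg e = N - 1" by auto
qed

text \<open>The commutator of the two derivations is a derivation with constant values on the
  variables, hence a combination of partial derivatives; these transform by the representation dual
  to that of the variables.\<close>

lemma adj_pd: "adj i j (pd (a, b, \<gamma>) p) = pd (a, b, \<gamma>) (adj i j p)
   - (if a = i then pd (j, b, \<gamma>) p else 0) + (if b = j then pd (a, i, \<gamma>) p else 0)"
proof (induction p rule: mpoly_induct)
  case (Var v)
  obtain k l \<epsilon> where v: "v = (k, l, \<epsilon>)" by (cases v)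
  have "adj i j (if P then 1 else 0 :: 'a mpoly) = 0" for P by simp
  then show ?case unfolding v by (simp add: adj_Var pd_def der_diff)
next
  case (mult p q)
  have m: "pd v (p * q) = p * pd v q + pd v p * q" for v and p q :: "'a mpoly" by (simp add: pd_def der_mult)
  have a: "pd v (p + q) = pd v p + pd v q" for v and p q :: "'a mpoly" by (simp add: pd_def der_add)
  have "adj i j (pd (a, b, \<gamma>) (p * q)) = p * adj i j (pd (a, b, \<gamma>) q) + adj i j (pd (a, b, \<gamma>) p) * q + adj i j p * pd (a, b, \<gamma>) q + pd (a, b, \<gamma>) p * adj i j q"
    by (simp add: m adj_mult adj_add algebra_simps)
  also have "\<dots> = pd (a, b, \<gamma>) (adj i j (p * q)) - (if a = i then pd (j, b, \<gamma>) (p * q) else 0) + (if b = j then pd (a, i, \<gamma>) (p * q) else 0)"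
    unfolding mult by (simp add: m a adj_mult algebra_simps)
  finally show ?case .
next
  case (add p q)
  have a: "pd v (p + q) = pd v p + pd v q" for v and p q :: "'a mpoly" by (simp add: pd_def der_add)
  show ?case unfolding adj_add a add by (simp add: algebra_simps)
next
  case (Const x)
  then show ?case by (simp add: pd_def)
qed

lemma fin_dim_keys:
  assumes "finite M"
  shows "fin_dim {p :: real mpoly. keys p \<subseteq> M}"
  unfolding fin_dim_def
proof (intro exI conjI subsetI)
  let ?B = "(\<lambda>e. single e 1 :: real mpoly) ` M"
  show "finite ?B" using assms by simp
  fix p :: "real mpoly" assume "p \<in> {p. keys p \<subseteq> M}"
  then have p: "keys p \<subseteq> M" by simp
  have sc: "single e c = c *\<^sub>R single e (1::real)" for e :: "var \<Rightarrow>\<^sub>0 nat" and c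
    by (rule poly_mapping_eqI) (simp add: lookup_scaleR lookup_single when_def)
  then have "p = (\<Sum>e\<in>keys p. lookup p e *\<^sub>R single e 1)"
    by (simp only: poly_mapping_sum_single[symmetric] flip: sc)
  also have "\<dots> \<in> span ?B" using p by (intro span_sum span_scale span_base) auto
  finally show "p \<in> span ?B" .
qed

lemma finite_monomials:
  assumes "finite A"
  shows "finite {e :: var \<Rightarrow>\<^sub>0 nat. keys e \<subseteq> A \<and> tdeg e = N}"
proof -
  let ?S = "{e :: var \<Rightarrow>\<^sub>0 nat. keys e \<subseteq> A \<and> tdeg e = N}"
  have "lookup e v \<le> tdeg e" for e v
  proof (cases "v \<in> keys e")
    case True
    then show ?thesis unfolding tdeg_def by (intro member_le_sum) auto
  qed (simp add: in_keys_iff)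
  then have "lookup ` ?S \<subseteq> {f. \<forall>x. (x \<in> A \<longrightarrow> f x \<in> {..N}) \<and> (x \<notin> A \<longrightarrow> f x = 0)}"
    by (auto simp: in_keys_iff)
  moreover have "finite {f. \<forall>x. (x \<in> A \<longrightarrow> f x \<in> {..N}) \<and> (x \<notin> A \<longrightarrow> f x = (0::nat))}"
    using assms by (intro finite_set_of_finite_funs) auto
  ultimately have "finite (lookup ` ?S)" by (rule finite_subset)
  then show ?thesis by (rule finite_imageD) (intro inj_onI, simp only: poly_mapping_eq_iff)
qed

section \<open>Contractions of invariants\<close>

lemma finite_varidx [simp]: "finite (varidx ns d)"
  by (simp add: varidx_def)

lemma der_ldelta_varidx:
  assumes p: "vars_in (varidx ns d) p" and j: "j < sum_list ns"
  shows "der (ldelta i j) p = (\<Sum>l<sum_list ns. \<Sum>\<beta><d. Var (i, l, \<beta>) * pd (j, l, \<beta>) p)"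
proof -
  have "der (ldelta i j) p = (\<Sum>k<sum_list ns. \<Sum>l<sum_list ns. \<Sum>\<beta><d. if k = j then Var (i, l, \<beta>) * pd (k, l, \<beta>) p else 0)"
    unfolding der_expand[OF p finite_varidx] varidx_def atLeast0LessThan sum.cartesian_product
    by (intro sum.cong refl) (auto simp: ldelta_def)
  also have "\<dots> = (\<Sum>k<sum_list ns. if k = j then \<Sum>l<sum_list ns. \<Sum>\<beta><d. Var (i, l, \<beta>) * pd (k, l, \<beta>) p else 0)"
    by (intro sum.cong refl) auto
  finally show ?thesis using j by simp
qed

lemma der_rdelta_varidx:
  assumes p: "vars_in (varidx ns d) p" and i: "i < sum_list ns"
  shows "der (rdelta i j) p = (\<Sum>k<sum_list ns. \<Sum>\<alpha><d. Var (k, j, \<alpha>) * pd (k, i, \<alpha>) p)"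
proof -
  have "der (rdelta i j) p = (\<Sum>k<sum_list ns. \<Sum>l<sum_list ns. \<Sum>\<alpha><d. if l = i then Var (k, j, \<alpha>) * pd (k, l, \<alpha>) p else 0)"
    unfolding der_expand[OF p finite_varidx] varidx_def atLeast0LessThan sum.cartesian_product
    by (intro sum.cong refl) (auto simp: rdelta_def)
  also have "\<dots> = (\<Sum>k<sum_list ns. \<Sum>l<sum_list ns. if l = i then \<Sum>\<alpha><d. Var (k, j, \<alpha>) * pd (k, l, \<alpha>) p else 0)"
    by (intro sum.cong refl) auto
  finally show ?thesis using i by simp
qed

text \<open>The traced derivative is again a trace over a block. Its two defects cancel because the
  block contains both \<open>i\<close> and \<open>j\<close> or neither.\<close>

lemma inv_under_trace_pd:
  assumes p: "inv_under ns p" and c: "c < length ns"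
  shows "inv_under ns (\<Sum>j\<in>blockset ns c. pd (j, j, \<alpha>) p)"
  unfolding inv_under_def
proof (intro ballI, clarify)
  fix i j assume ij: "(i, j) \<in> same_block ns"
  then have b: "i \<in> blockset ns c \<longleftrightarrow> j \<in> blockset ns c"
    using c by (auto simp: same_block_def in_blockset_iff)
  have "adj i j (\<Sum>s\<in>blockset ns c. pd (s, s, \<alpha>) p) = (\<Sum>s\<in>blockset ns c. (if s = j then pd (j, i, \<alpha>) p else 0) - (if s = i then pd (j, i, \<alpha>) p else 0))"
    unfolding adj_sum adj_pd inv_underD[OF p ij] by (intro sum.cong refl) (auto simp: pd_def)
  also have "\<dots> = 0" using b by (simp add: sum_subtractf)
  finally show "adj i j (\<Sum>j\<in>blockset ns c. pd (j, j, \<alpha>) p) = 0" .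
qed

text \<open>Removing two letters of an invariant and inserting one new letter \<open>\<gamma>\<close> yields an invariant of
  smaller degree, from which the original contraction is recovered by substitution.\<close>

lemma inv_under_contract:
  fixes p :: "'f::comm_ring_1 mpoly" and \<alpha> \<beta> \<gamma> :: nat
  assumes p: "inv_under ns p" and c: "c < length ns"
  defines "Q k l \<equiv> (\<Sum>s\<in>blockset ns c. pd (s, l, \<beta>) (pd (k, s, \<alpha>) p))"
  shows "inv_under ns (\<Sum>k<sum_list ns. \<Sum>l<sum_list ns. Var (k, l, \<gamma>) * Q k l)"
  unfolding inv_under_def
proof (intro ballI, clarify)
  fix i j assume ij: "(i, j) \<in> same_block ns"
  then have b: "i \<in> blockset ns c \<longleftrightarrow> j \<in> blockset ns c" and n: "i < sum_list ns" "j < sum_list ns"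
    using c by (auto simp: same_block_def in_blockset_iff)
  have pd_lin: "pd v (x + y) = pd v x + pd v y" "pd v (x - y) = pd v x - pd v y" "pd v 0 = 0" for v and x y :: "'f mpoly"
    by (simp_all add: pd_def der_add der_diff)
  \<comment> \<open>The contracted index \<open>s\<close> drops out for the same reason as in a
    trace over the block, so \<open>Q\<close> transforms dually to the entries of the new
    matrix.\<close>
  have Q: "adj i j (Q k l) = (if l = j then Q k i else 0) - (if k = i then Q j l else 0)" for k l
  proof -
    have "adj i j (Q k l) = (\<Sum>s\<in>blockset ns c. (if l = j then pd (s, i, \<beta>) (pd (k, s, \<alpha>) p) else 0)
       - (if k = i then pd (s, l, \<beta>) (pd (j, s, \<alpha>) p) else 0)
       + (if s = j then pd (j, l, \<beta>) (pd (k, i, \<alpha>) p) else 0) - (if s = i then pd (j, l, \<beta>) (pd (k, i, \<alpha>) p) else 0))"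
      unfolding Q_def adj_sum adj_pd inv_underD[OF p ij]
      by (intro sum.cong refl) (auto simp: pd_lin algebra_simps)
    also have "\<dots> = (if l = j then Q k i else 0) - (if k = i then Q j l else 0)"
      using b by (simp add: sum.distrib sum_subtractf Q_def)
    finally show ?thesis .
  qed
  have "adj i j (\<Sum>k<sum_list ns. \<Sum>l<sum_list ns. Var (k, l, \<gamma>) * Q k l)
     = (\<Sum>k<sum_list ns. \<Sum>l<sum_list ns. (if l = j then Var (k, j, \<gamma>) * Q k i else 0) - (if k = i then Var (i, l, \<gamma>) * Q j l else 0)
         + (if k = j then Var (i, l, \<gamma>) * Q j l else 0) - (if l = i then Var (k, j, \<gamma>) * Q k i else 0))"
    unfolding adj_sum adj_mult Q adj_Var by (intro sum.cong refl) (auto simp: algebra_simps)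
  also have "\<dots> = (\<Sum>k<sum_list ns. Var (k, j, \<gamma>) * Q k i - (\<Sum>l<sum_list ns. if k = i then Var (i, l, \<gamma>) * Q j l else 0)
      + (\<Sum>l<sum_list ns. if k = j then Var (i, l, \<gamma>) * Q j l else 0) - Var (k, j, \<gamma>) * Q k i)"
    using n by (simp add: sum.distrib sum_subtractf)
  also have "\<dots> = (\<Sum>l<sum_list ns. \<Sum>k<sum_list ns. if k = j then Var (i, l, \<gamma>) * Q j l else 0)
      - (\<Sum>l<sum_list ns. \<Sum>k<sum_list ns. if k = i then Var (i, l, \<gamma>) * Q j l else 0)"
    unfolding sum.distrib sum_subtractf
    by (subst (1 3) sum.swap) simp
  also have "\<dots> = 0" using n by simp
  finally show "adj i j (\<Sum>k<sum_list ns. \<Sum>l<sum_list ns. Var (k, l, \<gamma>) * Q k l) = 0" .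
qed

lemma inv_under_zero [simp]: "inv_under ns 0"
  by (simp add: inv_under_def)

lemma inv_under_add:
  assumes "inv_under ns p" "inv_under ns q"
  shows "inv_under ns (p + q)"
  using inv_underD[OF assms(1)] inv_underD[OF assms(2)] by (auto simp: inv_under_def adj_add)

lemma inv_under_scaleR:
  assumes "inv_under ns (p :: real mpoly)"
  shows "inv_under ns (c *\<^sub>R p)"
  using inv_underD[OF assms] by (auto simp: inv_under_def scaleR_eq_Const_mult adj_mult)

lemma hom_in_zero [simp]: "hom_in A N 0"
  by (simp add: hom_in_def)

lemma hom_in_add:
  assumes "hom_in A N p" "hom_in A N q"
  shows "hom_in A N (p + q)"
  unfolding hom_in_def
proof
  fix e assume "e \<in> keys (p + q)"
  from subsetD[OF keys_add this] show "keys e \<subseteq> A \<and> tdeg e = N"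
    using assms unfolding hom_in_def by blast
qed

lemma hom_in_scaleR: "hom_in A N (p :: real mpoly) \<Longrightarrow> hom_in A N (c *\<^sub>R p)"
  by (simp add: hom_in_def in_keys_iff lookup_scaleR)

text \<open>Polarization in the row index alone. Unlike \<open>adj\<close>, it does not annihilate
  the invariants, although the operator still maps them to invariants.\<close>

definition left_casimir :: "nat list \<Rightarrow> real mpoly \<Rightarrow> real mpoly" where
  "left_casimir ns p = (\<Sum>(i, j)\<in>same_block ns. der (ldelta i j) (der (ldelta j i) p))"

lemma hom_in_ldelta:
  assumes "hom_in (varidx ns d) N p" "i < sum_list ns"
  shows "hom_in (varidx ns d) N (der (ldelta i j) p)"
proof (rule hom_in_der[OF _ assms(1)])
  fix v f assume "v \<in> varidx ns d" "f \<in> keys (ldelta i j v :: 'a mpoly)"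
  then show "keys f \<subseteq> varidx ns d \<and> tdeg f = 1"
    using assms(2) by (auto simp: ldelta_def Var_def varidx_def split: if_splits prod.splits)
qed

text \<open>A vector in the kernel is annihilated by every \<open>ldelta\<close>, in particular by
  the diagonal ones. These add up to the Euler operator, which multiplies \<open>p\<close> by the
  nonzero number \<open>N\<close>.\<close>

lemma left_casimir_inj:
  assumes p: "hom_in (varidx ns d) N p" and N: "N > 0" and z: "left_casimir ns p = 0"
  shows "p = 0"
proof -
  have "der (ldelta i i) p = 0" if "i < sum_list ns" for i
  proof -
    have "(i, i) \<in> same_block ns" using that by (simp add: same_block_def)
    then show ?thesis
      by (rule casimir_kernel[where F = "\<lambda>i j. der (ldelta i j)" and F' = "\<lambda>i j. der (ldelta j i)",
            OF finite_same_block z[unfolded left_casimir_def] apolar_ldelta])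
  qed
  then have "0 = (\<Sum>i<sum_list ns. der (ldelta i i) p)" by simp
  also have "\<dots> = der (\<lambda>v. Const 1 * Var v) p"
  proof (rule derivation_eqI[OF hom_in_vars_in[OF p]])
    fix v assume "v \<in> varidx ns d"
    then show "(\<Sum>i<sum_list ns. der (ldelta i i) (Var v)) = der (\<lambda>v. Const 1 * Var v) (Var v :: real mpoly)"
      by (auto simp: ldelta_def varidx_def)
  qed (simp_all add: der_add der_mult sum.distrib sum_distrib_left sum_distrib_right)
  finally have e: "der (\<lambda>v. Const 1 * Var v) p = 0" by simp
  show ?thesis
  proof (rule poly_mapping_eqI)
    fix e
    have "0 = lookup (der (\<lambda>v. Const 1 * Var v) p) e" unfolding e by simp
    also have "\<dots> = real (tdeg e) * lookup p e"
      unfolding lookup_der_Var_scale by (simp add: tdeg_def)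
    also have "\<dots> = real N * lookup p e"
      using p unfolding hom_in_def by (cases "e \<in> keys p") (auto simp: in_keys_iff)
    finally show "lookup p e = lookup 0 e" using N by simp
  qed
qed

text \<open>Invariance exchanges the inner left polarization for the right one. By the product rule
  the outer one then either hits the variable just produced, giving a trace times a traced
  derivative, or the derivative of \<open>p\<close>, giving entries of a product of two generic
  matrices with a block idempotent in between.\<close>

lemma left_casimir_inv:
  assumes p: "inv_under ns p" "vars_in (varidx ns d) p"
  shows "left_casimir ns p =
     (\<Sum>c<length ns. \<Sum>\<alpha><d. (\<Sum>i\<in>blockset ns c. Var (i, i, \<alpha>)) * (\<Sum>j\<in>blockset ns c. pd (j, j, \<alpha>) p))
   + (\<Sum>c<length ns. \<Sum>\<alpha><d. \<Sum>\<beta><d. \<Sum>k<sum_list ns. \<Sum>l<sum_list ns.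
        (\<Sum>i\<in>blockset ns c. Var (k, i, \<alpha>) * Var (i, l, \<beta>)) * (\<Sum>j\<in>blockset ns c. pd (j, l, \<beta>) (pd (k, j, \<alpha>) p)))"
proof -
  have vpd: "vars_in (varidx ns d) (pd v p)" for v
  proof -
    have "keys e \<subseteq> varidx ns d" if "e \<in> keys (pd v p)" for e
    proof -
      have "e + single v 1 \<in> keys p" using that by (auto simp: in_keys_iff lookup_pd)
      then have "keys (e + single v 1) \<subseteq> varidx ns d" using p(2) unfolding vars_in_def by blast
      then show ?thesis by (simp add: keys_add_monomial)
    qed
    then show ?thesis by (simp add: vars_in_def)
  qed
  let ?n = "sum_list ns"
  have "der (ldelta i j) (der (ldelta j i) p) = (\<Sum>\<alpha><d. Var (i, i, \<alpha>) * pd (j, j, \<alpha>) p)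
      + (\<Sum>\<alpha><d. \<Sum>\<beta><d. \<Sum>k<?n. \<Sum>l<?n. Var (k, i, \<alpha>) * Var (i, l, \<beta>) * pd (j, l, \<beta>) (pd (k, j, \<alpha>) p))"
    if ij: "(i, j) \<in> same_block ns" for i j
  proof -
    have n: "i < ?n" "j < ?n" and ji: "(j, i) \<in> same_block ns" using ij by (auto simp: same_block_def)
    have "der (ldelta j i) p = der (rdelta j i) p" using inv_underD[OF p(1) ji] by (simp add: adj_eq)
    also have "\<dots> = (\<Sum>\<alpha><d. \<Sum>k<?n. Var (k, i, \<alpha>) * pd (k, j, \<alpha>) p)"
      unfolding der_rdelta_varidx[OF p(2) n(2)] by (rule sum.swap)
    finally have "der (ldelta i j) (der (ldelta j i) p) = (\<Sum>\<alpha><d. \<Sum>k<?n. (if k = j then Var (i, i, \<alpha>) * pd (j, j, \<alpha>) p else 0)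
        + (\<Sum>l<?n. \<Sum>\<beta><d. Var (k, i, \<alpha>) * Var (i, l, \<beta>) * pd (j, l, \<beta>) (pd (k, j, \<alpha>) p)))"
      by (simp add: der_sum der_mult der_ldelta_varidx[OF vpd n(2)] ldelta_def sum_distrib_left)
        (intro sum.cong refl, auto simp: mult.assoc)
    also have "\<dots> = (\<Sum>\<alpha><d. Var (i, i, \<alpha>) * pd (j, j, \<alpha>) p)
      + (\<Sum>\<alpha><d. \<Sum>k<?n. \<Sum>l<?n. \<Sum>\<beta><d. Var (k, i, \<alpha>) * Var (i, l, \<beta>) * pd (j, l, \<beta>) (pd (k, j, \<alpha>) p))"
      using n by (simp add: sum.distrib)
    also have "(\<Sum>\<alpha><d. \<Sum>k<?n. \<Sum>l<?n. \<Sum>\<beta><d. Var (k, i, \<alpha>) * Var (i, l, \<beta>) * pd (j, l, \<beta>) (pd (k, j, \<alpha>) p))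
       = (\<Sum>\<alpha><d. \<Sum>k<?n. \<Sum>\<beta><d. \<Sum>l<?n. Var (k, i, \<alpha>) * Var (i, l, \<beta>) * pd (j, l, \<beta>) (pd (k, j, \<alpha>) p))"
      by (rule sum.cong[OF refl], rule sum.cong[OF refl], rule sum.swap)
    also have "\<dots> = (\<Sum>\<alpha><d. \<Sum>\<beta><d. \<Sum>k<?n. \<Sum>l<?n. Var (k, i, \<alpha>) * Var (i, l, \<beta>) * pd (j, l, \<beta>) (pd (k, j, \<alpha>) p))"
      by (rule sum.cong[OF refl], rule sum.swap)
    finally show ?thesis .
  qed
  then have "left_casimir ns p = (\<Sum>(i, j)\<in>same_block ns. (\<Sum>\<alpha><d. Var (i, i, \<alpha>) * pd (j, j, \<alpha>) p)
      + (\<Sum>\<alpha><d. \<Sum>\<beta><d. \<Sum>k<?n. \<Sum>l<?n. Var (k, i, \<alpha>) * Var (i, l, \<beta>) * pd (j, l, \<beta>) (pd (k, j, \<alpha>) p)))"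
    unfolding left_casimir_def by (intro sum.cong refl) auto
  also have "\<dots> = (\<Sum>c<length ns. \<Sum>i\<in>blockset ns c. \<Sum>j\<in>blockset ns c. \<Sum>\<alpha><d. Var (i, i, \<alpha>) * pd (j, j, \<alpha>) p)
     + (\<Sum>c<length ns. \<Sum>i\<in>blockset ns c. \<Sum>j\<in>blockset ns c. \<Sum>\<alpha><d. \<Sum>\<beta><d. \<Sum>k<?n. \<Sum>l<?n. Var (k, i, \<alpha>) * Var (i, l, \<beta>) * pd (j, l, \<beta>) (pd (k, j, \<alpha>) p))"
    unfolding sum_same_block by (simp only: sum.distrib)
  also have "(\<Sum>c<length ns. \<Sum>i\<in>blockset ns c. \<Sum>j\<in>blockset ns c. \<Sum>\<alpha><d. Var (i, i, \<alpha>) * pd (j, j, \<alpha>) p)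
     = (\<Sum>c<length ns. \<Sum>\<alpha><d. (\<Sum>i\<in>blockset ns c. Var (i, i, \<alpha>)) * (\<Sum>j\<in>blockset ns c. pd (j, j, \<alpha>) p))"
  proof (rule sum.cong[OF refl])
    fix c
    let ?B = "blockset ns c"
    let ?f = "\<lambda>i j \<alpha>. Var (i, i, \<alpha>) * pd (j, j, \<alpha>) p"
    have "(\<Sum>i\<in>?B. \<Sum>j\<in>?B. \<Sum>\<alpha><d. ?f i j \<alpha>) = (\<Sum>i\<in>?B. \<Sum>\<alpha><d. \<Sum>j\<in>?B. ?f i j \<alpha>)"
      by (rule sum.cong[OF refl], rule sum.swap)
    also have "\<dots> = (\<Sum>\<alpha><d. \<Sum>i\<in>?B. \<Sum>j\<in>?B. ?f i j \<alpha>)" by (rule sum.swap)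
    finally show "(\<Sum>i\<in>?B. \<Sum>j\<in>?B. \<Sum>\<alpha><d. ?f i j \<alpha>) = (\<Sum>\<alpha><d. (\<Sum>i\<in>?B. Var (i, i, \<alpha>)) * (\<Sum>j\<in>?B. pd (j, j, \<alpha>) p))"
      unfolding sum_product .
  qed
  also have "(\<Sum>c<length ns. \<Sum>i\<in>blockset ns c. \<Sum>j\<in>blockset ns c. \<Sum>\<alpha><d. \<Sum>\<beta><d. \<Sum>k<?n. \<Sum>l<?n. Var (k, i, \<alpha>) * Var (i, l, \<beta>) * pd (j, l, \<beta>) (pd (k, j, \<alpha>) p))
     = (\<Sum>c<length ns. \<Sum>\<alpha><d. \<Sum>\<beta><d. \<Sum>k<?n. \<Sum>l<?n.
        (\<Sum>i\<in>blockset ns c. Var (k, i, \<alpha>) * Var (i, l, \<beta>)) * (\<Sum>j\<in>blockset ns c. pd (j, l, \<beta>) (pd (k, j, \<alpha>) p)))"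
  proof (rule sum.cong[OF refl])
    fix c
    let ?B = "blockset ns c"
    let ?f = "\<lambda>i j \<alpha> \<beta> k l. Var (k, i, \<alpha>) * Var (i, l, \<beta>) * pd (j, l, \<beta>) (pd (k, j, \<alpha>) p)"
    have "(\<Sum>i\<in>?B. \<Sum>j\<in>?B. \<Sum>\<alpha><d. \<Sum>\<beta><d. \<Sum>k<?n. \<Sum>l<?n. ?f i j \<alpha> \<beta> k l)
        = (\<Sum>(i, j)\<in>?B \<times> ?B. \<Sum>(\<alpha>, \<beta>, k, l)\<in>{..<d} \<times> {..<d} \<times> {..<?n} \<times> {..<?n}. ?f i j \<alpha> \<beta> k l)"
      by (simp only: sum.cartesian_product[symmetric])
    also have "\<dots> = (\<Sum>(\<alpha>, \<beta>, k, l)\<in>{..<d} \<times> {..<d} \<times> {..<?n} \<times> {..<?n}. \<Sum>(i, j)\<in>?B \<times> ?B. ?f i j \<alpha> \<beta> k l)"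
      unfolding case_prod_unfold by (rule sum.swap)
    also have "\<dots> = (\<Sum>\<alpha><d. \<Sum>\<beta><d. \<Sum>k<?n. \<Sum>l<?n. \<Sum>i\<in>?B. \<Sum>j\<in>?B. ?f i j \<alpha> \<beta> k l)"
      by (simp only: sum.cartesian_product[symmetric])
    finally show "(\<Sum>i\<in>?B. \<Sum>j\<in>?B. \<Sum>\<alpha><d. \<Sum>\<beta><d. \<Sum>k<?n. \<Sum>l<?n. ?f i j \<alpha> \<beta> k l)
      = (\<Sum>\<alpha><d. \<Sum>\<beta><d. \<Sum>k<?n. \<Sum>l<?n. (\<Sum>i\<in>?B. Var (k, i, \<alpha>) * Var (i, l, \<beta>)) * (\<Sum>j\<in>?B. pd (j, l, \<beta>) (pd (k, j, \<alpha>) p)))"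
      unfolding sum_product .
  qed
  finally show ?thesis .
qed

theorem first_fundamental_theorem:
  fixes p :: "real mpoly"
  assumes "inv_under ns p" "hom_in (varidx ns d) N p"
  shows "p \<in> U_ptr ns d"
  using assms
proof (induction N arbitrary: d p rule: less_induct)
  case (less N)
  show ?case
  proof (cases "N = 0")
    case True
    have "p = Const (lookup p 0)"
    proof (rule poly_mapping_eqI)
      fix e
      have "e = 0" if "e \<in> keys p"
        using less.prems(2) that True unfolding hom_in_def tdeg_def
        by (auto simp: in_keys_iff intro!: poly_mapping_eqI)
      then show "lookup p e = lookup (Const (lookup p 0)) e"
        by (cases "e = 0") (auto simp: Const_def lookup_single in_keys_iff when_def)
    qed
    then show ?thesis unfolding U_ptr_def by (metis subalg.const)
  next
    case False
    then have N: "N > 0" by simp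
    let ?n = "sum_list ns"
    have step: "left_casimir ns q \<in> U_ptr ns d" if q: "inv_under ns q" "hom_in (varidx ns d) N q" for q
    proof -
      note vq = hom_in_vars_in[OF q(2)]
      have 1: "(\<Sum>i\<in>blockset ns c. Var (i, i, \<alpha>)) * (\<Sum>j\<in>blockset ns c. pd (j, j, \<alpha>) q) \<in> U_ptr ns d"
        if c: "c < length ns" and a: "\<alpha> < d" for c \<alpha>
      proof (rule U_ptr_mult)
        have "mtr ?n (wordmat ns [(c, \<alpha>)]) \<in> ptr_gens ns d" unfolding ptr_gens_def using c a by fastforce
        then show "(\<Sum>i\<in>blockset ns c. Var (i, i, \<alpha>)) \<in> U_ptr ns d"
          unfolding mtr_wordmat_single[OF c] U_ptr_def by (rule subalg.gen)
        show "(\<Sum>j\<in>blockset ns c. pd (j, j, \<alpha>) q) \<in> U_ptr ns d"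
          using N by (intro less.IH[of "N - 1"] inv_under_trace_pd hom_in_sum hom_in_pd q c) simp
      qed
      have 2: "(\<Sum>k<?n. \<Sum>l<?n. (\<Sum>i\<in>blockset ns c. Var (k, i, \<alpha>) * Var (i, l, \<beta>)) * (\<Sum>j\<in>blockset ns c. pd (j, l, \<beta>) (pd (k, j, \<alpha>) q))) \<in> U_ptr ns d"
        if c: "c < length ns" and a: "\<alpha> < d" and b: "\<beta> < d" for c \<alpha> \<beta>
      proof -
        let ?Q = "\<lambda>k l. \<Sum>j\<in>blockset ns c. pd (j, l, \<beta>) (pd (k, j, \<alpha>) q)"
        let ?q = "\<Sum>k<?n. \<Sum>l<?n. Var (k, l, d) * ?Q k l"
        \<comment> \<open>Two derivatives lower the degree by 2 and the new letter restores 1, so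
          \<open>?q\<close> has degree \<open>N - 1\<close>. The form with \<open>+ 2\<close> is
          vacuous for \<open>N = 1\<close>, where there are no keys.\<close>
        have keysQ: "keys e \<subseteq> varidx ns d \<and> tdeg e + 2 = N" if "e \<in> keys (?Q k l)" for e k l
        proof -
          from subsetD[OF keys_sum that] obtain j where "e \<in> keys (pd (j, l, \<beta>) (pd (k, j, \<alpha>) q))" by blast
          from keys_pd[OF hom_in_pd[OF q(2)] this] N show ?thesis by auto
        qed
        have "hom_in (varidx ns (Suc d)) (N - 1) ?q"
        proof (intro hom_in_sum)
          fix k l assume kl: "k \<in> {..<?n}" "l \<in> {..<?n}"
          show "hom_in (varidx ns (Suc d)) (N - 1) (Var (k, l, d) * ?Q k l)"
            unfolding hom_in_def
          proof
            fix e assume "e \<in> keys (Var (k, l, d) * ?Q k l)"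
            from subsetD[OF keys_mult this] obtain e1 e2 where "e = e1 + e2" "e1 \<in> keys (Var (k, l, d) :: real mpoly)" "e2 \<in> keys (?Q k l)"
              by blast
            moreover from this have "e1 = single (k, l, d) 1" by (simp add: Var_def)
            moreover from calculation have "keys e2 \<subseteq> varidx ns d \<and> tdeg e2 + 2 = N" by (intro keysQ)
            ultimately show "keys e \<subseteq> varidx ns (Suc d) \<and> tdeg e = N - 1"
              using kl by (auto simp: keys_add_monomial tdeg_add varidx_def)
          qed
        qed
        then have "?q \<in> U_ptr ns (Suc d)"
          using N by (intro less.IH[of "N - 1"] inv_under_contract q c) simp
        then have "merge ns d c \<alpha> \<beta> ?q \<in> U_ptr ns d" by (rule merge_U_ptr[OF c a b])
        \<comment> \<open>Only the letter \<open>d\<close> is substituted, and the coefficients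
          \<open>?Q k l\<close> are free of it, so \<open>merge\<close> turns \<open>?q\<close> into
          exactly the contraction that is wanted.\<close>
        moreover have "merge ns d c \<alpha> \<beta> (?Q k l) = ?Q k l" for k l
          using keysQ by (intro merge_vars_in[OF c a b]) (auto simp: vars_in_def)
        ultimately show ?thesis by (simp only: merge_simps[OF c a b]) simp
      qed
      show ?thesis unfolding left_casimir_inv[OF q(1) vq]
      proof (rule U_ptr_add)
        show "(\<Sum>c<length ns. \<Sum>\<alpha><d. (\<Sum>i\<in>blockset ns c. Var (i, i, \<alpha>)) * (\<Sum>j\<in>blockset ns c. pd (j, j, \<alpha>) q)) \<in> U_ptr ns d"
          by (rule U_ptr_sum, rule U_ptr_sum, rule 1) simp_all
      qed (rule U_ptr_sum, rule U_ptr_sum, rule U_ptr_sum, rule 2, simp_all)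
    qed
    define I where "I = {q :: real mpoly. inv_under ns q \<and> hom_in (varidx ns d) N q}"
    have lin: "linear (left_casimir ns)"
      unfolding left_casimir_def case_prod_unfold
      by (intro linear_compose_sum ballI linear_compose[OF linear_der linear_der, unfolded o_def])
    have fd: "fin_dim I"
      by (rule fin_dim_subset[OF fin_dim_keys[OF finite_monomials[OF finite_varidx[of ns d], of N]]])
        (auto simp: I_def hom_in_def)
    have sub: "subspace I"
      by (rule subspaceI) (auto simp: I_def inv_under_zero hom_in_zero
        intro: inv_under_add hom_in_add inv_under_scaleR hom_in_scaleR)
    have "inj_on (left_casimir ns) I"
    proof (rule inj_onI)
      fix x y assume xy: "x \<in> I" "y \<in> I" "left_casimir ns x = left_casimir ns y"
      then have "left_casimir ns (x - y) = 0" using lin by (simp add: linear_diff)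
      moreover have "x - y \<in> I" using xy sub by (simp add: subspace_diff)
      ultimately have "x - y = 0" unfolding I_def using N left_casimir_inj by blast
      then show "x = y" by simp
    qed
    moreover have "left_casimir ns ` I \<subseteq> I"
    proof
      fix y assume "y \<in> left_casimir ns ` I"
      then obtain x where x: "x \<in> I" and y: "y = left_casimir ns x" by blast
      \<comment> \<open>Invariance of the image is not computed: it is read off from membership in
        the trace ring, which \<open>step\<close> provides.\<close>
      have "inv_under ns y" unfolding y using step x U_ptr_inv unfolding I_def by blast
      moreover have "hom_in (varidx ns d) N y" unfolding y left_casimir_def
        using x by (intro hom_in_sum) (auto simp: I_def same_block_def intro!: hom_in_ldelta)
      ultimately show "y \<in> I" by (simp add: I_def)
    qed
    ultimately have "left_casimir ns ` I = I" by (intro inj_endo_surj sub fd lin)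
    moreover have "p \<in> I" using less.prems by (simp add: I_def)
    ultimately obtain q where "q \<in> I" "p = left_casimir ns q" by blast
    then show ?thesis using step unfolding I_def by blast
  qed
qed

section \<open>The fermionic Fock space\<close>

instantiation "fun" :: (type, real_vector) real_vector
begin

definition scaleR_fun :: "real \<Rightarrow> ('a \<Rightarrow> 'b) \<Rightarrow> 'a \<Rightarrow> 'b" where
  "scaleR_fun c f = (\<lambda>x. c *\<^sub>R f x)"

instance
  by intro_classes (auto simp: scaleR_fun_def plus_fun_def scaleR_add_right scaleR_add_left)

end

type_synonym state = "nat set \<Rightarrow> real mpoly"

text \<open>Linear endomorphisms are made a type so that they form a ring in which
  \<open>gl_fermions\<close> can be interpreted.\<close>

typedef state_op = "{f :: state \<Rightarrow> state. linear f}"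
  morphisms app Op
  using linear_id by blast

setup_lifting type_definition_state_op

lemma linear_app: "linear (app x)"
  using app[of x] by simp

instantiation state_op :: ring_1
begin

lift_definition zero_state_op :: state_op is "\<lambda>y. 0"
  by (rule linear_zero)
lift_definition one_state_op :: state_op is "\<lambda>y. y"
  by (rule linear_ident)
lift_definition plus_state_op :: "state_op \<Rightarrow> state_op \<Rightarrow> state_op" is "\<lambda>f g y. f y + g y"
  by (rule linear_compose_add)
lift_definition minus_state_op :: "state_op \<Rightarrow> state_op \<Rightarrow> state_op" is "\<lambda>f g y. f y - g y"
  by (rule linear_compose_sub)
lift_definition uminus_state_op :: "state_op \<Rightarrow> state_op" is "\<lambda>f y. - f y"
  by (rule linear_compose_neg)
lift_definition times_state_op :: "state_op \<Rightarrow> state_op \<Rightarrow> state_op" is "\<lambda>f g y. f (g y)"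
  using linear_compose by (force simp: o_def)

instance
proof
  have "(\<lambda>y :: state. 0 :: state) \<noteq> (\<lambda>y. y)"
  proof
    assume "(\<lambda>y :: state. 0 :: state) = (\<lambda>y. y)"
    then have "(0 :: state) = (\<lambda>S. 1)" by (rule fun_cong)
    from fun_cong[OF this, of "{}"] show False by simp
  qed
  then show "(0 :: state_op) \<noteq> 1" by transfer
qed (transfer; auto simp: linear_add linear_diff fun_eq_iff)+

end

lemma app_simps [simp]:
  "app 0 y = 0" "app 1 y = y" "app (x + x') y = app x y + app x' y" "app (x - x') y = app x y - app x' y"
  "app (- x) y = - app x y" "app (x * x') y = app x (app x' y)"
  by (transfer; simp)+

lemma app_sum: "app (sum f A) y = (\<Sum>i\<in>A. app (f i) y)"
  by (induction A rule: infinite_finite_induct) simp_all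

lemma app_zero [simp]: "app x 0 = 0"
  using linear_app linear_0 by blast

lemma op_eqI: "(\<And>y S. app x y S = app x' y S) \<Longrightarrow> x = x'"
  by (metis app_inject ext)

lemma sum_fun_apply: "(sum f A :: 'a \<Rightarrow> 'b::comm_monoid_add) x = (\<Sum>i\<in>A. f i x)"
  by (induction A rule: infinite_finite_induct) simp_all

text \<open>Jordan-Wigner sign of the mode \<open>k\<close> relative to the occupied modes \<open>S\<close>.\<close>

definition jw :: "nat \<Rightarrow> nat set \<Rightarrow> real" where
  "jw k S = (-1) ^ card {a \<in> S. a < k}"

lemma jw_square [simp]: "jw k S * jw k S = 1"
  by (simp add: jw_def flip: power_add) 

lemma jw_insert: "l \<notin> S \<Longrightarrow> jw k (insert l S) = (if l < k then - jw k S else jw k S)"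
proof -
  assume l: "l \<notin> S"
  have "{a \<in> insert l S. a < k} = (if l < k then insert l {a \<in> S. a < k} else {a \<in> S. a < k})" by auto
  moreover have "finite {a \<in> S. a < k}" by (rule finite_subset[of _ "{..<k}"]) auto
  ultimately show ?thesis using l by (simp add: jw_def)
qed

lemma jw_remove: "l \<in> S \<Longrightarrow> jw k (S - {l}) = (if l < k then - jw k S else jw k S)"
  using jw_insert[of l "S - {l}" k] by (auto simp: insert_absorb split: if_splits)

lift_definition op_E :: "nat \<Rightarrow> nat \<Rightarrow> state_op" is "\<lambda>i j y S. adj i j (y S)"
  by (rule linearI) (auto simp: scaleR_fun_def adj_add scaleR_eq_Const_mult adj_mult fun_eq_iff)

text \<open>The operators act on coefficients, so creation evaluated at \<open>S\<close> reads the
  argument at \<open>S - {k}\<close>, and annihilation reads it at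
  \<open>insert k S\<close>.\<close>

lift_definition op_c :: "nat \<Rightarrow> state_op" is "\<lambda>k y S. if k \<in> S then jw k S *\<^sub>R y (S - {k}) else 0"
  by (rule linearI) (auto simp: scaleR_fun_def fun_eq_iff scaleR_add_right)

lift_definition op_b :: "nat \<Rightarrow> state_op" is "\<lambda>k y S. if k \<notin> S then jw k S *\<^sub>R y (insert k S) else 0"
  by (rule linearI) (auto simp: scaleR_fun_def fun_eq_iff scaleR_add_right)

text \<open>On infinite \<open>S\<close> the parity is set to \<open>0\<close>, so that it anticommutes with all fermions.\<close>

lift_definition op_parity :: state_op is "\<lambda>y S. (if finite S then (-1) ^ card S else 0) *\<^sub>R y S"
  by (rule linearI) (auto simp: scaleR_fun_def fun_eq_iff scaleR_add_right)

lemma op_c_c: "op_c k * op_c l = - (op_c l * op_c k)"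
proof (rule op_eqI)
  fix y S
  show "app (op_c k * op_c l) y S = app (- (op_c l * op_c k)) y S"
  proof (cases "k = l")
    case False
    have "S - {k} - {l} = S - {l} - {k}" by auto
    then show ?thesis using False
      by (simp add: op_c.rep_eq jw_remove)
  qed (simp add: op_c.rep_eq)
qed

lemma op_b_b: "op_b k * op_b l = - (op_b l * op_b k)"
proof (rule op_eqI)
  fix y S
  show "app (op_b k * op_b l) y S = app (- (op_b l * op_b k)) y S"
  proof (cases "k = l")
    case False
    have "insert k (insert l S) = insert l (insert k S)" by auto
    then show ?thesis using False
      by (simp add: op_b.rep_eq jw_insert)
  qed (simp add: op_b.rep_eq)
qed

lemma op_b_c: "op_b k * op_c l = (if k = l then 1 else 0) - op_c l * op_b k"
proof (rule op_eqI)
  fix y S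
  show "app (op_b k * op_c l) y S = app ((if k = l then 1 else 0) - op_c l * op_b k) y S"
  proof (cases "k = l")
    case True
    then show ?thesis
      by (auto simp: op_b.rep_eq op_c.rep_eq jw_insert jw_remove insert_absorb)
  next
    case False
    then have "insert k S - {l} = insert k (S - {l})" by auto
    then show ?thesis using False
      by (auto simp: op_b.rep_eq op_c.rep_eq jw_insert jw_remove)
  qed
qed

lemma op_E_E: "op_E i j * op_E k l = op_E k l * op_E i j + (if j = k then op_E i l else 0) - (if l = i then op_E k j else 0)"
  by (rule op_eqI) (simp add: op_E.rep_eq adj_commutator[of i j k l])

lemma adj_scaleR: "adj i j (c *\<^sub>R p) = c *\<^sub>R adj i j (p :: real mpoly)"
  by (simp add: scaleR_eq_Const_mult adj_mult)

lemma op_E_c: "op_E i j * op_c k = op_c k * op_E i j"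
  by (rule op_eqI) (simp add: op_E.rep_eq op_c.rep_eq adj_scaleR)

lemma op_E_b: "op_E i j * op_b k = op_b k * op_E i j"
  by (rule op_eqI) (simp add: op_E.rep_eq op_b.rep_eq adj_scaleR)

lemma op_parity_E: "op_parity * op_E i j = op_E i j * op_parity"
  by (rule op_eqI) (simp add: op_E.rep_eq op_parity.rep_eq adj_scaleR)

lemma op_parity_c: "op_parity * op_c k = - (op_c k * op_parity)"
proof (rule op_eqI)
  fix y S
  have "(-1 :: real) ^ card S = - ((-1) ^ card (S - {k}))" if "k \<in> S" "finite S"
    by (simp only: card.remove[OF that(2,1)] power_Suc mult_minus1)
  then show "app (op_parity * op_c k) y S = app (- (op_c k * op_parity)) y S"
    by (cases "k \<in> S \<and> finite S") (auto simp: op_c.rep_eq op_parity.rep_eq simp del: card_Diff_singleton card_Diff_insert)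
qed

lemma op_parity_b: "op_parity * op_b k = - (op_b k * op_parity)"
  by (rule op_eqI) (auto simp: op_b.rep_eq op_parity.rep_eq)

text \<open>The numbering of the modes by \<open>prod_encode\<close> fixes an order for the signs;
  the relations depend only on its injectivity.\<close>

interpretation ferm: gl_fermions "sum_list ns" "\<lambda>i j. blk ns i = blk ns j" op_E
    "\<lambda>i l. op_c (prod_encode (i, l))" "\<lambda>i l. op_b (prod_encode (i, l))" for ns
proof unfold_locales
  show "op_b (prod_encode (i, j)) * op_c (prod_encode (k, l)) = (if i = k \<and> j = l then 1 else 0) - op_c (prod_encode (k, l)) * op_b (prod_encode (i, j))" for i j k l
    using op_b_c[of "prod_encode (i, j)" "prod_encode (k, l)"] by (simp add: prod_encode_eq)
qed (rule op_E_E op_E_c op_E_b op_c_c op_b_b | simp)+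

section \<open>Weights of modes and monomials\<close>

lemma op_c_b_number: "app (op_c k * op_b k) y S = (if k \<in> S then y S else 0)"
  by (auto simp: op_c.rep_eq op_b.rep_eq insert_absorb jw_remove)

definition root_modes :: "nat list \<Rightarrow> nat set" where
  "root_modes ns = prod_encode ` {(i, l). i < l \<and> (i, l) \<in> same_block ns}"

text \<open>The mode \<open>(i, l)\<close> has weight +1 at \<open>l\<close> and -1 at
  \<open>i\<close>, matching the Laurent monomial \<open>z l / z i\<close> in the asymmetric
  density.\<close>

definition fweight :: "nat list \<Rightarrow> nat set \<Rightarrow> nat \<Rightarrow> int" where
  "fweight ns S l = int (card {i. i < l \<and> (i, l) \<in> same_block ns \<and> prod_encode (i, l) \<in> S})
     - int (card {j. l < j \<and> (l, j) \<in> same_block ns \<and> prod_encode (l, j) \<in> S})"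

lemma finite_root_modes [simp]: "finite (root_modes ns)"
  unfolding root_modes_def by (rule finite_imageI, rule finite_subset[OF _ finite_same_block[of ns]]) auto

lemma weight_op_apply:
  assumes "l < sum_list ns"
  shows "app (ferm.weight_op ns l) y S = adj l l (y S) + of_int (fweight ns S l) *\<^sub>R y S"
proof -
  have sc: "(\<Sum>i\<in>A. if prod_encode (f i) \<in> S then y S else 0) = real (card {i \<in> A. prod_encode (f i) \<in> S}) *\<^sub>R y S"
    if "finite A" for A and f :: "nat \<Rightarrow> nat \<times> nat"
    using that by (simp add: sum.inter_filter[symmetric] sum_constant_scaleR del: sum_constant)
  let ?A = "{j. Suc l \<le> j \<and> j < sum_list ns \<and> blk ns l = blk ns j}"
  have 1: "{j. l < j \<and> (l, j) \<in> same_block ns \<and> prod_encode (l, j) \<in> S} = {j \<in> ?A. prod_encode (l, j) \<in> S}"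
    using assms by (auto simp: same_block_def)
  have 2: "{i. i < l \<and> (i, l) \<in> same_block ns \<and> prod_encode (i, l) \<in> S} = {i \<in> ferm.below ns l. prod_encode (i, l) \<in> S}"
    using assms by (auto simp: same_block_def ferm.below_def)
  have finA: "finite ?A" by simp
  show ?thesis
    unfolding ferm.weight_op_def ferm.diag_E_def fweight_def 1 2
    by (simp add: app_sum sum_fun_apply op_c_b_number[simplified] op_E.rep_eq sc[OF finA] sc[OF ferm.finite_below] algebra_simps)
qed

text \<open>The exponent of \<open>z l\<close> in the integrand: a variable with indices
  \<open>(i, j, \<alpha>)\<close> contributes \<open>z i / z j\<close>.\<close>

definition mweight :: "(var \<Rightarrow>\<^sub>0 nat) \<Rightarrow> nat \<Rightarrow> int" where
  "mweight e l = (\<Sum>v\<in>keys e. int (lookup e v) * (of_bool (fst v = l) - of_bool (fst (snd v) = l)))"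

lemma lookup_adj_diag: "lookup (adj l l p) e = of_int (mweight e l) * lookup (p :: real mpoly) e"
proof -
  have "(\<lambda>v. ldelta l l v - rdelta l l v :: real mpoly) = (\<lambda>v. Const (of_bool (fst v = l) - of_bool (fst (snd v) = l)) * Var v)"
  proof
    fix v :: var
    obtain i j \<alpha> where v: "v = (i, j, \<alpha>)" by (cases v)
    have m: "Const (-1) * q = - q" for q :: "real mpoly" by (rule poly_mapping_eqI) simp
    show "ldelta l l v - rdelta l l v = Const (of_bool (fst v = l) - of_bool (fst (snd v) = l)) * (Var v :: real mpoly)"
      unfolding v by (auto simp: ldelta_def rdelta_def m)
  qed
  then show ?thesis unfolding adj_def by (simp add: lookup_der_Var_scale mweight_def)
qed

text \<open>The span of the basis states, a wedge times a monomial, indexed by \<open>Z\<close>. It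
  lets cardinalities be handled as dimensions.\<close>

definition supp_in :: "(nat set \<times> (var \<Rightarrow>\<^sub>0 nat)) set \<Rightarrow> state set" where
  "supp_in Z = {y. \<forall>S e. (S, e) \<notin> Z \<longrightarrow> lookup (y S) e = 0}"

lemma subspace_supp_in: "subspace (supp_in Z)"
  by (rule subspaceI) (auto simp: supp_in_def scaleR_fun_def lookup_scaleR lookup_add)

lemma dim_supp_in:
  assumes Z: "finite Z"
  shows "dim (supp_in Z) = card Z" "fin_dim (supp_in Z)"
proof -
  define st :: "nat set \<times> (var \<Rightarrow>\<^sub>0 nat) \<Rightarrow> state" where
    "st z = (\<lambda>S. if S = fst z then single (snd z) 1 else 0)" for z
  have lk: "lookup (st z S) e = (if z = (S, e) then 1 else 0)" for z S e
    by (auto simp: st_def lookup_single when_def)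
  have lksum: "lookup ((\<Sum>z\<in>Z. u z *\<^sub>R st z) S) e = (if (S, e) \<in> Z then u (S, e) else 0)" for u S e
    using Z by (simp add: sum_fun_apply lookup_sum scaleR_fun_def lookup_scaleR lk if_distrib cong: if_cong)
  have inj: "inj_on st Z"
  proof (rule inj_onI)
    fix z z' assume "st z = st z'"
    then have "lookup (st z (fst z)) (snd z) = lookup (st z' (fst z)) (snd z)" by simp
    then show "z = z'" unfolding lk by (simp split: if_splits)
  qed
  have ind: "independent (st ` Z)"
  proof
    assume "dependent (st ` Z)"
    then obtain u where u: "(\<Sum>v\<in>st ` Z. u v *\<^sub>R v) = 0" "\<exists>v\<in>st ` Z. u v \<noteq> 0"
      using real_vector.dependent_finite[of "st ` Z"] Z by auto
    have "(\<Sum>z\<in>Z. u (st z) *\<^sub>R st z) = 0" using u(1) by (simp add: sum.reindex[OF inj])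
    then have "lookup ((\<Sum>z\<in>Z. u (st z) *\<^sub>R st z) S) e = 0" for S e by simp
    then have "u (st (S, e)) = 0" if "(S, e) \<in> Z" for S e using that unfolding lksum by (metis (full_types))
    then show False using u(2) by auto
  qed
  have span: "supp_in Z \<subseteq> span (st ` Z)"
  proof
    fix y assume y: "y \<in> supp_in Z"
    have "y = (\<Sum>z\<in>Z. lookup (y (fst z)) (snd z) *\<^sub>R st z)"
      using y by (intro ext poly_mapping_eqI) (auto simp: lksum supp_in_def)
    then show "y \<in> span (st ` Z)"
      by (metis (no_types, lifting) span_sum span_scale span_base imageI)
  qed
  have sub: "st ` Z \<subseteq> supp_in Z"
    by (auto simp: supp_in_def lk split: if_splits)
  show "dim (supp_in Z) = card Z"
    using sub span ind by (rule real_vector.dim_unique) (simp add: card_image inj)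
  show "fin_dim (supp_in Z)"
    unfolding fin_dim_def using span Z by blast
qed

text \<open>A sum of positive roots vanishes only if it is empty. At the largest upper end of a mode
  in \<open>S\<close> no negative contribution occurs, so the weight there would be
  positive.\<close>

lemma fweight_zero_imp_empty:
  assumes S: "S \<subseteq> root_modes ns" and z: "\<And>l. l < sum_list ns \<Longrightarrow> fweight ns S l = 0"
  shows "S = {}"
proof (rule ccontr)
  assume ne: "S \<noteq> {}"
  define L where "L = {l. \<exists>i<l. (i, l) \<in> same_block ns \<and> prod_encode (i, l) \<in> S}"
  have fin: "finite L" by (rule finite_subset[of _ "{..<sum_list ns}"]) (auto simp: L_def same_block_def)
  have "L \<noteq> {}" using ne S by (auto simp: L_def root_modes_def)
  then have m: "Max L \<in> L" using fin by simp
  let ?A = "{i. i < Max L \<and> (i, Max L) \<in> same_block ns \<and> prod_encode (i, Max L) \<in> S}"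
  have em: "{j. Max L < j \<and> (Max L, j) \<in> same_block ns \<and> prod_encode (Max L, j) \<in> S} = {}"
  proof -
    have "j \<le> Max L" if "Max L < j" "(Max L, j) \<in> same_block ns" "prod_encode (Max L, j) \<in> S" for j
      using that fin by (intro Max_ge) (auto simp: L_def)
    then show ?thesis by force
  qed
  have "Max L < sum_list ns" using m by (auto simp: L_def same_block_def)
  then have "card ?A = 0" using z[of "Max L"] unfolding fweight_def em by simp
  moreover have "finite ?A" by (rule finite_subset[of _ "{..<Max L}"]) auto
  ultimately show False using m by (auto simp: L_def)
qed

section \<open>Weyl integration in terms of weights\<close>

definition Mon :: "nat list \<Rightarrow> nat \<Rightarrow> (var \<Rightarrow> nat) \<Rightarrow> (var \<Rightarrow>\<^sub>0 nat) set" where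
  "Mon ns d k = {e. keys e \<subseteq> varidx ns d \<and> mdeg ns e = k}"

definition inv_comp :: "nat list \<Rightarrow> nat \<Rightarrow> (var \<Rightarrow> nat) \<Rightarrow> real mpoly set" where
  "inv_comp ns d k = {p. keys p \<subseteq> Mon ns d k \<and> inv_under ns p}"

definition zero_weight :: "nat list \<Rightarrow> nat \<Rightarrow> (var \<Rightarrow> nat) \<Rightarrow> (nat set \<times> (var \<Rightarrow>\<^sub>0 nat)) set" where
  "zero_weight ns d k = {(S, e). S \<subseteq> root_modes ns \<and> e \<in> Mon ns d k \<and> (\<forall>l<sum_list ns. mweight e l + fweight ns S l = 0)}"

section \<open>Multihomogeneous components\<close>

lemma mdeg_superset:
  assumes "finite A" "keys e \<subseteq> A"
  shows "mdeg ns e key = (\<Sum>v\<in>{v \<in> A. vdeg ns v = key}. lookup e v)"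
  unfolding mdeg_def using assms by (intro sum.mono_neutral_left) (auto simp: in_keys_iff)

lemma mdeg_add: "mdeg ns (e + f) key = mdeg ns e key + mdeg ns f key"
  using mdeg_superset[of "keys e \<union> keys f" _ ns key]
  by (simp add: keys_add_monomial lookup_add sum.distrib)

lemma mdeg_single: "mdeg ns (single v 1) key = of_bool (vdeg ns v = key)"
proof -
  have "{w. w = v \<and> vdeg ns w = key} = (if vdeg ns v = key then {v} else {})" by auto
  then show ?thesis by (auto simp: mdeg_def)
qed

lemma tdeg_mdeg:
  assumes "e \<in> Mon ns d k"
  shows "tdeg e = (\<Sum>key\<in>vdeg ns ` varidx ns d. k key)"
proof -
  have e: "keys e \<subseteq> varidx ns d" "mdeg ns e = k" using assms by (auto simp: Mon_def)
  have "tdeg e = (\<Sum>v\<in>varidx ns d. lookup e v)" using e(1) by (intro tdeg_superset) simp_all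
  also have "\<dots> = (\<Sum>key\<in>vdeg ns ` varidx ns d. \<Sum>v\<in>{v \<in> varidx ns d. vdeg ns v = key}. lookup e v)"
    by (rule sum.image_gen) simp
  also have "\<dots> = (\<Sum>key\<in>vdeg ns ` varidx ns d. k key)"
    using e by (intro sum.cong refl) (simp flip: mdeg_superset)
  finally show ?thesis .
qed

lemma finite_Mon [simp]: "finite (Mon ns d k)"
proof (rule finite_subset[OF _ finite_monomials[OF finite_varidx[of ns d]]])
  show "Mon ns d k \<subseteq> {e. keys e \<subseteq> varidx ns d \<and> tdeg e = (\<Sum>key\<in>vdeg ns ` varidx ns d. k key)}"
    using tdeg_mdeg by (auto simp: Mon_def)
qed

lemma Mon_adj:
  assumes p: "keys p \<subseteq> Mon ns d k" and ij: "(i, j) \<in> same_block ns"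
  shows "keys (adj i j p) \<subseteq> Mon ns d k"
proof
  fix e' assume "e' \<in> keys (adj i j p)"
  then obtain e v f where *: "e \<in> keys p" "v \<in> keys e"
    "f \<in> keys (ldelta i j v - rdelta i j v :: 'a mpoly)"
    and eq: "e' + single v 1 = e + f" using keys_der unfolding adj_def by blast
  obtain a b \<alpha> where v: "v = (a, b, \<alpha>)" by (cases v)
  have e: "keys e \<subseteq> varidx ns d" "mdeg ns e = k" using * p by (auto simp: Mon_def)
  have "v \<in> varidx ns d" using * e by auto
  have "f \<in> keys (ldelta i j v :: 'a mpoly) \<union> keys (rdelta i j v :: 'a mpoly)"
    using *(3) by (auto simp: in_keys_iff lookup_minus)
  then obtain w where f: "f = single w 1" and w: "w \<in> varidx ns d" "vdeg ns w = vdeg ns v"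
    using ij \<open>v \<in> varidx ns d\<close> unfolding v
    by (auto simp: ldelta_def rdelta_def Var_def varidx_def vdeg_def same_block_def split: if_splits)
  have "keys e' \<subseteq> keys (e' + single v 1)" by (auto simp: keys_add_monomial)
  also have "\<dots> \<subseteq> varidx ns d" unfolding eq f using e w by (auto simp: keys_add_monomial)
  finally have "keys e' \<subseteq> varidx ns d" .
  moreover have "mdeg ns e' = k"
  proof
    fix key
    have "mdeg ns (e' + single v 1) key = mdeg ns (e + f) key" by (simp only: eq)
    then show "mdeg ns e' key = k key" unfolding mdeg_add f mdeg_single w(2) e(2) by simp
  qed
  ultimately show "e' \<in> Mon ns d k" by (simp add: Mon_def)
qed

lemma keys_subset_iff: "keys p \<subseteq> M \<longleftrightarrow> (\<forall>e. e \<notin> M \<longrightarrow> lookup p e = 0)"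
  by (auto simp: in_keys_iff)

section \<open>The Dirac operator on the zero weight space\<close>

definition fock :: "nat list \<Rightarrow> nat \<Rightarrow> (var \<Rightarrow> nat) \<Rightarrow> state set" where
  "fock ns d k = {y. (\<forall>S. \<not> S \<subseteq> root_modes ns \<longrightarrow> y S = 0) \<and> (\<forall>S. keys (y S) \<subseteq> Mon ns d k)}"

lemma total_dirac_fock:
  assumes "y \<in> fock ns d k"
  shows "app (ferm.total_dirac ns) y \<in> fock ns d k"
proof -
  let ?X = "{x. \<forall>y\<in>fock ns d k. app x y \<in> fock ns d k}"
  have K: "keys (p + q) \<subseteq> Mon ns d k" "keys (p - q) \<subseteq> Mon ns d k" "keys (a *\<^sub>R p) \<subseteq> Mon ns d k"
    if "keys p \<subseteq> Mon ns d k" "keys q \<subseteq> Mon ns d k" for p q :: "real mpoly" and a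
    using that by (simp_all add: keys_subset_iff lookup_add lookup_minus lookup_scaleR)
  have "ferm.total_dirac ns \<in> ?X"
  proof (rule ferm.total_dirac_closed; (intro CollectI ballI conjI)?)
    fix i j y assume ij: "i < sum_list ns" "j < sum_list ns" "blk ns i = blk ns j" and y: "y \<in> fock ns d k"
    have sb: "(i, j) \<in> same_block ns" using ij by (simp add: same_block_def)
    have "keys (adj i j (y S)) \<subseteq> Mon ns d k" for S
      using y by (intro Mon_adj sb) (simp add: fock_def)
    then show "app (op_E i j) y \<in> fock ns d k"
      using y by (simp add: fock_def op_E.rep_eq)
  next
    fix i j y assume ij: "i < j" "j < sum_list ns" "blk ns i = blk ns j" and y: "y \<in> fock ns d k"
    have m: "prod_encode (i, j) \<in> root_modes ns" using ij by (auto simp: root_modes_def same_block_def)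
    have y0: "\<And>S. \<not> S \<subseteq> root_modes ns \<Longrightarrow> y S = 0" and yM: "\<And>S. keys (y S) \<subseteq> Mon ns d k"
      using y by (auto simp: fock_def)
    have "y (S - {prod_encode (i, j)}) = 0" "y (insert (prod_encode (i, j)) S) = 0" if "\<not> S \<subseteq> root_modes ns" for S
      using that m by (auto intro!: y0)
    then show "app (op_c (prod_encode (i, j))) y \<in> fock ns d k" "app (op_b (prod_encode (i, j))) y \<in> fock ns d k"
      unfolding fock_def op_c.rep_eq op_b.rep_eq using K(3)[OF yM yM] by auto
  qed (use K in \<open>auto simp: fock_def\<close>)
  then show ?thesis using assms by blast
qed

text \<open>Basis states are joint eigenvectors of the weight operators, with eigenvalues
  \<open>mweight e l + fweight ns S l\<close>. The description as a joint kernel shows that the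
  Dirac operator, which commutes with the weight operators, preserves the space.\<close>

lemma supp_in_zero_weight_iff:
  "y \<in> supp_in (zero_weight ns d k) \<longleftrightarrow> y \<in> fock ns d k \<and> (\<forall>l<sum_list ns. app (ferm.weight_op ns l) y = 0)"
proof -
  have c: "lookup (app (ferm.weight_op ns l) y S) e = of_int (mweight e l + fweight ns S l) * lookup (y S) e"
    if "l < sum_list ns" for l S e
    using that by (simp add: weight_op_apply lookup_add lookup_adj_diag lookup_scaleR algebra_simps)
  show ?thesis
  proof
    assume y: "y \<in> supp_in (zero_weight ns d k)"
    have "app (ferm.weight_op ns l) y = 0" if "l < sum_list ns" for l
    proof (intro ext poly_mapping_eqI)
      fix S e show "lookup (app (ferm.weight_op ns l) y S) e = lookup (0 S) e"
        using y that by (cases "(S, e) \<in> zero_weight ns d k") (auto simp: c supp_in_def zero_weight_def)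
    qed
    moreover have "y \<in> fock ns d k"
    proof -
      have "lookup (y S) e = 0" if "\<not> S \<subseteq> root_modes ns \<or> e \<notin> Mon ns d k" for S e
        using y that unfolding supp_in_def zero_weight_def by blast
      then show ?thesis unfolding fock_def keys_subset_iff by (intro CollectI conjI allI impI poly_mapping_eqI) simp_all
    qed
    ultimately show "y \<in> fock ns d k \<and> (\<forall>l<sum_list ns. app (ferm.weight_op ns l) y = 0)" by blast
  next
    assume y: "y \<in> fock ns d k \<and> (\<forall>l<sum_list ns. app (ferm.weight_op ns l) y = 0)"
    show "y \<in> supp_in (zero_weight ns d k)" unfolding supp_in_def
    proof (intro CollectI allI impI)
      fix S e assume z: "(S, e) \<notin> zero_weight ns d k"
      show "lookup (y S) e = 0"
      proof (cases "S \<subseteq> root_modes ns \<and> e \<in> Mon ns d k")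
        case True
        then obtain l where l: "l < sum_list ns" "mweight e l + fweight ns S l \<noteq> 0" using z by (auto simp: zero_weight_def)
        have "app (ferm.weight_op ns l) y = 0" using y l(1) by blast
        then have "real_of_int (mweight e l + fweight ns S l) * lookup (y S) e = 0"
          unfolding c[OF l(1), symmetric] by simp
        then show ?thesis using l(2) unfolding mult_eq_0_iff of_int_eq_0_iff by blast
      next
        case False
        then show ?thesis using y by (auto simp: fock_def keys_subset_iff)
      qed
    qed
  qed
qed

lemma finite_zero_weight [simp]: "finite (zero_weight ns d k)"
  by (rule finite_subset[of _ "Pow (root_modes ns) \<times> Mon ns d k"]) (auto simp: zero_weight_def)

text \<open>With the weight operators gone, only the Casimir element of the polynomial factor is
  left. It acts separately on each coefficient \<open>y S\<close>, so the apolar product suffices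
  and no inner product on the exterior algebra is required.\<close>

lemma total_dirac_square_zero_weight:
  assumes "y \<in> supp_in (zero_weight ns d k)"
  shows "app (ferm.total_dirac ns) (app (ferm.total_dirac ns) y) + app (ferm.total_dirac ns) (app (ferm.total_dirac ns) y)
    = (\<lambda>S. \<Sum>(i, j)\<in>same_block ns. adj i j (adj j i (y S)))"
proof -
  have h: "app (ferm.weight_op ns l) y = 0" if "l < sum_list ns" for l
    using assms that by (simp add: supp_in_zero_weight_iff)
  have hb: "app (ferm.weight_op ns l) y = 0" if "m < sum_list ns" "l \<in> ferm.below ns m" for l m
    using that by (intro h) (auto simp: ferm.below_def)
  have "app (ferm.total_dirac ns) (app (ferm.total_dirac ns) y) + app (ferm.total_dirac ns) (app (ferm.total_dirac ns) y)
    = app (ferm.total_dirac ns * ferm.total_dirac ns + ferm.total_dirac ns * ferm.total_dirac ns) y" by simp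
  also have "\<dots> = (\<Sum>i<sum_list ns. \<Sum>j\<in>{j. j < sum_list ns \<and> blk ns i = blk ns j}. app (op_E i j) (app (op_E j i) y))"
    unfolding ferm.total_dirac_square app_simps app_sum by (simp add: h hb)
  also have "\<dots> = (\<Sum>(i, j)\<in>same_block ns. app (op_E i j) (app (op_E j i) y))"
  proof -
    have "same_block ns = (SIGMA i:{..<sum_list ns}. {j. j < sum_list ns \<and> blk ns i = blk ns j})"
      by (auto simp: same_block_def)
    then show ?thesis by (simp add: sum.Sigma)
  qed
  finally show ?thesis by (simp add: fun_eq_iff sum_fun_apply op_E.rep_eq case_prod_unfold)
qed

definition vac :: "real mpoly \<Rightarrow> state" where
  "vac w = (\<lambda>S. if S = {} then w else 0)"

text \<open>Positivity makes every \<open>y S\<close> invariant, hence of polynomial weight 0. Total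
  weight 0 then forces the weight of \<open>S\<close> itself to vanish, which leaves only the empty
  set.\<close>

lemma zero_weight_casimir_kernel:
  assumes y: "y \<in> supp_in (zero_weight ns d k)"
    and D: "app (ferm.total_dirac ns) (app (ferm.total_dirac ns) y) = 0"
  obtains w where "w \<in> inv_comp ns d k" "y = vac w"
proof -
  have yf: "y \<in> fock ns d k" and h: "\<And>l. l < sum_list ns \<Longrightarrow> app (ferm.weight_op ns l) y = 0"
    using y by (auto simp: supp_in_zero_weight_iff)
  have "(\<Sum>(i, j)\<in>same_block ns. adj i j (adj j i (y S))) = 0" for S
    using fun_cong[OF total_dirac_square_zero_weight[OF y], of S] unfolding D by simp
  then have a: "adj j i (y S) = 0" if "(i, j) \<in> same_block ns" for i j S
    by (rule casimir_kernel[where F = adj and F' = "\<lambda>i j. adj j i", OF finite_same_block _ apolar_adj that])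
  have inv: "inv_under ns (y S)" for S
    using a by (auto simp: inv_under_def same_block_def)
  have "y S = 0" if "S \<noteq> {}" for S
  proof (rule ccontr)
    assume n: "y S \<noteq> 0"
    then have S: "S \<subseteq> root_modes ns" using yf by (auto simp: fock_def)
    have "fweight ns S l = 0" if l: "l < sum_list ns" for l
    proof -
      have "0 = app (ferm.weight_op ns l) y S" by (simp add: h l)
      also have "\<dots> = of_int (fweight ns S l) *\<^sub>R y S"
        using l a[of l l S] by (simp add: weight_op_apply same_block_def)
      finally show ?thesis using n by simp
    qed
    then show False using fweight_zero_imp_empty[OF S] that by blast
  qed
  then have "y = vac (y {})" by (auto simp: vac_def)
  moreover have "y {} \<in> inv_comp ns d k" using inv yf by (auto simp: inv_comp_def fock_def)
  ultimately show ?thesis using that by blast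
qed

lemma vac_inv:
  assumes w: "w \<in> inv_comp ns d k"
  shows "vac w \<in> supp_in (zero_weight ns d k)" "app (ferm.total_dirac ns) (vac w) = 0"
proof -
  have E: "app (op_E i j) (vac w) = 0" if "i < sum_list ns" "j < sum_list ns" "blk ns i = blk ns j" for i j
  proof -
    have "adj i j w = 0" using that w by (auto simp: inv_comp_def inv_under_def same_block_def)
    then show ?thesis by (auto simp: op_E.rep_eq vac_def)
  qed
  have b: "app (op_b m) (vac w) = 0" for m
    by (auto simp: op_b.rep_eq vac_def)
  have diag_E: "app (ferm.diag_E ns m i j) (vac w) = 0" if "i < sum_list ns" "j < sum_list ns" "blk ns i = blk ns j" for i j m
    unfolding ferm.diag_E_def using E[OF that] by (simp add: app_sum b)
  have "app (ferm.weight_op ns l) (vac w) = 0" if "l < sum_list ns" for l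
    unfolding ferm.weight_op_def using diag_E[OF that that] by (simp add: app_sum b)
  moreover have "vac w \<in> fock ns d k" using w by (auto simp: fock_def vac_def inv_comp_def)
  ultimately show "vac w \<in> supp_in (zero_weight ns d k)" by (simp add: supp_in_zero_weight_iff)
  have "app (ferm.dirac ns m) (vac w) = 0" if m: "m < sum_list ns" for m
  proof -
    \<comment> \<open>The creation operator does not annihilate the vacuum. Moving it to the left
      lets \<open>diag_E\<close>, which does, act first.\<close>
    have "app (ferm.diag_E ns (Suc m) i m * op_c (prod_encode (i, m))) (vac w) = 0" if i: "i \<in> ferm.below ns m" for i
    proof -
      have "ferm.diag_E ns (Suc m) i m * op_c (prod_encode (i, m)) = op_c (prod_encode (i, m)) * ferm.diag_E ns (Suc m) i m"
        by (rule ferm.diag_E_c) simp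
      then show ?thesis using diag_E[of i m "Suc m"] i m by (simp add: ferm.below_def del: app_simps(6)) (simp add: ferm.below_def)
    qed
    then show ?thesis unfolding ferm.dirac_def by (simp add: app_sum b)
  qed
  then show "app (ferm.total_dirac ns) (vac w) = 0"
    unfolding ferm.total_dirac_def by (simp add: app_sum)
qed

theorem dim_inv_comp:
  "card {z \<in> zero_weight ns d k. even (card (fst z))} = card {z \<in> zero_weight ns d k. odd (card (fst z))} + dim (inv_comp ns d k)"
proof -
  let ?Z = "zero_weight ns d k" and ?D = "app (ferm.total_dirac ns)"
  let ?Ze = "{z \<in> ?Z. even (card (fst z))}" and ?Zo = "{z \<in> ?Z. odd (card (fst z))}"
  have finS: "finite S" if "(S, e) \<in> ?Z" for S e
    using that finite_subset[OF _ finite_root_modes] by (auto simp: zero_weight_def)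
  \<comment> \<open>The even and odd parts of the zero weight space are the eigenspaces of
    \<open>op_parity\<close>, so anticommutation with the parity suffices to see that the Dirac
    operator exchanges them.\<close>
  have e_iff: "y \<in> supp_in ?Ze \<longleftrightarrow> y \<in> supp_in ?Z \<and> app op_parity y = y" for y
  proof
    assume y: "y \<in> supp_in ?Ze"
    have "app op_parity y = y"
    proof (intro ext poly_mapping_eqI)
      fix S e show "lookup (app op_parity y S) e = lookup (y S) e"
        using y finS[of S e] by (cases "(S, e) \<in> ?Ze") (auto simp: op_parity.rep_eq lookup_scaleR supp_in_def)
    qed
    then show "y \<in> supp_in ?Z \<and> app op_parity y = y" using y by (auto simp: supp_in_def)
  next
    assume y: "y \<in> supp_in ?Z \<and> app op_parity y = y"
    show "y \<in> supp_in ?Ze" unfolding supp_in_def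
    proof (intro CollectI allI impI)
      fix S e assume z: "(S, e) \<notin> ?Ze"
      have "lookup (y S) e = lookup (app op_parity y S) e" using y by simp
      also have "\<dots> = (if finite S then (-1) ^ card S else 0) * lookup (y S) e"
        by (simp add: op_parity.rep_eq lookup_scaleR)
      finally show "lookup (y S) e = 0"
        using y z finS[of S e] by (cases "(S, e) \<in> ?Z") (auto simp: supp_in_def)
    qed
  qed
  have o_iff: "y \<in> supp_in ?Zo \<longleftrightarrow> y \<in> supp_in ?Z \<and> app op_parity y = - y" for y
  proof
    assume y: "y \<in> supp_in ?Zo"
    have "app op_parity y = - y"
    proof (intro ext poly_mapping_eqI)
      fix S e show "lookup (app op_parity y S) e = lookup ((- y) S) e"
        using y finS[of S e] by (cases "(S, e) \<in> ?Zo") (auto simp: op_parity.rep_eq lookup_scaleR supp_in_def)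
    qed
    then show "y \<in> supp_in ?Z \<and> app op_parity y = - y" using y by (auto simp: supp_in_def)
  next
    assume y: "y \<in> supp_in ?Z \<and> app op_parity y = - y"
    show "y \<in> supp_in ?Zo" unfolding supp_in_def
    proof (intro CollectI allI impI)
      fix S e assume z: "(S, e) \<notin> ?Zo"
      have "- lookup (y S) e = lookup (app op_parity y S) e" using y by simp
      also have "\<dots> = (if finite S then (-1) ^ card S else 0) * lookup (y S) e"
        by (simp add: op_parity.rep_eq lookup_scaleR)
      finally show "lookup (y S) e = 0"
        using y z finS[of S e] by (cases "(S, e) \<in> ?Z") (auto simp: supp_in_def)
    qed
  qed
  have DZ: "?D y \<in> supp_in ?Z" if "y \<in> supp_in ?Z" for y
  proof -
    have "app (ferm.weight_op ns l) (?D y) = 0" if l: "l < sum_list ns" for l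
    proof -
      have "app (ferm.weight_op ns l) (?D y) = app (ferm.total_dirac ns * ferm.weight_op ns l) y"
        unfolding ferm.weight_op_total_dirac[OF l, symmetric] by simp
      then show ?thesis using \<open>y \<in> supp_in ?Z\<close> l by (simp add: supp_in_zero_weight_iff)
    qed
    then show ?thesis using that total_dirac_fock by (simp add: supp_in_zero_weight_iff)
  qed
  have par: "app op_parity (?D y) = - ?D (app op_parity y)" for y
  proof -
    have "op_parity * ferm.total_dirac ns = - (ferm.total_dirac ns * op_parity)"
      by (rule ferm.total_dirac_parity) (rule op_parity_E op_parity_c op_parity_b)+
    then have "app (op_parity * ferm.total_dirac ns) y = app (- (ferm.total_dirac ns * op_parity)) y" by simp
    then show ?thesis by simp
  qed
  have neg: "?D (- y) = - ?D y" for y using linear_app by (rule linear_neg)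
  have ker: "?D y = 0" if "y \<in> supp_in ?Z" "?D (?D y) = 0" for y
    using zero_weight_casimir_kernel[OF that] vac_inv by metis
  have "dim (supp_in ?Ze) + dim {x \<in> supp_in ?Zo. ?D x = 0} = dim (supp_in ?Zo) + dim {x \<in> supp_in ?Ze. ?D x = 0}"
  proof (rule dim_supersymmetry)
    show "?D ` supp_in ?Ze \<subseteq> supp_in ?Zo" "?D ` supp_in ?Zo \<subseteq> supp_in ?Ze"
      by (auto simp: e_iff o_iff par neg intro!: DZ)
    show "?D x = 0" if "x \<in> supp_in ?Ze \<union> supp_in ?Zo" "?D (?D x) = 0" for x
    proof (rule ker[OF _ that(2)])
      show "x \<in> supp_in ?Z" using that(1) by (auto simp: e_iff o_iff)
    qed
    show "fin_dim (supp_in ?Ze)" "fin_dim (supp_in ?Zo)"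
      by (rule dim_supp_in(2), simp)+
  qed (rule subspace_supp_in linear_app)+
  \<comment> \<open>Vectors in the kernel live on the empty set of modes and are therefore even; an
    odd one is its own negative.\<close>
  moreover have "{x \<in> supp_in ?Zo. ?D x = 0} = {0}"
  proof -
    have "x = 0" if x: "x \<in> supp_in ?Zo" "?D x = 0" for x
    proof -
      obtain w where w: "x = vac w" using zero_weight_casimir_kernel[of x ns d k] x by (auto simp: o_iff)
      have "app op_parity (vac w) = vac w" by (auto simp: vac_def op_parity.rep_eq)
      then have "vac w = - vac w" using x by (simp add: w o_iff)
      then have "w = - w" by (metis vac_def uminus_apply)
      then have "w = 0" by (metis add.right_inverse real_vector.scale_eq_0_iff scaleR_2 zero_neq_numeral)
      then show ?thesis by (auto simp: w vac_def)
    qed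
    then show ?thesis by (auto simp: supp_in_def)
  qed
  moreover have "{x \<in> supp_in ?Ze. ?D x = 0} = vac ` inv_comp ns d k"
  proof
    show "{x \<in> supp_in ?Ze. ?D x = 0} \<subseteq> vac ` inv_comp ns d k"
    proof
      fix x assume "x \<in> {x \<in> supp_in ?Ze. ?D x = 0}"
      then have "x \<in> supp_in ?Z" "?D (?D x) = 0" by (simp_all add: e_iff)
      then show "x \<in> vac ` inv_comp ns d k" using zero_weight_casimir_kernel by blast
    qed
    have "app op_parity (vac w) = vac w" for w by (auto simp: vac_def op_parity.rep_eq)
    then show "vac ` inv_comp ns d k \<subseteq> {x \<in> supp_in ?Ze. ?D x = 0}"
      using vac_inv by (auto simp: e_iff)
  qed
  moreover have "dim (vac ` inv_comp ns d k) = dim (inv_comp ns d k)"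
  proof (rule dim_image_inj_on)
    show "subspace (inv_comp ns d k)"
      by (rule subspaceI) (auto simp: inv_comp_def keys_subset_iff lookup_add lookup_scaleR
        intro: inv_under_add inv_under_scaleR)
    show "fin_dim (inv_comp ns d k)"
      by (rule fin_dim_subset[OF fin_dim_keys[OF finite_Mon[of ns d k]]]) (auto simp: inv_comp_def)
    show "linear vac" by (rule linearI) (auto simp: vac_def scaleR_fun_def)
    show "inj_on vac (inv_comp ns d k)" by (rule inj_onI) (metis vac_def)
  qed
  moreover have "dim {0 :: state} = 0"
    by (rule real_vector.dim_unique[of "{}"]) (simp_all add: real_vector.independent_empty)
  ultimately show ?thesis by (simp add: dim_supp_in)
qed

section \<open>Integration of Laurent polynomials over the torus\<close>

definition zmon :: "nat \<Rightarrow> (nat \<Rightarrow> int) \<Rightarrow> (nat \<Rightarrow> complex) \<Rightarrow> complex" where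
  "zmon n \<beta> z = (\<Prod>i<n. z i powi \<beta> i)"

lemma cis_powi: "cis x powi k = cis (of_int k * x)"
  by (cases "k \<ge> 0") (simp_all add: power_int_def Complex.DeMoivre cis_inverse flip: power_inverse)

lemma integral_cis:
  fixes k :: int
  defines "M \<equiv> restrict_space lborel {0..2*pi}"
  shows "integrable M (\<lambda>x. cis (of_int k * x))"
    and "integral\<^sup>L M (\<lambda>x. cis (of_int k * x)) = (if k = 0 then 2 * pi else 0)"
proof -
  have cont: "continuous_on {0..2*pi} (\<lambda>x. cis (of_int k * x))"
    unfolding cis_conv_exp by (intro continuous_intros)
  show "integrable M (\<lambda>x. cis (of_int k * x))"
    unfolding M_def using borel_integrable_atLeastAtMost'[OF cont]
    by (subst integrable_restrict_space) (simp_all add: set_integrable_def)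
  have int: "integral\<^sup>L M (\<lambda>x. cis (of_int k * x)) = (\<integral>x. indicator {0..2*pi} x *\<^sub>R cis (of_int k * x) \<partial>lborel)"
    unfolding M_def by (subst integral_restrict_space) simp_all
  show "integral\<^sup>L M (\<lambda>x. cis (of_int k * x)) = (if k = 0 then 2 * pi else 0)"
  proof (cases "k = 0")
    case True
    have "(\<integral>x. indicator {0..2*pi} x *\<^sub>R (1::complex) \<partial>lborel) = complex_of_real (2 * pi)"
      by (simp add: scaleR_conv_of_real)
    then show ?thesis unfolding int using True by simp
  next
    case False
    let ?F = "\<lambda>x :: real. cis (of_int k * x) / (\<i> * of_int k)"
    have "(\<integral>x. indicator {0..2*pi} x *\<^sub>R cis (of_int k * x) \<partial>lborel) = ?F (2*pi) - ?F 0"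
    proof (rule integral_FTC_Icc)
      fix x :: real
      have "((\<lambda>x. exp (\<i> * of_real (of_int k * x)) / (\<i> * of_int k)) has_vector_derivative exp (\<i> * of_real (of_int k * x))) (at x within {0..2*pi})"
        using False by (auto intro!: derivative_eq_intros has_vector_derivative_real_field simp: field_simps)
      then show "(?F has_vector_derivative cis (of_int k * x)) (at x within {0..2*pi})"
        by (simp add: cis_conv_exp)
    qed (use cont in auto)
    also have "cis (of_int k * (2 * pi)) = 1"
      by (metis cis_multiple_2pi Ints_of_int mult.commute)
    then have "?F (2*pi) - ?F 0 = 0" by simp
    finally show ?thesis unfolding int using False by simp
  qed
qed

lemma zmon_cis: "zmon n \<beta> (\<lambda>i. cis (\<theta> i)) = (\<Prod>i<n. cis (of_int (\<beta> i) * \<theta> i))"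
  by (simp add: zmon_def cis_powi)

lemma torus_integrable_zmon:
  "integrable (PiM {..<n} (\<lambda>_. restrict_space lborel {0..2*pi})) (\<lambda>\<theta>. zmon n \<beta> (\<lambda>i. cis (\<theta> i)))"
proof -
  interpret product_sigma_finite "\<lambda>_::nat. restrict_space lborel {0..2*pi}"
    by (simp add: product_sigma_finite_def sigma_finite_measure_restrict_space lborel.sigma_finite_measure_axioms)
  show ?thesis unfolding zmon_cis by (intro product_integrable_prod integral_cis) simp
qed

lemma torus_integral_zmon: "torus_integral n (zmon n \<beta>) = (if \<forall>i<n. \<beta> i = 0 then 1 else 0)"
proof -
  interpret product_sigma_finite "\<lambda>_::nat. restrict_space lborel {0..2*pi}"
    by (simp add: product_sigma_finite_def sigma_finite_measure_restrict_space lborel.sigma_finite_measure_axioms)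
  have "torus_integral n (zmon n \<beta>) = complex_of_real (inverse ((2 * pi) ^ n)) * (\<Prod>i<n. if \<beta> i = 0 then 2 * pi else 0)"
    unfolding torus_integral_def zmon_cis
    by (subst product_integral_prod) (simp_all add: integral_cis)
  also have "\<dots> = (if \<forall>i<n. \<beta> i = 0 then 1 else 0)"
  proof (cases "\<forall>i<n. \<beta> i = 0")
    case True
    then have "(\<Prod>i<n. if \<beta> i = 0 then 2 * pi else 0 :: complex) = (2 * pi) ^ n" by simp
    then show ?thesis using True by (simp add: field_simps)
  next
    case False
    then have z: "(\<Prod>i<n. if \<beta> i = 0 then 2 * pi else 0) = 0" by (subst prod_zero_iff) auto
    show ?thesis unfolding z using False by simp
  qed
  finally show ?thesis .
qed

text \<open>Laurent polynomials as functions; only their values at nonzero arguments matter.\<close>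

inductive lpoly :: "nat \<Rightarrow> ((nat \<Rightarrow> complex) \<Rightarrow> complex) \<Rightarrow> bool" for n where
  lpoly_zmon: "lpoly n (zmon n \<beta>)"
| lpoly_add: "lpoly n f \<Longrightarrow> lpoly n g \<Longrightarrow> lpoly n (\<lambda>z. f z + g z)"
| lpoly_scale: "lpoly n f \<Longrightarrow> lpoly n (\<lambda>z. a * f z)"
| lpoly_cong: "lpoly n f \<Longrightarrow> (\<And>z. (\<And>i. z i \<noteq> 0) \<Longrightarrow> f z = g z) \<Longrightarrow> lpoly n g"

lemma torus_integral_cong:
  assumes "\<And>z. (\<And>i. z i \<noteq> 0) \<Longrightarrow> f z = g z"
  shows "torus_integral n f = torus_integral n g"
  unfolding torus_integral_def using assms by simp

lemma lpoly_integrable: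
  assumes "lpoly n f"
  shows "integrable (PiM {..<n} (\<lambda>_. restrict_space lborel {0..2*pi})) (\<lambda>\<theta>. f (\<lambda>i. cis (\<theta> i)))"
  using assms
proof (induction rule: lpoly.induct)
  case (lpoly_cong f g)
  then have "(\<lambda>\<theta>. g (\<lambda>i. cis (\<theta> i))) = (\<lambda>\<theta>. f (\<lambda>i. cis (\<theta> i)))" by auto
  then show ?case using lpoly_cong by simp
qed (auto intro: torus_integrable_zmon)

lemma torus_integral_add:
  assumes "lpoly n f" "lpoly n g"
  shows "torus_integral n (\<lambda>z. f z + g z) = torus_integral n f + torus_integral n g"
  unfolding torus_integral_def
  by (simp add: Bochner_Integration.integral_add[OF lpoly_integrable[OF assms(1)] lpoly_integrable[OF assms(2)]] distrib_left)

lemma torus_integral_scale: "torus_integral n (\<lambda>z. a * f z) = a * torus_integral n f"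
  by (simp add: torus_integral_def mult_ac)

lemma zmon_zero: "(\<forall>i<n. \<beta> i = 0) \<Longrightarrow> zmon n \<beta> z = 1"
  by (simp add: zmon_def)

lemma zmon_mult: "(\<And>i. z i \<noteq> 0) \<Longrightarrow> zmon n \<beta> z * zmon n \<gamma> z = zmon n (\<lambda>i. \<beta> i + \<gamma> i) z"
  by (simp add: zmon_def power_int_add prod.distrib)

lemma lpoly_const: "lpoly n (\<lambda>z. a)"
  by (rule lpoly_cong[OF lpoly_scale[OF lpoly_zmon[of n "\<lambda>i. 0"], of a]]) (simp add: zmon_zero)

lemma lpoly_mult:
  assumes "lpoly n f" "lpoly n g"
  shows "lpoly n (\<lambda>z. f z * g z)"
  using assms(1)
proof (induction rule: lpoly.induct)
  case (lpoly_zmon \<beta>)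
  show ?case using assms(2)
  proof (induction rule: lpoly.induct)
    case (lpoly_zmon \<gamma>)
    show ?case by (rule lpoly_cong[OF lpoly.lpoly_zmon[of n "\<lambda>i. \<beta> i + \<gamma> i"]]) (simp add: zmon_mult)
  next
    case (lpoly_add f g)
    show ?case by (rule lpoly_cong[OF lpoly.lpoly_add[OF lpoly_add.IH]]) (simp add: distrib_left)
  next
    case (lpoly_scale f a)
    show ?case by (rule lpoly_cong[OF lpoly.lpoly_scale[OF lpoly_scale.IH, of a]]) simp
  next
    case (lpoly_cong f g)
    show ?case by (rule lpoly.lpoly_cong[OF lpoly_cong.IH]) (simp add: lpoly_cong)
  qed
next
  case (lpoly_add f h)
  show ?case by (rule lpoly_cong[OF lpoly.lpoly_add[OF lpoly_add.IH]]) (simp add: distrib_right)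
next
  case (lpoly_scale f a)
  show ?case by (rule lpoly_cong[OF lpoly.lpoly_scale[OF lpoly_scale.IH, of a]]) simp
next
  case (lpoly_cong f h)
  show ?case by (rule lpoly.lpoly_cong[OF lpoly_cong.IH]) (simp add: lpoly_cong)
qed

lemma lpoly_sum: "(\<And>k. k \<in> A \<Longrightarrow> lpoly n (f k)) \<Longrightarrow> lpoly n (\<lambda>z. \<Sum>k\<in>A. f k z)"
  by (induction A rule: infinite_finite_induct) (auto intro: lpoly_const lpoly_add)

lemma lpoly_prod: "(\<And>k. k \<in> A \<Longrightarrow> lpoly n (f k)) \<Longrightarrow> lpoly n (\<lambda>z. \<Prod>k\<in>A. f k z)"
  by (induction A rule: infinite_finite_induct) (auto intro: lpoly_const lpoly_mult)

lemma lpoly_power: "lpoly n f \<Longrightarrow> lpoly n (\<lambda>z. f z ^ k)"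
  by (induction k) (auto intro: lpoly_const lpoly_mult)

lemma torus_integral_sum:
  "(\<And>k. k \<in> A \<Longrightarrow> lpoly n (f k)) \<Longrightarrow> torus_integral n (\<lambda>z. \<Sum>k\<in>A. f k z) = (\<Sum>k\<in>A. torus_integral n (f k))"
proof (induction A rule: infinite_finite_induct)
  case (insert k A)
  then show ?case by (simp add: torus_integral_add lpoly_sum)
qed (simp_all add: torus_integral_def)

lemma ratio_eq_zmon:
  assumes "i < n" "j < n" "z j \<noteq> 0" "z i \<noteq> 0"
  shows "z i / z j = zmon n (\<lambda>l. of_bool (l = i) - of_bool (l = j)) z"
proof -
  have a: "(\<Prod>l<n. z l powi (if l = k then b else 0)) = z k powi b" if "k < n" for k b
  proof -
    have "(\<Prod>l<n. z l powi (if l = k then b else 0)) = (\<Prod>l<n. if l = k then z k powi b else 1)"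
      by (intro prod.cong refl) auto
    then show ?thesis using that by simp
  qed
  have "zmon n (\<lambda>l. of_bool (l = i) - of_bool (l = j)) z = (\<Prod>l<n. z l powi (if l = i then 1 else 0) * z l powi (if l = j then -1 else 0))"
    unfolding zmon_def using assms by (intro prod.cong refl) (auto simp: power_int_minus)
  also have "\<dots> = z i powi 1 * z j powi (-1)"
    unfolding prod.distrib using a[OF assms(1)] a[OF assms(2)] by simp
  finally show ?thesis by (simp add: power_int_minus divide_inverse)
qed

lemma lpoly_ratio: "i < n \<Longrightarrow> j < n \<Longrightarrow> lpoly n (\<lambda>z. z i / z j)"
  by (rule lpoly_cong[OF lpoly_zmon]) (rule ratio_eq_zmon[symmetric])

lemma lpoly_one_minus_ratio: "i < n \<Longrightarrow> j < n \<Longrightarrow> lpoly n (\<lambda>z. 1 - z i / z j)"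
  using lpoly_add[OF lpoly_const[of n 1] lpoly_scale[OF lpoly_ratio, of i n j "-1"]] by simp

lemma zmon_transpose:
  assumes "a < n" "b < n"
  shows "zmon n \<beta> (z \<circ> Transposition.transpose a b) = zmon n (\<beta> \<circ> Transposition.transpose a b) z"
  unfolding zmon_def
  by (rule prod.reindex_bij_witness[of _ "Transposition.transpose a b" "Transposition.transpose a b"])
    (use assms in \<open>auto simp: Transposition.transpose_def\<close>)

text \<open>Checked on monomials, whose integral only records whether all exponents vanish. No
  change of variables in the product measure is involved.\<close>

lemma lpoly_transpose:
  assumes "lpoly n f" "a < n" "b < n"
  shows "lpoly n (\<lambda>z. f (z \<circ> Transposition.transpose a b)) \<and> torus_integral n (\<lambda>z. f (z \<circ> Transposition.transpose a b)) = torus_integral n f"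
  using assms(1)
proof (induction rule: lpoly.induct)
  case (lpoly_zmon \<beta>)
  have "(\<forall>i<n. (\<beta> \<circ> Transposition.transpose a b) i = 0) \<longleftrightarrow> (\<forall>i<n. \<beta> i = 0)"
    using assms(2,3) unfolding Transposition.transpose_def o_def by metis
  then show ?case unfolding zmon_transpose[OF assms(2,3)]
    by (simp add: lpoly.lpoly_zmon torus_integral_zmon)
next
  case (lpoly_add f g)
  then show ?case by (simp add: lpoly.lpoly_add torus_integral_add)
next
  case (lpoly_scale f c)
  then show ?case by (simp add: lpoly.lpoly_scale torus_integral_scale)
next
  case (lpoly_cong f g)
  have e: "f (z \<circ> Transposition.transpose a b) = g (z \<circ> Transposition.transpose a b)" if "\<And>i. z i \<noteq> 0" for z
    using that by (intro lpoly_cong) simp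
  have "lpoly n (\<lambda>z. g (z \<circ> Transposition.transpose a b))"
    by (rule lpoly.lpoly_cong[OF conjunct1[OF lpoly_cong.IH]]) (rule e)
  moreover have "torus_integral n (\<lambda>z. g (z \<circ> Transposition.transpose a b)) = torus_integral n (\<lambda>z. f (z \<circ> Transposition.transpose a b))"
    by (rule torus_integral_cong) (simp add: e)
  moreover have "torus_integral n f = torus_integral n g"
    by (rule torus_integral_cong) (rule lpoly_cong)
  ultimately show ?case using lpoly_cong.IH by (simp only:)
qed

section \<open>From the symmetric to the asymmetric Weyl density\<close>

text \<open>The sum interpolates the constant 1 at the nodes \<open>x l\<close>. It differs from 1
  by a polynomial of degree below \<open>card B\<close> with \<open>card B\<close> roots.\<close>

lemma lagrange_partition_of_unity:
  fixes x :: "nat \<Rightarrow> 'a::field"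
  assumes "finite B" "B \<noteq> {}" "inj_on x B"
  shows "(\<Sum>l\<in>B. \<Prod>i\<in>B - {l}. (t - x i) / (x l - x i)) = 1"
proof -
  define p where "p = (\<Sum>l\<in>B. \<Prod>i\<in>B - {l}. smult (inverse (x l - x i)) [:- x i, 1:]) - 1"
  have ev: "poly p t = (\<Sum>l\<in>B. \<Prod>i\<in>B - {l}. (t - x i) / (x l - x i)) - 1" for t
    by (simp add: p_def poly_sum poly_prod divide_inverse algebra_simps)
  have root: "poly p (x k) = 0" if k: "k \<in> B" for k
  proof -
    have "(\<Prod>i\<in>B - {l}. (x k - x i) / (x l - x i)) = (if l = k then 1 else 0)" if l: "l \<in> B" for l
    proof (cases "l = k")
      case True
      have "(x k - x i) / (x k - x i) = 1" if "i \<in> B - {k}" for i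
        using that k assms(3) by (auto simp: inj_on_def)
      then show ?thesis using True by simp
    next
      case False
      then have "(\<Prod>i\<in>B - {l}. (x k - x i) / (x l - x i)) = 0"
        using k assms(1) by (intro prod_zero) auto
      then show ?thesis using False by simp
    qed
    then show ?thesis using k assms(1) by (simp add: ev)
  qed
  have "p = 0"
  proof (rule ccontr)
    assume p: "p \<noteq> 0"
    have "degree (\<Prod>i\<in>B - {l}. smult (inverse (x l - x i)) [:- x i, 1:]) \<le> card B - 1" if "l \<in> B" for l
    proof -
      have "degree (\<Prod>i\<in>B - {l}. smult (inverse (x l - x i)) [:- x i, 1:]) \<le> sum (degree \<circ> (\<lambda>i. smult (inverse (x l - x i)) [:- x i, 1:])) (B - {l})"
        by (rule degree_prod_sum_le) (use assms in auto)
      also have "\<dots> \<le> (\<Sum>i\<in>B - {l}. 1)" by (intro sum_mono) auto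
      finally show ?thesis using that assms(1) by simp
    qed
    then have "degree p \<le> card B - 1"
      unfolding p_def using assms(1) by (intro degree_diff_le degree_sum_le) auto
    moreover have "card (x ` B) \<le> card {t. poly p t = 0}"
      using root poly_roots_finite[OF p] by (intro card_mono) auto
    moreover have "card B > 0" using assms by (simp add: card_gt_0_iff)
    ultimately show False
      using card_poly_roots_bound[OF p] assms by (simp add: card_image)
  qed
  then show ?thesis using ev[of t] by simp
qed

definition wsym :: "nat set \<Rightarrow> (nat \<Rightarrow> complex) \<Rightarrow> complex" where
  "wsym B z = (\<Prod>i\<in>B. \<Prod>j\<in>B - {i}. (1 - z i / z j))"

definition wasym :: "nat set \<Rightarrow> (nat \<Rightarrow> complex) \<Rightarrow> complex" where
  "wasym B z = (\<Prod>l\<in>B. \<Prod>i\<in>{i \<in> B. i < l}. (1 - z l / z i))"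

lemma wsym_remove:
  assumes "finite B" "l \<in> B"
  shows "wsym B z = (\<Prod>i\<in>B - {l}. 1 - z l / z i) * (\<Prod>i\<in>B - {l}. 1 - z i / z l) * wsym (B - {l}) z"
proof -
  have "wsym B z = (\<Prod>i\<in>B - {l}. 1 - z l / z i) * (\<Prod>i\<in>B - {l}. \<Prod>j\<in>B - {i}. (1 - z i / z j))"
    unfolding wsym_def by (rule prod.remove[OF assms])
  also have "(\<Prod>i\<in>B - {l}. \<Prod>j\<in>B - {i}. (1 - z i / z j)) = (\<Prod>i\<in>B - {l}. (1 - z i / z l) * (\<Prod>j\<in>B - {l} - {i}. (1 - z i / z j)))"
  proof (rule prod.cong[OF refl])
    fix i assume i: "i \<in> B - {l}"
    have "B - {i} - {l} = B - {l} - {i}" by auto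
    moreover have "l \<in> B - {i}" using assms i by auto
    ultimately show "(\<Prod>j\<in>B - {i}. (1 - z i / z j)) = (1 - z i / z l) * (\<Prod>j\<in>B - {l} - {i}. (1 - z i / z j))"
      using prod.remove[of "B - {i}" l "\<lambda>j. 1 - z i / z j"] assms by simp
  qed
  finally show ?thesis unfolding wsym_def prod.distrib by (simp add: mult.assoc)
qed

text \<open>Interpolation at the nodes \<open>inverse (z i)\<close>, evaluated at 0: the coefficient
  for \<open>l\<close> is the reciprocal of the product of the factors \<open>1 - z i / z l\<close>.
  Multiplying by it removes one of the two factors for each pair containing
  \<open>l\<close>.\<close>

lemma wsym_expand:
  assumes B: "finite B" "B \<noteq> {}" and z: "\<And>i. z i \<noteq> 0"
  shows "wsym B z = (\<Sum>l\<in>B. (\<Prod>i\<in>B - {l}. 1 - z l / z i) * wsym (B - {l}) z)"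
proof (cases "inj_on z B")
  case True
  have ne: "1 - z i / z l \<noteq> 0" if "l \<in> B" "i \<in> B - {l}" for i l
    using True that z by (auto simp: inj_on_def)
  have "inj_on (\<lambda>i. inverse (z i)) B" using True by (auto simp: inj_on_def)
  from lagrange_partition_of_unity[OF B this, of 0]
  have "wsym B z = (\<Sum>l\<in>B. wsym B z * (\<Prod>i\<in>B - {l}. (0 - inverse (z i)) / (inverse (z l) - inverse (z i))))"
    by (simp add: sum_distrib_left[symmetric])
  also have "\<dots> = (\<Sum>l\<in>B. (\<Prod>i\<in>B - {l}. 1 - z l / z i) * wsym (B - {l}) z)"
  proof (rule sum.cong[OF refl])
    fix l assume l: "l \<in> B"
    have "(\<Prod>i\<in>B - {l}. 1 - z i / z l) * (\<Prod>i\<in>B - {l}. (0 - inverse (z i)) / (inverse (z l) - inverse (z i))) = 1"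
      unfolding prod.distrib[symmetric]
    proof (rule prod.neutral, rule ballI)
      fix i assume i: "i \<in> B - {l}"
      have "z l \<noteq> z i" using True l i by (auto simp: inj_on_def)
      then show "(1 - z i / z l) * ((0 - inverse (z i)) / (inverse (z l) - inverse (z i))) = 1"
        using z[of i] z[of l] by (simp add: field_simps)
    qed
    then show "wsym B z * (\<Prod>i\<in>B - {l}. (0 - inverse (z i)) / (inverse (z l) - inverse (z i))) = (\<Prod>i\<in>B - {l}. 1 - z l / z i) * wsym (B - {l}) z"
      unfolding wsym_remove[OF B(1) l] by (simp add: mult_ac)
  qed
  finally show ?thesis .
next
  case False
  \<comment> \<open>With two equal arguments both sides vanish: in each summand either the product
    contains a zero factor or \<open>wsym\<close> still involves both indices.\<close>
  then obtain p q where pq: "p \<in> B" "q \<in> B" "p \<noteq> q" "z p = z q" by (auto simp: inj_on_def)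
  have zero: "wsym C z = 0" if "finite C" "p \<in> C" "q \<in> C" for C
  proof -
    have "(\<Prod>j\<in>C - {p}. 1 - z p / z j) = 0"
      using that pq z by (intro prod_zero bexI[of _ q]) auto
    then have "\<exists>i\<in>C. (\<Prod>j\<in>C - {i}. 1 - z i / z j) = 0" using that(2) by blast
    with that(1) show ?thesis unfolding wsym_def by (rule prod_zero)
  qed
  have "(\<Prod>i\<in>B - {l}. 1 - z l / z i) * wsym (B - {l}) z = 0" if "l \<in> B" for l
  proof (cases "l = p \<or> l = q")
    case True
    then have "(\<Prod>i\<in>B - {l}. 1 - z l / z i) = 0"
    proof
      assume "l = p" then show ?thesis using pq z B by (intro prod_zero bexI[of _ q]) auto
    next
      assume "l = q" then show ?thesis using pq z B by (intro prod_zero bexI[of _ p]) auto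
    qed
    then show ?thesis by simp
  next
    case False
    then show ?thesis using zero[of "B - {l}"] pq B by simp
  qed
  then have "(\<Sum>l\<in>B. (\<Prod>i\<in>B - {l}. 1 - z l / z i) * wsym (B - {l}) z) = 0"
    by (rule sum.neutral[OF ballI])
  then show ?thesis using zero[OF B(1) pq(1,2)] by simp
qed

section \<open>Integrating against symmetric functions\<close>

definition sym_in :: "nat set \<Rightarrow> ((nat \<Rightarrow> complex) \<Rightarrow> complex) \<Rightarrow> bool" where
  "sym_in B f \<longleftrightarrow> (\<forall>a\<in>B. \<forall>b\<in>B. \<forall>z. (\<forall>i. z i \<noteq> 0) \<longrightarrow> f (z \<circ> Transposition.transpose a b) = f z)"

lemma sym_inD: "sym_in B f \<Longrightarrow> a \<in> B \<Longrightarrow> b \<in> B \<Longrightarrow> (\<And>i. z i \<noteq> 0) \<Longrightarrow> f (z \<circ> Transposition.transpose a b) = f z"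
  unfolding sym_in_def by blast

lemma sym_in_mult: "sym_in B f \<Longrightarrow> sym_in B g \<Longrightarrow> sym_in B (\<lambda>z. f z * g z)"
  by (simp add: sym_in_def)

lemma prod_transpose:
  assumes "Transposition.transpose a b ` A = A'"
  shows "(\<Prod>i\<in>A. f (Transposition.transpose a b i)) = (\<Prod>i\<in>A'. f i)"
  using prod.reindex[of "Transposition.transpose a b" A f] assms by simp

lemma wsym_transpose: "wsym B (z \<circ> Transposition.transpose a b) = wsym (Transposition.transpose a b ` B) z"
proof -
  have "wsym B (z \<circ> Transposition.transpose a b) = (\<Prod>i\<in>B. \<Prod>j\<in>Transposition.transpose a b ` (B - {i}). (1 - z (Transposition.transpose a b i) / z j))"
    unfolding wsym_def by (rule prod.cong[OF refl]) (simp add: prod.reindex)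
  also have "\<dots> = (\<Prod>i\<in>B. \<Prod>j\<in>Transposition.transpose a b ` B - {Transposition.transpose a b i}. (1 - z (Transposition.transpose a b i) / z j))"
    by (rule prod.cong[OF refl]) (simp add: image_set_diff inj_transpose)
  also have "\<dots> = wsym (Transposition.transpose a b ` B) z"
    unfolding wsym_def by (simp add: prod.reindex)
  finally show ?thesis .
qed

lemma lpoly_wsym: "B \<subseteq> {..<n} \<Longrightarrow> lpoly n (wsym B)"
  unfolding wsym_def by (intro lpoly_prod lpoly_one_minus_ratio) auto

lemma lpoly_wasym: "B \<subseteq> {..<n} \<Longrightarrow> lpoly n (wasym B)"
  unfolding wasym_def by (intro lpoly_prod lpoly_one_minus_ratio) auto

text \<open>By symmetry all summands of \<open>wsym_expand\<close> have the same integral as the one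
  for the largest index \<open>m\<close>, whence the factor \<open>card B\<close>. The factors
  \<open>1 - z m / z i\<close> left in that summand are those of \<open>wasym\<close> at
  \<open>m\<close>, and they are symmetric in the remaining indices, so induction applies.\<close>

lemma torus_integral_wsym:
  assumes "finite B" "B \<subseteq> {..<n}" "lpoly n f" "sym_in B f"
  shows "torus_integral n (\<lambda>z. f z * wsym B z) = fact (card B) * torus_integral n (\<lambda>z. f z * wasym B z)"
  using assms
proof (induction B arbitrary: f rule: finite_linorder_max_induct)
  case empty
  then show ?case by (simp add: wsym_def wasym_def)
next
  case (insert m I)
  let ?B = "insert m I"
  have mI: "m \<notin> I" using insert.hyps by auto
  have fin: "finite ?B" using insert.hyps by simp
  let ?P = "\<lambda>l z. \<Prod>i\<in>?B - {l}. 1 - z l / z i :: complex"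
  let ?t = "\<lambda>l z. f z * (?P l z * wsym (?B - {l}) z)"
  have lp: "lpoly n (?t l)" if "l \<in> ?B" for l
    using insert.prems that by (intro lpoly_mult lpoly_prod lpoly_one_minus_ratio lpoly_wsym) auto
  have "torus_integral n (\<lambda>z. f z * wsym ?B z) = torus_integral n (\<lambda>z. \<Sum>l\<in>?B. ?t l z)"
  proof (rule torus_integral_cong)
    fix z :: "nat \<Rightarrow> complex" assume z: "\<And>i. z i \<noteq> 0"
    show "f z * wsym ?B z = (\<Sum>l\<in>?B. ?t l z)"
      unfolding wsym_expand[OF fin insert_not_empty z] by (rule sum_distrib_left)
  qed
  also have "\<dots> = (\<Sum>l\<in>?B. torus_integral n (?t l))"
    using lp by (rule torus_integral_sum)
  also have "\<dots> = (\<Sum>l\<in>?B. torus_integral n (?t m))"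
  proof (rule sum.cong[OF refl])
    fix l assume l: "l \<in> ?B"
    have img: "Transposition.transpose l m ` (?B - {m}) = ?B - {l}"
    proof -
      have "Transposition.transpose l m ` ?B = ?B" using l by (intro transpose_image_eq) auto
      then show ?thesis unfolding image_set_diff[OF inj_transpose] by (simp only: image_insert[of _ m "{}"] image_empty transpose_apply_second)
    qed
    have "torus_integral n (?t m) = torus_integral n (\<lambda>z. ?t m (z \<circ> Transposition.transpose l m))"
      using lpoly_transpose[OF lp[of m], of l m] l insert.prems by auto
    also have "\<dots> = torus_integral n (?t l)"
    proof (rule torus_integral_cong)
      fix z :: "nat \<Rightarrow> complex" assume z: "\<And>i. z i \<noteq> 0"
      have "f (z \<circ> Transposition.transpose l m) = f z" using l z insert.prems(3) by (intro sym_inD) auto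
      moreover have "?P m (z \<circ> Transposition.transpose l m) = ?P l z"
        using prod_transpose[OF img, of "\<lambda>i. 1 - z l / z i"] by simp
      moreover have "wsym (?B - {m}) (z \<circ> Transposition.transpose l m) = wsym (?B - {l}) z"
        unfolding wsym_transpose img ..
      ultimately show "?t m (z \<circ> Transposition.transpose l m) = ?t l z" by simp
    qed
    finally show "torus_integral n (?t l) = torus_integral n (?t m)" ..
  qed
  also have "\<dots> = of_nat (card ?B) * torus_integral n (?t m)" by simp
  also have "?t m = (\<lambda>z. (f z * (\<Prod>i\<in>I. 1 - z m / z i)) * wsym I z)"
    using mI by (simp add: mult.assoc)
  also have "torus_integral n \<dots> = fact (card I) * torus_integral n (\<lambda>z. (f z * (\<Prod>i\<in>I. 1 - z m / z i)) * wasym I z)"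
  proof (rule insert.IH)
    show "lpoly n (\<lambda>z. f z * (\<Prod>i\<in>I. 1 - z m / z i))"
      using insert.prems by (intro lpoly_mult lpoly_prod lpoly_one_minus_ratio) auto
    show "sym_in I (\<lambda>z. f z * (\<Prod>i\<in>I. 1 - z m / z i))"
    proof (rule sym_in_mult)
      show "sym_in I f" using insert.prems(3) by (auto simp: sym_in_def)
      show "sym_in I (\<lambda>z. \<Prod>i\<in>I. 1 - z m / z i)" unfolding sym_in_def
      proof (intro ballI allI impI)
        fix a b :: nat and z :: "nat \<Rightarrow> complex" assume ab: "a \<in> I" "b \<in> I"
        have "Transposition.transpose a b m = m" using ab mI by (intro transpose_apply_other) auto
        then show "(\<Prod>i\<in>I. 1 - (z \<circ> Transposition.transpose a b) m / (z \<circ> Transposition.transpose a b) i) = (\<Prod>i\<in>I. 1 - z m / z i)"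
          using prod_transpose[of a b I I "\<lambda>i. 1 - z m / z i"] ab by simp
      qed
    qed
  qed (use insert.prems in auto)
  also have "(\<lambda>z. (f z * (\<Prod>i\<in>I. 1 - z m / z i)) * wasym I z) = (\<lambda>z. f z * wasym ?B z)"
  proof
    fix z :: "nat \<Rightarrow> complex"
    have 1: "{i \<in> ?B. i < m} = I" using insert.hyps by auto
    have 2: "{i \<in> ?B. i < l} = {i \<in> I. i < l}" if "l \<in> I" for l using insert.hyps that by fastforce
    have "wasym ?B z = (\<Prod>i\<in>I. 1 - z m / z i) * (\<Prod>l\<in>I. \<Prod>i\<in>{i \<in> ?B. i < l}. 1 - z l / z i)"
      unfolding wasym_def using insert.hyps mI 1 by simp
    also have "(\<Prod>l\<in>I. \<Prod>i\<in>{i \<in> ?B. i < l}. 1 - z l / z i) = wasym I z"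
      unfolding wasym_def using 2 by (intro prod.cong) auto
    finally show "(f z * (\<Prod>i\<in>I. 1 - z m / z i)) * wasym I z = f z * wasym ?B z" by simp
  qed
  also have "of_nat (card ?B) * (fact (card I) * torus_integral n (\<lambda>z. f z * wasym ?B z)) = fact (card ?B) * torus_integral n (\<lambda>z. f z * wasym ?B z)"
    using insert.hyps mI by simp
  finally show ?case .
qed

section \<open>The torus integral counts zero weights\<close>

text \<open>A transposition inside a block permutes the variables without changing their
  multidegree. It thus permutes the exponent arrays of the integrand, which makes
  \<open>integrand_coeff\<close> symmetric in each block.\<close>

lemma expo_transpose:
  assumes ab: "(a, b) \<in> same_block ns"
  defines "t \<equiv> (\<lambda>(i, j, \<alpha>). (Transposition.transpose a b i, Transposition.transpose a b j, \<alpha> :: nat))"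
  shows "bij_betw t (varidx ns d) (varidx ns d)" "vdeg ns (t v) = vdeg ns v" "t (t v) = v"
    "m \<in> expo ns d k \<Longrightarrow> m \<circ> t \<in> expo ns d k"
proof -
  show tt: "t (t v) = v" for v by (cases v) (simp add: t_def)
  have tv: "t v \<in> varidx ns d" if "v \<in> varidx ns d" for v
    using that ab by (auto simp: t_def varidx_def same_block_def Transposition.transpose_def)
  show bij: "bij_betw t (varidx ns d) (varidx ns d)"
    by (rule bij_betwI[of _ _ _ t]) (auto simp: tt tv)
  show deg: "vdeg ns (t v) = vdeg ns v" for v
    using ab by (cases v) (auto simp: t_def vdeg_def same_block_def Transposition.transpose_def)
  assume m: "m \<in> expo ns d k"
  have "(m \<circ> t) v = 0" if "v \<notin> varidx ns d" for v
  proof -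
    have "t v \<notin> varidx ns d" using that tv[of "t v"] tt[of v] by auto
    then show ?thesis using m by (simp add: expo_def del: split_paired_All)
  qed
  moreover have "(\<Sum>v\<in>{v \<in> varidx ns d. vdeg ns v = key}. m v) = (\<Sum>v\<in>{v \<in> varidx ns d. vdeg ns v = key}. (m \<circ> t) v)" for key
    by (rule sum.reindex_bij_witness[of _ t t]) (auto simp: tt tv deg)
  ultimately show "m \<circ> t \<in> expo ns d k" using m by (simp add: expo_def del: split_paired_All)
qed

lemma sym_in_integrand_coeff:
  assumes c: "c < length ns"
  shows "sym_in (blockset ns c) (integrand_coeff ns d k)"
  unfolding sym_in_def
proof (intro ballI allI impI)
  fix a b z assume "a \<in> blockset ns c" "b \<in> blockset ns c"
  then have ab: "(a, b) \<in> same_block ns" using c by (auto simp: same_block_def in_blockset_iff)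
  define t where "t = (\<lambda>(i, j, \<alpha>). (Transposition.transpose a b i, Transposition.transpose a b j, \<alpha> :: nat))"
  note t = expo_transpose[OF ab, folded t_def]
  let ?g = "\<lambda>z (m :: var \<Rightarrow> nat). \<Prod>v\<in>varidx ns d. (case v of (i, j, \<alpha>) \<Rightarrow> (z i / z j) ^ m v) :: complex"
  have "?g (z \<circ> Transposition.transpose a b) m = ?g z (m \<circ> t)" for m
  proof -
    let ?h = "\<lambda>v. case v of (i, j, \<alpha>) \<Rightarrow> (z i / z j) ^ m (t v)"
    have "?g (z \<circ> Transposition.transpose a b) m = (\<Prod>v\<in>varidx ns d. ?h (t v))"
      by (intro prod.cong refl) (auto simp: t(3)[of "(_, _, _)"], simp add: t_def)
    then show ?thesis using prod.reindex_bij_betw[OF t(1), of ?h] by simp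
  qed
  then have "integrand_coeff ns d k (z \<circ> Transposition.transpose a b) = (\<Sum>m\<in>expo ns d k. ?g z (m \<circ> t))"
    unfolding integrand_coeff_def by simp
  also have "\<dots> = integrand_coeff ns d k z"
  proof -
    have tt: "(m \<circ> t) \<circ> t = m" for m :: "var \<Rightarrow> nat" by (rule ext) (simp only: o_apply t(3))
    show ?thesis unfolding integrand_coeff_def
      by (rule sum.reindex_bij_witness[of _ "\<lambda>m. m \<circ> t" "\<lambda>m. m \<circ> t"]) (simp_all only: tt t(4))
  qed
  finally show "integrand_coeff ns d k (z \<circ> Transposition.transpose a b) = integrand_coeff ns d k z" .
qed

lemma lpoly_integrand_coeff: "lpoly (sum_list ns) (integrand_coeff ns d k)"
  unfolding integrand_coeff_def
  by (intro lpoly_sum lpoly_prod) (auto simp: varidx_def intro!: lpoly_power lpoly_ratio)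

lemma card_blockset: "c < length ns \<Longrightarrow> card (blockset ns c) = ns ! c"
  by (simp add: blockset_def take_Suc_conv_app_nth)

lemma sym_in_wsym:
  assumes "c < length ns"
  shows "sym_in (blockset ns c) (wsym (blockset ns c'))"
  unfolding sym_in_def wsym_transpose
proof (intro ballI allI impI)
  fix a b z assume "a \<in> blockset ns c" "b \<in> blockset ns c"
  then have "a \<in> blockset ns c' \<longleftrightarrow> b \<in> blockset ns c'" using blockset_disjoint by metis
  then have "Transposition.transpose a b ` blockset ns c' = blockset ns c'" by (rule transpose_image_eq)
  then show "wsym (Transposition.transpose a b ` blockset ns c') z = wsym (blockset ns c') z" by simp
qed

lemma sym_in_wasym:
  assumes "c \<noteq> c'"
  shows "sym_in (blockset ns c) (wasym (blockset ns c'))"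
  unfolding sym_in_def
proof (intro ballI allI impI)
  fix a b :: nat and z :: "nat \<Rightarrow> complex" assume ab: "a \<in> blockset ns c" "b \<in> blockset ns c"
  have "Transposition.transpose a b i = i" if "i \<in> blockset ns c'" for i
    using that ab assms blockset_disjoint[of i ns c c'] by (intro transpose_apply_other) auto
  then show "wasym (blockset ns c') (z \<circ> Transposition.transpose a b) = wasym (blockset ns c') z"
    unfolding wasym_def by (intro prod.cong refl) auto
qed

lemma sym_in_prod: "(\<And>k. k \<in> C \<Longrightarrow> sym_in B (f k)) \<Longrightarrow> sym_in B (\<lambda>z. \<Prod>k\<in>C. f k z)"
  unfolding sym_in_def by (intro ballI allI impI prod.cong refl) auto

lemma sym_in_const: "sym_in B (\<lambda>z. a)"
  by (simp add: sym_in_def)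

lemma torus_integral_blocks:
  assumes "finite C" "C \<subseteq> {..<length ns}" "lpoly (sum_list ns) f" "\<And>c. c < length ns \<Longrightarrow> sym_in (blockset ns c) f"
  shows "torus_integral (sum_list ns) (\<lambda>z. f z * (\<Prod>c\<in>C. inverse (of_nat (fact (ns ! c))) * wsym (blockset ns c) z))
    = torus_integral (sum_list ns) (\<lambda>z. f z * (\<Prod>c\<in>C. wasym (blockset ns c) z))"
proof -
  let ?n = "sum_list ns"
  let ?w = "\<lambda>c z. inverse (of_nat (fact (ns ! c))) * wsym (blockset ns c) z"
  \<comment> \<open>Blocks are converted one at a time, \<open>C'\<close> being those already done.
    The rest of the integrand stays symmetric in the block at hand: \<open>wsym\<close> is
    symmetric, and \<open>wasym\<close> of another block does not involve its variables.\<close>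
  have "torus_integral ?n (\<lambda>z. f z * (\<Prod>c\<in>C'. wasym (blockset ns c) z) * (\<Prod>c\<in>C. ?w c z))
      = torus_integral ?n (\<lambda>z. f z * (\<Prod>c\<in>C' \<union> C. wasym (blockset ns c) z))"
    if "finite C'" "C' \<subseteq> {..<length ns}" "C' \<inter> C = {}" for C'
    using assms(1,2) that
  proof (induction C arbitrary: C' rule: finite_induct)
    case (insert c C)
    have c: "c < length ns" "c \<notin> C'" using insert.prems by auto
    let ?g = "\<lambda>z. f z * (\<Prod>c\<in>C'. wasym (blockset ns c) z) * (\<Prod>c\<in>C. ?w c z)"
    have lp: "lpoly ?n ?g"
      using assms(3) insert.prems blockset_subset by (intro lpoly_mult lpoly_prod lpoly_scale lpoly_wsym lpoly_wasym) auto
    have sy: "sym_in (blockset ns c) ?g"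
      using assms(4) c by (intro sym_in_mult sym_in_prod sym_in_const sym_in_wsym sym_in_wasym) auto
    have "torus_integral ?n (\<lambda>z. f z * (\<Prod>c\<in>C'. wasym (blockset ns c) z) * (\<Prod>c\<in>insert c C. ?w c z))
      = torus_integral ?n (\<lambda>z. inverse (of_nat (fact (ns ! c))) * (?g z * wsym (blockset ns c) z))"
      using insert.hyps by (simp add: mult_ac)
    also have "\<dots> = inverse (of_nat (fact (ns ! c))) * (fact (card (blockset ns c)) * torus_integral ?n (\<lambda>z. ?g z * wasym (blockset ns c) z))"
      unfolding torus_integral_scale using torus_integral_wsym[OF finite_blockset blockset_subset lp sy] by simp
    also have "\<dots> = torus_integral ?n (\<lambda>z. ?g z * wasym (blockset ns c) z)"
      by (simp add: card_blockset[OF c(1)])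
    also have "\<dots> = torus_integral ?n (\<lambda>z. f z * (\<Prod>c\<in>insert c C'. wasym (blockset ns c) z) * (\<Prod>c\<in>C. ?w c z))"
      using insert.prems c by (simp add: mult_ac)
    also have "\<dots> = torus_integral ?n (\<lambda>z. f z * (\<Prod>c\<in>insert c C' \<union> C. wasym (blockset ns c) z))"
      using insert.prems insert.hyps by (intro insert.IH) auto
    finally show ?case by simp
  qed simp
  from this[of "{}"] show ?thesis by simp
qed

section \<open>Expansion over the positive roots\<close>

definition pos_roots :: "nat list \<Rightarrow> (nat \<times> nat) set" where
  "pos_roots ns = {(i, l). i < l \<and> (i, l) \<in> same_block ns}"

lemma finite_pos_roots [simp]: "finite (pos_roots ns)"
  by (rule finite_subset[OF _ finite_same_block[of ns]]) (auto simp: pos_roots_def)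

lemma prod_wasym: "(\<Prod>c<length ns. wasym (blockset ns c) z) = (\<Prod>(i, l)\<in>pos_roots ns. 1 - z l / z i)"
proof -
  have "(\<Prod>c<length ns. wasym (blockset ns c) z) = (\<Prod>(c, l, i)\<in>(SIGMA c:{..<length ns}. SIGMA l:blockset ns c. {i \<in> blockset ns c. i < l}). 1 - z l / z i)"
    unfolding wasym_def by (simp add: prod.Sigma)
  also have "\<dots> = (\<Prod>(i, l)\<in>pos_roots ns. 1 - z l / z i)"
    by (rule prod.reindex_bij_witness[of _ "\<lambda>(i, l). (blk ns l, l, i)" "\<lambda>(c, l, i). (i, l)"])
      (use blk_works in \<open>auto simp: pos_roots_def same_block_def in_blockset_iff\<close>)
  finally show ?thesis .
qed

lemma zmon_power: "zmon n \<beta> z ^ k = zmon n (\<lambda>i. int k * \<beta> i) z"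
  by (simp add: zmon_def prod_power_distrib power_int_power' mult.commute)

lemma zmon_prod:
  assumes "\<And>i. z i \<noteq> 0"
  shows "(\<Prod>k\<in>A. zmon n (\<beta> k) z) = zmon n (\<lambda>i. \<Sum>k\<in>A. \<beta> k i) z"
  by (induction A rule: infinite_finite_induct) (simp_all add: zmon_zero zmon_mult assms)

definition root_weight :: "(nat \<times> nat) set \<Rightarrow> nat \<Rightarrow> int" where
  "root_weight X l = (\<Sum>(i, j)\<in>X. of_bool (l = j) - of_bool (l = i))"

definition expo_weight :: "nat list \<Rightarrow> nat \<Rightarrow> (var \<Rightarrow> nat) \<Rightarrow> nat \<Rightarrow> int" where
  "expo_weight ns d m l = (\<Sum>(i, j, \<alpha>)\<in>varidx ns d. int (m (i, j, \<alpha>)) * (of_bool (l = i) - of_bool (l = j)))"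

text \<open>Each exponent array \<open>m\<close> and each set \<open>X\<close> of positive roots
  contribute one signed Laurent monomial, and integration keeps those with exponent zero.\<close>

lemma torus_integral_weights:
  "torus_integral (sum_list ns) (\<lambda>z. integrand_coeff ns d k z * nu_density ns z)
    = (\<Sum>m\<in>expo ns d k. \<Sum>X\<in>Pow (pos_roots ns). (-1) ^ card X * of_bool (\<forall>l<sum_list ns. expo_weight ns d m l + root_weight X l = 0))"
proof -
  let ?n = "sum_list ns"
  have "torus_integral ?n (\<lambda>z. integrand_coeff ns d k z * nu_density ns z)
     = torus_integral ?n (\<lambda>z. integrand_coeff ns d k z * (\<Prod>c<length ns. inverse (of_nat (fact (ns ! c))) * wsym (blockset ns c) z))"
    by (simp add: nu_density_def wsym_def)
  also have "\<dots> = torus_integral ?n (\<lambda>z. integrand_coeff ns d k z * (\<Prod>c<length ns. wasym (blockset ns c) z))"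
    by (rule torus_integral_blocks) (auto intro: lpoly_integrand_coeff sym_in_integrand_coeff)
  also have "\<dots> = torus_integral ?n (\<lambda>z. \<Sum>(m, X)\<in>expo ns d k \<times> Pow (pos_roots ns). (-1) ^ card X * zmon ?n (\<lambda>l. expo_weight ns d m l + root_weight X l) z)"
  proof (rule torus_integral_cong)
    fix z :: "nat \<Rightarrow> complex" assume z: "\<And>i. z i \<noteq> 0"
    have 1: "(\<Prod>v\<in>varidx ns d. (case v of (i, j, \<alpha>) \<Rightarrow> (z i / z j) ^ m v)) = zmon ?n (expo_weight ns d m) z" for m
    proof -
      have "(\<Prod>v\<in>varidx ns d. (case v of (i, j, \<alpha>) \<Rightarrow> (z i / z j) ^ m v))
        = (\<Prod>v\<in>varidx ns d. zmon ?n (\<lambda>l. case v of (i, j, \<alpha>) \<Rightarrow> int (m v) * (of_bool (l = i) - of_bool (l = j))) z)"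
      proof (rule prod.cong[OF refl])
        fix v assume v: "v \<in> varidx ns d"
        obtain i j \<alpha> where ij: "v = (i, j, \<alpha>)" by (cases v)
        have "i < ?n" "j < ?n" using v by (simp_all add: ij varidx_def)
        from ratio_eq_zmon[of i ?n j z, OF this z z]
        have "(z i / z j) ^ m v = zmon ?n (\<lambda>l. of_bool (l = i) - of_bool (l = j)) z ^ m v" by (rule arg_cong)
        also have "\<dots> = zmon ?n (\<lambda>l. int (m v) * (of_bool (l = i) - of_bool (l = j))) z" by (rule zmon_power)
        finally show "(case v of (i, j, \<alpha>) \<Rightarrow> (z i / z j) ^ m v) = zmon ?n (\<lambda>l. case v of (i, j, \<alpha>) \<Rightarrow> int (m v) * (of_bool (l = i) - of_bool (l = j))) z"
          by (simp only: ij prod.case)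
      qed
      also have "\<dots> = zmon ?n (expo_weight ns d m) z"
        unfolding zmon_prod[OF z] expo_weight_def by (simp add: case_prod_unfold)
      finally show ?thesis .
    qed
    have 2: "(\<Prod>(i, l)\<in>X. z l / z i) = zmon ?n (root_weight X) z" if "X \<subseteq> pos_roots ns" for X
    proof -
      have "(\<Prod>(i, j)\<in>X. z j / z i) = (\<Prod>x\<in>X. zmon ?n (\<lambda>l. case x of (i, j) \<Rightarrow> of_bool (l = j) - of_bool (l = i)) z)"
      proof (rule prod.cong[OF refl])
        fix x assume "x \<in> X"
        then have "x \<in> pos_roots ns" using that by blast
        then obtain i j where ij: "x = (i, j)" "i < ?n" "j < ?n" by (auto simp: pos_roots_def same_block_def)
        from ratio_eq_zmon[of j ?n i z, OF ij(3,2) z z]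
        show "(case x of (i, j) \<Rightarrow> z j / z i) = zmon ?n (\<lambda>l. case x of (i, j) \<Rightarrow> of_bool (l = j) - of_bool (l = i)) z"
          by (simp only: ij(1) prod.case)
      qed
      also have "\<dots> = zmon ?n (root_weight X) z"
        unfolding zmon_prod[OF z] root_weight_def by (simp add: case_prod_unfold)
      finally show ?thesis .
    qed
    have "(\<Prod>c<length ns. wasym (blockset ns c) z) = (\<Sum>X\<in>Pow (pos_roots ns). (-1) ^ card X * (\<Prod>(i, l)\<in>X. z l / z i))"
      unfolding prod_wasym case_prod_unfold by (subst prod_diff_conv_sum) simp_all
    also have "\<dots> = (\<Sum>X\<in>Pow (pos_roots ns). (-1) ^ card X * zmon ?n (root_weight X) z)"
      using 2 by (intro sum.cong refl) simp
    finally have w: "(\<Prod>c<length ns. wasym (blockset ns c) z) = (\<Sum>X\<in>Pow (pos_roots ns). (-1) ^ card X * zmon ?n (root_weight X) z)" .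
    have "integrand_coeff ns d k z * (\<Prod>c<length ns. wasym (blockset ns c) z)
      = (\<Sum>m\<in>expo ns d k. \<Sum>X\<in>Pow (pos_roots ns). zmon ?n (expo_weight ns d m) z * ((-1) ^ card X * zmon ?n (root_weight X) z))"
      unfolding w integrand_coeff_def 1 by (rule sum_product)
    also have "\<dots> = (\<Sum>(m, X)\<in>expo ns d k \<times> Pow (pos_roots ns). (-1) ^ card X * zmon ?n (\<lambda>l. expo_weight ns d m l + root_weight X l) z)"
      unfolding sum.cartesian_product by (intro sum.cong refl) (auto simp: zmon_mult[OF z, symmetric])
    finally show "integrand_coeff ns d k z * (\<Prod>c<length ns. wasym (blockset ns c) z) = \<dots>" .
  qed
  also have "\<dots> = (\<Sum>(m, X)\<in>expo ns d k \<times> Pow (pos_roots ns). torus_integral ?n (\<lambda>z. (-1) ^ card X * zmon ?n (\<lambda>l. expo_weight ns d m l + root_weight X l) z))"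
    unfolding case_prod_unfold by (rule torus_integral_sum) (rule lpoly_scale[OF lpoly_zmon])
  finally show ?thesis
    unfolding torus_integral_scale torus_integral_zmon sum.cartesian_product by (simp add: of_bool_def)
qed

lemma bij_betw_lookup_Mon: "bij_betw lookup (Mon ns d k) (expo ns d k)"
proof (rule bij_betw_imageI)
  show "inj_on lookup (Mon ns d k)" by (rule inj_onI) (simp only: poly_mapping_eq_iff)
  show "lookup ` Mon ns d k = expo ns d k"
  proof (intro equalityI subsetI)
    fix m assume "m \<in> lookup ` Mon ns d k"
    then obtain e where e: "m = lookup e" "keys e \<subseteq> varidx ns d" "mdeg ns e = k" by (auto simp: Mon_def)
    then show "m \<in> expo ns d k"
      using mdeg_superset[OF finite_varidx e(2), of ns] by (auto simp: expo_def in_keys_iff)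
  next
    fix m assume m: "m \<in> expo ns d k"
    then have m0: "\<And>v. v \<notin> varidx ns d \<Longrightarrow> m v = 0"
      and mk: "\<And>key. k key = (\<Sum>v\<in>{v \<in> varidx ns d. vdeg ns v = key}. m v)"
      unfolding expo_def by blast+
    define e where "e = Abs_poly_mapping m"
    have "finite {v. m v \<noteq> 0}"
      by (rule finite_subset[OF _ finite_varidx[of ns d]]) (intro subsetI, rule ccontr, use m0 in simp)
    then have l: "lookup e = m" by (simp add: e_def)
    then have ke: "keys e \<subseteq> varidx ns d" using m0 by (auto simp: in_keys_iff)
    have "mdeg ns e = k"
      by (rule ext) (simp only: mdeg_superset[OF finite_varidx ke, of ns] l mk)
    then show "m \<in> lookup ` Mon ns d k" using l ke by (auto simp: Mon_def)
  qed
qed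

lemma expo_weight_lookup:
  assumes "e \<in> Mon ns d k"
  shows "expo_weight ns d (lookup e) l = mweight e l"
proof -
  have "mweight e l = (\<Sum>v\<in>varidx ns d. int (lookup e v) * (of_bool (fst v = l) - of_bool (fst (snd v) = l)))"
    unfolding mweight_def using assms by (intro sum.mono_neutral_left) (auto simp: Mon_def in_keys_iff)
  then show ?thesis by (simp add: expo_weight_def case_prod_unfold eq_commute)
qed

lemma root_weight_fweight:
  assumes X: "X \<subseteq> pos_roots ns"
  shows "fweight ns (prod_encode ` X) l = root_weight X l"
proof -
  have fin: "finite X" using X finite_pos_roots by (rule finite_subset)
  have m: "prod_encode p \<in> prod_encode ` X \<longleftrightarrow> p \<in> X" for p by (auto simp: prod_encode_eq)
  have "{i. i < l \<and> (i, l) \<in> same_block ns \<and> (i, l) \<in> X} = fst ` {x \<in> X. l = snd x}"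
    using X by (force simp: pos_roots_def)
  moreover have "card (fst ` {x \<in> X. l = snd x}) = card {x \<in> X. l = snd x}"
    by (rule card_image) (auto simp: inj_on_def)
  moreover have "{j. l < j \<and> (l, j) \<in> same_block ns \<and> (l, j) \<in> X} = snd ` {x \<in> X. l = fst x}"
    using X by (force simp: pos_roots_def)
  moreover have "card (snd ` {x \<in> X. l = fst x}) = card {x \<in> X. l = fst x}"
    by (rule card_image) (auto simp: inj_on_def)
  ultimately have "fweight ns (prod_encode ` X) l = int (card {x \<in> X. l = snd x}) - int (card {x \<in> X. l = fst x})"
    unfolding fweight_def m by simp
  also have "\<dots> = root_weight X l"
    unfolding root_weight_def case_prod_unfold sum_subtractf using fin by (simp add: Int_def)
  finally show ?thesis .
qed

lemma root_modes_eq: "root_modes ns = prod_encode ` pos_roots ns"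
  by (simp add: root_modes_def pos_roots_def)

lemma inj_prod_encode': "inj_on prod_encode A"
  by (simp add: inj_on_def prod_encode_eq)

text \<open>The signed count of pairs (exponent array, set of roots) becomes the number of even
  minus the number of odd elements of \<open>zero_weight\<close>, to which
  \<open>dim_inv_comp\<close> applies.\<close>

theorem torus_integral_dim:
  "torus_integral (sum_list ns) (\<lambda>z. integrand_coeff ns d k z * nu_density ns z) = of_nat (dim (inv_comp ns d k))"
proof -
  let ?n = "sum_list ns" and ?Z = "zero_weight ns d k"
  let ?P = "\<lambda>S e. \<forall>l<?n. mweight e l + fweight ns S l = 0"
  have "torus_integral ?n (\<lambda>z. integrand_coeff ns d k z * nu_density ns z)
    = (\<Sum>e\<in>Mon ns d k. \<Sum>X\<in>Pow (pos_roots ns). (-1) ^ card X * of_bool (\<forall>l<?n. mweight e l + root_weight X l = 0))"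
    unfolding torus_integral_weights sum.reindex_bij_betw[OF bij_betw_lookup_Mon, symmetric]
    by (intro sum.cong refl) (simp add: expo_weight_lookup)
  also have "\<dots> = (\<Sum>e\<in>Mon ns d k. \<Sum>S\<in>Pow (root_modes ns). (-1) ^ card S * of_bool (?P S e))"
  proof (rule sum.cong[OF refl])
    fix e
    have b: "bij_betw ((`) prod_encode) (Pow (pos_roots ns)) (Pow (root_modes ns))"
      unfolding root_modes_eq by (rule bij_betw_Pow) (simp add: bij_betw_def inj_prod_encode')
    show "(\<Sum>X\<in>Pow (pos_roots ns). (-1) ^ card X * of_bool (\<forall>l<?n. mweight e l + root_weight X l = 0))
      = (\<Sum>S\<in>Pow (root_modes ns). (-1) ^ card S * of_bool (?P S e) :: complex)"
      unfolding sum.reindex_bij_betw[OF b, symmetric]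
      by (rule sum.cong[OF refl]) (simp add: root_weight_fweight card_image[OF inj_prod_encode'])
  qed
  also have "\<dots> = (\<Sum>S\<in>Pow (root_modes ns). \<Sum>e\<in>Mon ns d k. (-1) ^ card S * of_bool (?P S e))"
    by (rule sum.swap)
  also have "\<dots> = (\<Sum>x\<in>Pow (root_modes ns) \<times> Mon ns d k. (-1) ^ card (fst x) * of_bool (?P (fst x) (snd x)))"
    by (simp only: sum.cartesian_product case_prod_unfold)
  also have "\<dots> = (\<Sum>x\<in>?Z. (-1) ^ card (fst x))"
    by (rule sum.mono_neutral_cong_right) (auto simp: zero_weight_def)
  also have "\<dots> = (\<Sum>x\<in>{x \<in> ?Z. even (card (fst x))}. (-1) ^ card (fst x)) + (\<Sum>x\<in>{x \<in> ?Z. odd (card (fst x))}. (-1) ^ card (fst x))"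
    by (subst sum.union_disjoint[symmetric]) (auto intro: sum.cong)
  also have "\<dots> = of_nat (card {x \<in> ?Z. even (card (fst x))}) - of_nat (card {x \<in> ?Z. odd (card (fst x))})"
    by simp
  also have "\<dots> = of_nat (dim (inv_comp ns d k))"
    unfolding dim_inv_comp by simp
  finally show ?thesis .
qed

section \<open>The pure trace ring over different fields\<close>

lemma lookup_fscale: "lookup (fscale c p) e = c * lookup p e"
  by (simp add: fscale_def)

lemma vector_space_fscale: "vector_space (fscale :: 'f::field \<Rightarrow> 'f mpoly \<Rightarrow> 'f mpoly)"
  by unfold_locales (simp_all add: fscale_def Const_mult Const_add algebra_simps)

interpretation mp: vector_space "fscale :: 'f::field \<Rightarrow> 'f mpoly \<Rightarrow> 'f mpoly"
  by (rule vector_space_fscale)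

lemma dim_real_mpoly: "dim (V :: real mpoly set) = mp.dim V"
proof -
  have "(fscale :: real \<Rightarrow> real mpoly \<Rightarrow> real mpoly) = scaleR"
    by (intro ext) (simp add: fscale_def scaleR_eq_Const_mult)
  then show ?thesis by (simp add: dim_raw_def)
qed

section \<open>Products of traces and their multidegrees\<close>

definition valid_word :: "nat list \<Rightarrow> nat \<Rightarrow> (nat \<times> nat) list \<Rightarrow> bool" where
  "valid_word ns d w \<longleftrightarrow> w \<noteq> [] \<and> (\<forall>(a, \<alpha>)\<in>set w. a < length ns \<and> \<alpha> < d)"

definition trace_prod :: "nat list \<Rightarrow> (nat \<times> nat) list list \<Rightarrow> 'f::comm_ring_1 mpoly" where
  "trace_prod ns ws = (\<Prod>w\<leftarrow>ws. mtr (sum_list ns) (wordmat ns w))"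

definition trace_prods :: "nat list \<Rightarrow> nat \<Rightarrow> 'f::comm_ring_1 mpoly set" where
  "trace_prods ns d = {trace_prod ns ws | ws. \<forall>w\<in>set ws. valid_word ns d w}"

definition homog :: "nat list \<Rightarrow> (var \<Rightarrow> nat) \<Rightarrow> 'f::comm_ring_1 mpoly \<Rightarrow> bool" where
  "homog ns k p \<longleftrightarrow> (\<forall>e\<in>keys p. mdeg ns e = k)"

lemma ptr_gens_eq: "ptr_gens ns d = {mtr (sum_list ns) (wordmat ns w) | w. valid_word ns d w}"
  by (simp add: ptr_gens_def valid_word_def)

text \<open>Products of traces are closed under multiplication, so the algebra needs only linear
  combinations of them. This yields a spanning set that is multihomogeneous and has rational
  coefficients.\<close>

lemma U_ptr_eq_span: "U_ptr ns d = mp.span (trace_prods ns d :: 'f::field mpoly set)"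
proof
  let ?T = "trace_prods ns d :: 'f mpoly set"
  have one: "1 \<in> ?T" unfolding trace_prods_def trace_prod_def by (intro CollectI exI[of _ "[]"]) simp
  have mult: "p * q \<in> ?T" if pq: "p \<in> ?T" "q \<in> ?T" for p q
  proof -
    obtain ws vs where "p = trace_prod ns ws" "\<forall>w\<in>set ws. valid_word ns d w" "q = trace_prod ns vs" "\<forall>w\<in>set vs. valid_word ns d w"
      using pq unfolding trace_prods_def by blast
    then show ?thesis unfolding trace_prods_def
      by (intro CollectI exI[of _ "ws @ vs"]) (auto simp: trace_prod_def)
  qed
  have smult: "p * q \<in> mp.span ?T" if "p \<in> mp.span ?T" "q \<in> mp.span ?T" for p q
    using that(1)
  proof (induction rule: mp.span_induct_alt)
    case (step c x y)
    have "x * q \<in> mp.span ?T" using that(2)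
    proof (induction rule: mp.span_induct_alt)
      case (step c' x' y')
      have "x * (fscale c' x' + y') = fscale c' (x * x') + x * y'" by (simp add: fscale_def algebra_simps)
      then show ?case using step \<open>x \<in> ?T\<close> by (simp add: mp.span_add mp.span_scale mp.span_base mult)
    qed (simp add: mp.span_zero)
    moreover have "(fscale c x + y) * q = fscale c (x * q) + y * q" by (simp add: fscale_def algebra_simps)
    ultimately show ?case using step by (simp add: mp.span_add mp.span_scale)
  qed (simp add: mp.span_zero)
  show "U_ptr ns d \<subseteq> mp.span ?T"
  proof
    fix p :: "'f mpoly" assume "p \<in> U_ptr ns d"
    then show "p \<in> mp.span ?T" unfolding U_ptr_def
    proof (induction rule: subalg.induct)
      case (gen p)
      then obtain w where "p = mtr (sum_list ns) (wordmat ns w)" "valid_word ns d w" unfolding ptr_gens_eq by blast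
      then have "p \<in> ?T" unfolding trace_prods_def by (intro CollectI exI[of _ "[w]"]) (simp add: trace_prod_def)
      then show ?case by (rule mp.span_base)
    next
      case (const c)
      have "Const c = fscale c 1" by (simp add: fscale_def)
      then show ?case using one by (simp add: mp.span_scale mp.span_base)
    qed (auto intro: mp.span_add smult)
  qed
  show "mp.span ?T \<subseteq> U_ptr ns d"
  proof (rule mp.span_minimal)
    show "?T \<subseteq> U_ptr ns d"
    proof
      fix p assume "p \<in> ?T"
      then obtain ws where p: "p = trace_prod ns ws" and ws: "\<forall>w\<in>set ws. valid_word ns d w" unfolding trace_prods_def by blast
      have "(trace_prod ns ws :: 'f mpoly) \<in> U_ptr ns d" using ws
      proof (induction ws)
        case Nil
        then show ?case using subalg.const[of 1] by (simp add: trace_prod_def U_ptr_def)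
      next
        case (Cons w ws)
        have "(mtr (sum_list ns) (wordmat ns w) :: 'f mpoly) \<in> ptr_gens ns d" using Cons.prems unfolding ptr_gens_eq by auto
        then have "(mtr (sum_list ns) (wordmat ns w) :: 'f mpoly) \<in> U_ptr ns d" unfolding U_ptr_def by (rule subalg.gen)
        then show ?case using Cons U_ptr_mult by (auto simp: trace_prod_def)
      qed
      then show "p \<in> U_ptr ns d" by (simp add: p)
    qed
    show "mp.subspace (U_ptr ns d :: 'f mpoly set)"
    proof (rule mp.subspaceI)
      show "0 \<in> U_ptr ns d" using U_ptr_sum[of "{}"] by simp
      show "x + y \<in> U_ptr ns d" if "x \<in> U_ptr ns d" "y \<in> U_ptr ns d" for x y using that by (rule U_ptr_add)
      show "fscale c x \<in> U_ptr ns d" if "x \<in> U_ptr ns d" for c and x :: "'f mpoly"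
        unfolding fscale_def by (rule U_ptr_mult[OF _ that]) (simp add: U_ptr_def subalg.const)
    qed
  qed
qed

text \<open>\<open>b\<close> is the block of the column index at the end of the word, and so stands
  in for the next letter after the last one. In a trace the word closes up, and \<open>b\<close> is
  the block of its first letter.\<close>

fun word_head :: "(nat \<times> nat) list \<Rightarrow> nat \<Rightarrow> nat" where
  "word_head [] b = b"
| "word_head ((a, \<alpha>) # w) b = a"

fun word_deg :: "(nat \<times> nat) list \<Rightarrow> nat \<Rightarrow> var \<Rightarrow> nat" where
  "word_deg [] b = (\<lambda>_. 0)"
| "word_deg ((a, \<alpha>) # w) b = (\<lambda>key. of_bool ((a, word_head w b, \<alpha>) = key) + word_deg w b key)"

text \<open>Each idempotent fixes the block of the row index of its matrix, and the column index of
  that matrix is the row index of the rest of the word. The multidegree is thus determined by the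
  word and the block of \<open>j\<close> alone.\<close>

lemma keys_wordmat:
  assumes "\<forall>(a, \<alpha>)\<in>set w. a < length ns \<and> \<alpha> < d" "j < sum_list ns" "i < sum_list ns"
    "e \<in> keys (wordmat ns w i j :: 'f::comm_ring_1 mpoly)"
  shows "blk ns i = word_head w (blk ns j) \<and> mdeg ns e = word_deg w (blk ns j) \<and> keys e \<subseteq> varidx ns d"
  using assms
proof (induction w arbitrary: i e)
  case Nil
  have "mdeg ns 0 = (\<lambda>_. 0)" by (rule ext) (simp add: mdeg_def)
  then show ?case using Nil by (auto simp: mid_def split: if_splits)
next
  case (Cons x w)
  obtain a \<alpha> where x: "x = (a, \<alpha>)" by (cases x)
  have a: "a < length ns" "\<alpha> < d" using Cons.prems x by auto
  have e: "e \<in> keys (if i \<in> blockset ns a then \<Sum>k<sum_list ns. Var (i, k, \<alpha>) * wordmat ns w k j else 0 :: 'f mpoly)"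
    using Cons.prems(4) unfolding x wordmat_Cons[OF a(1)] .
  then have i: "i \<in> blockset ns a" by (auto split: if_splits)
  then have "e \<in> keys (\<Sum>k<sum_list ns. Var (i, k, \<alpha>) * wordmat ns w k j :: 'f mpoly)" using e by simp
  from subsetD[OF keys_sum this] obtain k where k: "k < sum_list ns" "e \<in> keys (Var (i, k, \<alpha>) * wordmat ns w k j :: 'f mpoly)"
    by auto
  from subsetD[OF keys_mult k(2)] obtain e1 e2 where e12: "e = e1 + e2" "e1 \<in> keys (Var (i, k, \<alpha>) :: 'f mpoly)"
    "e2 \<in> keys (wordmat ns w k j :: 'f mpoly)" by blast
  have e1: "e1 = single (i, k, \<alpha>) 1" using e12(2) by (simp add: Var_def split: if_splits)
  have IH: "blk ns k = word_head w (blk ns j) \<and> mdeg ns e2 = word_deg w (blk ns j) \<and> keys e2 \<subseteq> varidx ns d"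
    using Cons.IH[OF _ Cons.prems(2) k(1) e12(3)] Cons.prems(1) by simp
  have bi: "blk ns i = a" using i a by (simp add: in_blockset_iff)
  have "mdeg ns e = word_deg (x # w) (blk ns j)"
    by (rule ext) (use IH bi in \<open>simp add: e12(1) e1 mdeg_add mdeg_single[unfolded One_nat_def] x vdeg_def\<close>)
  moreover have "keys e \<subseteq> varidx ns d"
    using IH Cons.prems(3) k(1) a(2) by (auto simp: e12(1) e1 keys_add_monomial varidx_def)
  ultimately show ?case using bi by (simp add: x)
qed

lemma keys_mtr_wordmat:
  assumes w: "valid_word ns d w" and e: "e \<in> keys (mtr (sum_list ns) (wordmat ns w) :: 'f::comm_ring_1 mpoly)"
  shows "mdeg ns e = word_deg w (fst (hd w)) \<and> keys e \<subseteq> varidx ns d"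
proof -
  from subsetD[OF keys_sum e[unfolded mtr_def]] obtain i where i: "i < sum_list ns" "e \<in> keys (wordmat ns w i i :: 'f mpoly)"
    by auto
  obtain a \<alpha> w' where "w = (a, \<alpha>) # w'" using w unfolding valid_word_def by (metis list.exhaust surj_pair)
  then show ?thesis using keys_wordmat[OF _ i(1) i(1) i(2), of d] w unfolding valid_word_def by auto
qed

lemma keys_trace_prod:
  assumes "\<forall>w\<in>set ws. valid_word ns d w" "e \<in> keys (trace_prod ns ws :: 'f::comm_ring_1 mpoly)"
  shows "mdeg ns e = (\<lambda>key. \<Sum>w\<leftarrow>ws. word_deg w (fst (hd w)) key) \<and> keys e \<subseteq> varidx ns d"
  using assms
proof (induction ws arbitrary: e)
  case Nil
  have "mdeg ns 0 = (\<lambda>_. 0)" by (rule ext) (simp add: mdeg_def)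
  then show ?case using Nil by (simp add: trace_prod_def split: if_splits)
next
  case (Cons w ws)
  have "e \<in> keys (mtr (sum_list ns) (wordmat ns w) * trace_prod ns ws :: 'f mpoly)"
    using Cons.prems(2) by (simp add: trace_prod_def)
  from subsetD[OF keys_mult this] obtain e1 e2 where e12: "e = e1 + e2" "e1 \<in> keys (mtr (sum_list ns) (wordmat ns w) :: 'f mpoly)"
    "e2 \<in> keys (trace_prod ns ws :: 'f mpoly)" by blast
  have 1: "mdeg ns e1 = word_deg w (fst (hd w)) \<and> keys e1 \<subseteq> varidx ns d"
    using Cons.prems(1) by (intro keys_mtr_wordmat[OF _ e12(2)]) simp
  have 2: "mdeg ns e2 = (\<lambda>key. \<Sum>w\<leftarrow>ws. word_deg w (fst (hd w)) key) \<and> keys e2 \<subseteq> varidx ns d"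
    using Cons.prems(1) by (intro Cons.IH e12(3)) simp
  have "mdeg ns e = (\<lambda>key. \<Sum>w\<leftarrow>w # ws. word_deg w (fst (hd w)) key)"
    by (rule ext) (use 1 2 in \<open>simp add: e12(1) mdeg_add\<close>)
  then show ?case using 1 2 by (simp add: e12(1) keys_add_monomial)
qed

text \<open>The projection \<open>proj\<close> to multidegree \<open>k\<close> is linear and either
  fixes or kills a product of traces, since such a product is multihomogeneous.\<close>

lemma hcomp_eq_span:
  "hcomp ns (U_ptr ns d) k = mp.span {p \<in> trace_prods ns d. homog ns k (p :: 'f::field mpoly)}"
proof
  let ?T = "trace_prods ns d :: 'f mpoly set"
  let ?G = "{p \<in> ?T. homog ns k p}"
  define proj :: "'f mpoly \<Rightarrow> 'f mpoly" where
    "proj p = (\<Sum>e\<in>{e \<in> keys p. mdeg ns e = k}. single e (lookup p e))" for p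
  have lk: "lookup (proj p) e = (if mdeg ns e = k then lookup p e else 0)" for p e
    by (simp add: proj_def lookup_sum lookup_single when_def in_keys_iff)
  have pr: "proj (fscale c p + q) = fscale c (proj p) + proj q" for c p q
    by (rule poly_mapping_eqI) (simp add: lk lookup_add fscale_def)
  have p0: "proj 0 = 0" by (simp add: proj_def)
  show "hcomp ns (U_ptr ns d) k \<subseteq> mp.span ?G"
  proof
    fix p :: "'f mpoly" assume p: "p \<in> hcomp ns (U_ptr ns d) k"
    have "proj p \<in> mp.span ?G" if "p \<in> mp.span ?T" for p using that
    proof (induction rule: mp.span_induct_alt)
      case (step c x y)
      obtain ws where ws: "x = trace_prod ns ws" "\<forall>w\<in>set ws. valid_word ns d w" using step(1) unfolding trace_prods_def by blast
      let ?k = "\<lambda>key. \<Sum>w\<leftarrow>ws. word_deg w (fst (hd w)) key"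
      have hx: "mdeg ns e = ?k" if "e \<in> keys x" for e
        using keys_trace_prod[OF ws(2), of e] that ws(1) by blast
      have "proj x \<in> mp.span ?G"
      proof (cases "?k = k")
        case True
        have "proj x = x" by (rule poly_mapping_eqI) (use hx True in \<open>auto simp: lk in_keys_iff\<close>)
        moreover have "x \<in> ?G" using step(1) hx True by (auto simp: homog_def)
        ultimately show ?thesis by (simp add: mp.span_base)
      next
        case False
        have "proj x = 0" by (rule poly_mapping_eqI) (use hx False in \<open>auto simp: lk in_keys_iff\<close>)
        then show ?thesis by (simp add: mp.span_zero)
      qed
      then show ?case unfolding pr using step by (simp add: mp.span_add mp.span_scale)
    qed (simp add: p0 mp.span_zero)
    from this[of p] have "proj p \<in> mp.span ?G" using p by (simp add: hcomp_def U_ptr_eq_span)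
    moreover have "proj p = p" by (rule poly_mapping_eqI) (use p in \<open>auto simp: lk hcomp_def in_keys_iff\<close>)
    ultimately show "p \<in> mp.span ?G" by simp
  qed
  show "mp.span ?G \<subseteq> hcomp ns (U_ptr ns d) k"
  proof
    fix p assume p: "p \<in> mp.span ?G"
    have "p \<in> U_ptr ns d" unfolding U_ptr_eq_span using p mp.span_mono[of ?G ?T] by auto
    moreover have "proj p = p" using p
    proof (induction rule: mp.span_induct_alt)
      case (step c x y)
      have "proj x = x" by (rule poly_mapping_eqI) (use step(1) in \<open>auto simp: lk homog_def in_keys_iff\<close>)
      then show ?case unfolding pr using step by simp
    qed (rule p0)
    then have "mdeg ns e = k" if "e \<in> keys p" for e
      using that lk[of p e] by (auto simp: in_keys_iff split: if_splits)
    ultimately show "p \<in> hcomp ns (U_ptr ns d) k" by (simp add: hcomp_def)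
  qed
qed

section \<open>Extension of scalars from the rationals\<close>

definition rat_embed :: "rat mpoly \<Rightarrow> 'f::field_char_0 mpoly" where
  "rat_embed = eval_hom (\<lambda>c. Const (of_rat c)) Var"

interpretation rat_hom: coeff_hom "\<lambda>c. Const (of_rat c) :: 'f::field_char_0 mpoly"
  by unfold_locales (simp_all add: of_rat_add of_rat_mult Const_add Const_mult)

lemma lookup_rat_embed: "lookup (rat_embed p :: 'f::field_char_0 mpoly) e = of_rat (lookup p e)"
proof -
  have "rat_embed (single e c) = (single e (of_rat c) :: 'f mpoly)" for e c
  proof -
    have "Const (of_rat c) * meval Var e = (single e (of_rat c) :: 'f mpoly)"
    proof (induction e rule: monomial_induct)
      case zero
      then show ?case by (simp add: meval_def Const_def)
    next
      case (add_single e v)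
      have "meval Var (single v 1) = (Var v :: 'f mpoly)" by (simp add: meval_def)
      then show ?case using add_single Var_mult_single[of v e "of_rat c :: 'f"] by (simp add: meval_add mult_ac)
    qed
    then show ?thesis by (simp add: rat_embed_def rat_hom.eval_hom_single)
  qed
  then have "(rat_embed p :: 'f mpoly) = (\<Sum>e\<in>keys p. single e (of_rat (lookup p e)))"
    by (subst poly_mapping_sum_single[of p]) (simp add: rat_embed_def rat_hom.eval_hom_sum)
  then show ?thesis by (simp add: lookup_sum lookup_single when_def in_keys_iff)
qed

lemma rat_embed_wordmat:
  assumes "\<forall>(a, \<alpha>)\<in>set w. a < length ns"
  shows "rat_embed (wordmat ns w i j) = (wordmat ns w i j :: 'f::field_char_0 mpoly)"
  using assms
proof (induction w arbitrary: i j)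
  case Nil
  then show ?case by (simp add: mid_def rat_embed_def)
next
  case (Cons x w)
  obtain a \<alpha> where x: "x = (a, \<alpha>)" by (cases x)
  have a: "a < length ns" using Cons.prems x by auto
  have IH: "rat_embed (wordmat ns w i j) = (wordmat ns w i j :: 'f mpoly)" for i j using Cons by auto
  show ?case unfolding x wordmat_Cons[OF a]
    using IH by (simp add: rat_embed_def rat_hom.eval_hom_sum rat_hom.eval_hom_mult)
qed

lemma rat_embed_trace_prod:
  assumes "\<forall>w\<in>set ws. valid_word ns d w"
  shows "rat_embed (trace_prod ns ws) = (trace_prod ns ws :: 'f::field_char_0 mpoly)"
proof -
  have "rat_embed (mtr (sum_list ns) (wordmat ns w)) = (mtr (sum_list ns) (wordmat ns w) :: 'f mpoly)" if "w \<in> set ws" for w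
  proof -
    have v: "\<forall>(a, \<alpha>)\<in>set w. a < length ns" using assms that unfolding valid_word_def by fastforce
    show ?thesis
      by (simp add: mtr_def rat_embed_def rat_hom.eval_hom_sum rat_embed_wordmat[OF v, unfolded rat_embed_def])
  qed
  then have m: "map (\<lambda>w. rat_embed (mtr (sum_list ns) (wordmat ns w))) ws = map (\<lambda>w. mtr (sum_list ns) (wordmat ns w) :: 'f mpoly) ws"
    by simp
  have "(rat_embed (trace_prod ns ws) :: 'f mpoly) = prod_list (map (\<lambda>w. rat_embed (mtr (sum_list ns) (wordmat ns w))) ws)"
    by (simp add: trace_prod_def rat_embed_def rat_hom.eval_hom_prod_list o_def)
  then show ?thesis unfolding m by (simp only: trace_prod_def)
qed

lemma rat_embed_trace_prods:
  "{p \<in> trace_prods ns d. homog ns k (p :: 'f::field_char_0 mpoly)} = rat_embed ` {p \<in> trace_prods ns d. homog ns k p}"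
proof -
  have h: "homog ns k (rat_embed p :: 'f mpoly) \<longleftrightarrow> homog ns k p" for p
  proof -
    have "keys (rat_embed p :: 'f mpoly) = keys p"
      by (auto simp: in_keys_iff lookup_rat_embed)
    then show ?thesis by (simp add: homog_def)
  qed
  have "trace_prods ns d = (rat_embed ` trace_prods ns d :: 'f mpoly set)"
  proof (intro equalityI subsetI)
    fix p :: "'f mpoly" assume "p \<in> trace_prods ns d"
    then obtain ws where "p = trace_prod ns ws" and ws: "\<forall>w\<in>set ws. valid_word ns d w" unfolding trace_prods_def by blast
    then have "p = rat_embed (trace_prod ns ws)" using rat_embed_trace_prod[OF ws, where 'f = 'f] by simp
    moreover have "trace_prod ns ws \<in> trace_prods ns d" unfolding trace_prods_def using ws by blast
    ultimately show "p \<in> rat_embed ` trace_prods ns d" by (rule image_eqI)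
  next
    fix p :: "'f mpoly" assume "p \<in> rat_embed ` trace_prods ns d"
    then obtain ws where "p = rat_embed (trace_prod ns ws)" and ws: "\<forall>w\<in>set ws. valid_word ns d w" unfolding trace_prods_def by blast
    then show "p \<in> trace_prods ns d" unfolding trace_prods_def using rat_embed_trace_prod[OF ws, where 'f = 'f] by auto
  qed
  then show ?thesis using h by auto
qed

text \<open>Apply \<open>\<rat>\<close>-linear functionals of the larger field to the coefficients of a linear relation.\<close>

lemma independent_rat_embed:
  assumes "mp.independent (B :: rat mpoly set)"
  shows "mp.independent (rat_embed ` B :: 'f::field_char_0 mpoly set)" "inj (rat_embed :: rat mpoly \<Rightarrow> 'f mpoly)"
proof -
  show inj: "inj (rat_embed :: rat mpoly \<Rightarrow> 'f mpoly)"
  proof (rule injI)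
    fix p q :: "rat mpoly" assume e: "(rat_embed p :: 'f mpoly) = rat_embed q"
    have "of_rat (lookup p e) = (of_rat (lookup q e) :: 'f)" for e
      unfolding lookup_rat_embed[symmetric] e ..
    then show "p = q" by (intro poly_mapping_eqI) simp
  qed
  interpret Q: vector_space "\<lambda>(q :: rat) (x :: 'f). of_rat q * x"
    by unfold_locales (simp_all add: of_rat_add of_rat_mult algebra_simps)
  interpret R: vector_space "(*) :: rat \<Rightarrow> rat \<Rightarrow> rat"
    by unfold_locales (simp_all add: algebra_simps)
  interpret QR: vector_space_pair "\<lambda>(q :: rat) (x :: 'f). of_rat q * x" "(*) :: rat \<Rightarrow> rat \<Rightarrow> rat" ..
  show "mp.independent (rat_embed ` B :: 'f mpoly set)"
    unfolding mp.independent_explicit_module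
  proof (intro allI impI)
    fix t :: "'f mpoly set" and u v
    assume t: "finite t" "t \<subseteq> rat_embed ` B" and z: "(\<Sum>v\<in>t. fscale (u v) v) = 0" and v: "v \<in> t"
    obtain s where s: "s \<subseteq> B" "t = rat_embed ` s" using t(2) by (meson subset_imageE)
    have fs: "finite s" using t(1) s(2) inj by (metis finite_imageD inj_on_subset subset_UNIV)
    obtain b where b: "b \<in> s" "v = rat_embed b" using v s by blast
    have inj_s: "inj_on (rat_embed :: rat mpoly \<Rightarrow> 'f mpoly) s" using inj by (rule inj_on_subset) simp
    show "u v = 0"
    proof (rule ccontr)
      assume n: "u v \<noteq> 0"
      \<comment> \<open>A single nonzero scalar is independent over the rationals, so some rational
        functional \<open>g\<close> takes the value 1 on it. Applied to all coefficients,
        \<open>g\<close> yields a rational relation among the elements of \<open>B\<close> that is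
        nontrivial at \<open>b\<close>.\<close>
      have "Q.independent {u v}" using n by simp
      from QR.linear_independent_extend[OF this, of "\<lambda>_. 1"]
      obtain g where g: "Vector_Spaces.linear (\<lambda>(q :: rat) (x :: 'f). of_rat q * x) (*) g" "g (u v) = 1" by auto
      interpret g: Vector_Spaces.linear "\<lambda>(q :: rat) (x :: 'f). of_rat q * x" "(*)" g by fact
      have "(\<Sum>b\<in>s. fscale (g (u (rat_embed b))) b) = 0"
      proof (rule poly_mapping_eqI)
        fix e
        have "0 = lookup (\<Sum>v\<in>t. fscale (u v) v) e" by (simp add: z)
        also have "\<dots> = (\<Sum>b\<in>s. of_rat (lookup b e) * u (rat_embed b))"
          unfolding s(2) sum.reindex[OF inj_s] by (simp add: lookup_sum lookup_fscale lookup_rat_embed mult.commute)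
        finally have "g 0 = g (\<Sum>b\<in>s. of_rat (lookup b e) * u (rat_embed b))" by simp
        also have "\<dots> = (\<Sum>b\<in>s. lookup b e * g (u (rat_embed b)))"
          by (simp add: g.sum g.scale)
        finally show "lookup (\<Sum>b\<in>s. fscale (g (u (rat_embed b))) b) e = lookup 0 e"
          by (simp add: lookup_sum lookup_fscale mult.commute g.zero)
      qed
      then have "g (u (rat_embed b)) = 0"
        using mp.independentD[OF assms fs s(1), of "\<lambda>b. g (u (rat_embed b))" b] b by blast
      then show False using g b by simp
    qed
  qed
qed

lemma dim_rat_embed: "mp.dim (rat_embed ` G :: 'f::field_char_0 mpoly set) = mp.dim (G :: rat mpoly set)"
proof -
  obtain B where B: "B \<subseteq> G" "mp.independent B" "G \<subseteq> mp.span B" "card B = mp.dim G"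
    using mp.basis_exists by blast
  show ?thesis
  proof (rule mp.dim_unique)
    show "rat_embed ` B \<subseteq> rat_embed ` G" using B(1) by blast
    show "mp.independent (rat_embed ` B :: 'f mpoly set)" by (rule independent_rat_embed(1)[OF B(2)])
    show "card (rat_embed ` B :: 'f mpoly set) = mp.dim G"
      using B(4) independent_rat_embed(2)[OF B(2)] by (metis card_image inj_on_subset subset_UNIV)
    show "rat_embed ` G \<subseteq> mp.span (rat_embed ` B :: 'f mpoly set)"
    proof
      fix y :: "'f mpoly" assume "y \<in> rat_embed ` G"
      then obtain p where p: "p \<in> mp.span B" "y = rat_embed p" using B(3) by blast
      have "(rat_embed p :: 'f mpoly) \<in> mp.span (rat_embed ` B)" using p(1)
      proof (induction rule: mp.span_induct_alt)
        case (step c x y)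
        have "(rat_embed (fscale c x + y) :: 'f mpoly) = fscale (of_rat c) (rat_embed x) + rat_embed y"
          by (simp add: rat_embed_def fscale_def rat_hom.eval_hom_add rat_hom.eval_hom_mult)
        then show ?case using step by (simp add: mp.span_add mp.span_scale mp.span_base)
      qed (simp add: rat_embed_def mp.span_zero)
      then show "y \<in> mp.span (rat_embed ` B)" by (simp add: p)
    qed
  qed
qed

lemma poincare_coeff_eq_rat:
  "poincare_coeff TYPE('f::field_char_0) ns d k = mp.dim {p \<in> trace_prods ns d. homog ns k (p :: rat mpoly)}"
  unfolding poincare_coeff_def hcomp_eq_span mp.dim_span rat_embed_trace_prods[where 'f = 'f] dim_rat_embed ..

text \<open>A fixed multidegree determines the total degree, so the first fundamental theorem
  applies to each invariant of multidegree \<open>k\<close>.\<close>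

lemma inv_comp_eq_hcomp: "inv_comp ns d k = hcomp ns (U_ptr ns d) k"
proof
  show "inv_comp ns d k \<subseteq> hcomp ns (U_ptr ns d) k"
  proof
    fix p assume p: "p \<in> inv_comp ns d k"
    then have "hom_in (varidx ns d) (\<Sum>key\<in>vdeg ns ` varidx ns d. k key) p"
      using tdeg_mdeg unfolding hom_in_def inv_comp_def by (auto simp: Mon_def)
    then have "p \<in> U_ptr ns d" using p first_fundamental_theorem by (auto simp: inv_comp_def)
    then show "p \<in> hcomp ns (U_ptr ns d) k" using p by (auto simp: hcomp_def inv_comp_def Mon_def)
  qed
  show "hcomp ns (U_ptr ns d) k \<subseteq> inv_comp ns d k"
  proof
    fix p :: "real mpoly" assume p: "p \<in> hcomp ns (U_ptr ns d) k"
    then have U: "p \<in> U_ptr ns d" and k: "\<forall>e\<in>keys p. mdeg ns e = k" by (simp_all add: hcomp_def)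
    have "p \<in> mp.span (trace_prods ns d)" using U by (simp add: U_ptr_eq_span)
    then have "vars_in (varidx ns d) p"
    proof (induction rule: mp.span_induct_alt)
      case (step c x y)
      obtain ws where ws: "x = trace_prod ns ws" "\<forall>w\<in>set ws. valid_word ns d w" using step(1) unfolding trace_prods_def by blast
      have x: "vars_in (varidx ns d) x" unfolding vars_in_def ws(1) using keys_trace_prod[OF ws(2)] by blast
      show ?case unfolding vars_in_def
      proof
        fix e assume "e \<in> keys (fscale c x + y)"
        then have "e \<in> keys x \<or> e \<in> keys y" by (auto simp: in_keys_iff lookup_add fscale_def)
        then show "keys e \<subseteq> varidx ns d" using x step unfolding vars_in_def by blast
      qed
    qed (simp add: vars_in_def)
    then show "p \<in> inv_comp ns d k"
      using U_ptr_inv[OF U] k by (auto simp: inv_comp_def Mon_def vars_in_def)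
  qed
qed

text \<open>The rational dimension is the bridge from an arbitrary field of characteristic zero to
  the reals, where positivity of the apolar product is available.\<close>

lemma poincare_coeff_eq_dim: "poincare_coeff TYPE('f::field_char_0) ns d k = dim (inv_comp ns d k)"
proof -
  have "poincare_coeff TYPE('f) ns d k = poincare_coeff TYPE(real) ns d k"
    unfolding poincare_coeff_eq_rat ..
  also have "\<dots> = dim (inv_comp ns d k)"
    unfolding poincare_coeff_def inv_comp_eq_hcomp dim_real_mpoly ..
  finally show ?thesis .
qed

theorem theorem3p3:
  fixes ns :: "nat list" and d :: nat
  assumes "\<forall>c \<in> set ns. 0 < c"
  shows "\<forall>k :: var \<Rightarrow> nat.
    of_nat (poincare_coeff TYPE('f::field_char_0) ns d k) =
    torus_integral (sum_list ns) (\<lambda>z. integrand_coeff ns d k z * nu_density ns z)"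
  unfolding poincare_coeff_eq_dim torus_integral_dim by simp

end
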